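(* Let $\Gamma$ be a finitely generated $\delta$-hyperbolic group (with respect to a finite symmetric generating set $S_\Gamma$) and let $p>108\,\delta \operatorname{Ent}(S_\Gamma)+2$. Assume that there exists a cobounded $(\mathrm{L}^p,\mathrm{L}^{\infty})$-integrable measure equivalence coupling from $\Gamma$ to a finitely generated group $\Lambda$. Then $\Lambda$ is hyperbolic.
   Context: A geodesic metric space $(X,d)$ is $\delta$-hyperbolic ($\delta\ge 0$) if each side of every geodesic triangle is contained in the $\delta$-neighbourhood of the union of the other two sides; it is hyperbolic if it is $\delta$-hyperbolic for some $\delta$. A finitely generated group is ($\delta$-)hyperbolic if its Cayley graph with respect to its given finite generating set, with edges identified with unit intervals and endowed with the path metric, is ($\delta$-)hyperbolic. The growth function is $\operatorname{Vol}_{S_\Gamma}(n)=|S_\Gamma^n|$ and the volume entropy is $\operatorname{Ent}(S_\Gamma)=\limsup_{r\to\infty}\frac{\log(\operatorname{Vol}_{S_\Gamma}(r))}{r}$ (natural logarithm). A measure equivalence coupling from a countable group $\Gamma$ to a countable group $\Lambda$ is a tuple $(\Omega,\mu,X_\Gamma,X_\Lambda)$ where $(\Omega,\mu)$ is a nonzero $\sigma$-finite standard measured space endowed with commuting free measure-preserving actions of $\Gamma$ and $\Lambda$ (both denoted $*$), and $X_\Gamma$, $X_\Lambda\subseteq\Omega$ are finite measure fundamental domains for the $\Gamma$-action and the $\Lambda$-action respectively. Here a fundamental domain for the $\Gamma$-action is a measurable subset $X_\Gamma\subseteq\Omega$ such that $\Gamma\times X_\Gamma\to\Omega$, $(\gamma,x)\mapsto\gamma*x$,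 is a measure-preserving bijection for the product of counting measure and $\mu|_{X_\Gamma}$ (similarly for $\Lambda$). The associated cocycles $\alpha:\Gamma\times X_\Lambda\to\Lambda$ and $\beta:\Lambda\times X_\Gamma\to\Gamma$ are uniquely defined by $\alpha(\gamma,x)*(\gamma*x)\in X_\Lambda$ for $\gamma\in\Gamma$, $x\in X_\Lambda$, and $\beta(\lambda,x)*(\lambda*x)\in X_\Gamma$ for $\lambda\in\Lambda$, $x\in X_\Gamma$. The coupling is cobounded if $X_\Gamma$ is contained in the union of finitely many $\Lambda$-translates of $X_\Lambda$. Let $S_\Lambda$ be a finite generating set of $\Lambda$, with word lengths $|\cdot|_{S_\Gamma},|\cdot|_{S_\Lambda}$. The coupling is $(\mathrm{L}^p,\mathrm{L}^\infty)$-integrable if $\int_{X_\Lambda}|\alpha(s,x)|_{S_\Lambda}^p\,d\mu(x)<+\infty$ for all $s\in S_\Gamma$ and, for all $t\in S_\Lambda$, the map $x\mapsto|\beta(t,x)|_{S_\Gamma}$ is essentially bounded on $X_\Gamma$. (This does not depend on the choice of finite generating sets.) *)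

theory Defs
  imports
    "HOL-Analysis.Analysis"
    "HOL-Algebra.Generated_Groups"
    "HOL-Algebra.Group_Action"
begin

section \<open>Hyperbolic metric spaces\<close>

definition geodesic_segment ::
  "'p set \<Rightarrow> ('p \<Rightarrow> 'p \<Rightarrow> real) \<Rightarrow> 'p \<Rightarrow> 'p \<Rightarrow> 'p set \<Rightarrow> bool" where
  "geodesic_segment M d x y A \<longleftrightarrow>
     (\<exists>c. c \<in> {0..d x y} \<rightarrow> M \<and> c 0 = x \<and> c (d x y) = y \<and>
        (\<forall>s\<in>{0..d x y}. \<forall>t\<in>{0..d x y}. d (c s) (c t) = \<bar>s - t\<bar>) \<and>
        A = c ` {0..d x y})"

definition geodesic_metric_space :: "'p set \<Rightarrow> ('p \<Rightarrow> 'p \<Rightarrow> real) \<Rightarrow> bool" where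
  "geodesic_metric_space M d \<longleftrightarrow>
     Metric_space M d \<and> (\<forall>x\<in>M. \<forall>y\<in>M. \<exists>A. geodesic_segment M d x y A)"

text \<open>Neighbourhoods are closed, so that \<open>\<delta> = 0\<close> is meaningful (trees are 0-hyperbolic).\<close>

definition neighbourhood :: "'p set \<Rightarrow> ('p \<Rightarrow> 'p \<Rightarrow> real) \<Rightarrow> real \<Rightarrow> 'p set \<Rightarrow> 'p set" where
  "neighbourhood M d \<delta> A = {x \<in> M. \<exists>y\<in>A. d x y \<le> \<delta>}"

definition delta_hyperbolic_space :: "real \<Rightarrow> 'p set \<Rightarrow> ('p \<Rightarrow> 'p \<Rightarrow> real) \<Rightarrow> bool" where
  "delta_hyperbolic_space \<delta> M d \<longleftrightarrow>
     0 \<le> \<delta> \<and> geodesic_metric_space M d \<and>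
     (\<forall>x\<in>M. \<forall>y\<in>M. \<forall>z\<in>M. \<forall>A B C.
        geodesic_segment M d x y A \<and> geodesic_segment M d y z B \<and> geodesic_segment M d z x C \<longrightarrow>
          A \<subseteq> neighbourhood M d \<delta> (B \<union> C) \<and>
          B \<subseteq> neighbourhood M d \<delta> (C \<union> A) \<and>
          C \<subseteq> neighbourhood M d \<delta> (A \<union> B))"

section \<open>Finitely generated groups and their Cayley graphs\<close>

definition finite_generating_set :: "('g, 'a) monoid_scheme \<Rightarrow> 'g set \<Rightarrow> bool" where
  "finite_generating_set G S \<longleftrightarrow> finite S \<and> S \<subseteq> carrier G \<and> generate G S = carrier G"

primrec set_power :: "('g, 'a) monoid_scheme \<Rightarrow> 'g set \<Rightarrow> nat \<Rightarrow> 'g set" where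
  "set_power G S 0 = {\<one>\<^bsub>G\<^esub>}"
| "set_power G S (Suc n) = set_power G S n <#>\<^bsub>G\<^esub> S"

definition word_length :: "('g, 'a) monoid_scheme \<Rightarrow> 'g set \<Rightarrow> 'g \<Rightarrow> nat" where
  "word_length G S g = (LEAST n. g \<in> set_power G (S \<union> set_inv\<^bsub>G\<^esub> S) n)"

definition growth_function :: "('g, 'a) monoid_scheme \<Rightarrow> 'g set \<Rightarrow> nat \<Rightarrow> nat" where
  "growth_function G S n = card (set_power G S n)"

definition volume_entropy :: "('g, 'a) monoid_scheme \<Rightarrow> 'g set \<Rightarrow> ereal" where
  "volume_entropy G S = limsup (\<lambda>n. ereal (ln (real (growth_function G S n)) / real n))"

text \<open>
  The Cayley graph is realised in barycentric coordinates: a point is a function on vertices,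
  and \<open>edge_point u v t\<close> is the point at distance \<open>t\<close> from \<open>u\<close> on the unit interval from \<open>u\<close>
  to \<open>v\<close>. This makes the graph simple: parallel edges are identified, and an edge from \<open>u\<close> to
  itself (which arises if \<open>\<one> \<in> S\<close>) collapses to the vertex \<open>u\<close>, which is \<open>edge_point u u 0\<close>.
\<close>

definition cayley_edges :: "('g, 'a) monoid_scheme \<Rightarrow> 'g set \<Rightarrow> ('g \<times> 'g) set" where
  "cayley_edges G S = {(g, g \<otimes>\<^bsub>G\<^esub> s) | g s. g \<in> carrier G \<and> s \<in> S}"

definition edge_point :: "'g \<Rightarrow> 'g \<Rightarrow> real \<Rightarrow> 'g \<Rightarrow> real" where
  "edge_point u v t = (\<lambda>w. (1 - t) * indicator {u} w + t * indicator {v} w)"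

definition cayley_points :: "('g, 'a) monoid_scheme \<Rightarrow> 'g set \<Rightarrow> ('g \<Rightarrow> real) set" where
  "cayley_points G S =
     {edge_point u u 0 | u. u \<in> carrier G} \<union>
     {edge_point u v t | u v t. (u, v) \<in> cayley_edges G S \<and> t \<in> {0..1}}"

text \<open>
  \<open>cayley_path G S x y l\<close>: there is a piecewise linear path of length \<open>l\<close> from \<open>x\<close> to \<open>y\<close>,
  i.e. a finite concatenation of linear paths, each of which runs inside one edge.
\<close>

inductive cayley_path ::
  "('g, 'a) monoid_scheme \<Rightarrow> 'g set \<Rightarrow> ('g \<Rightarrow> real) \<Rightarrow> ('g \<Rightarrow> real) \<Rightarrow> real \<Rightarrow> bool"
  for G S where
  refl: "x \<in> cayley_points G S \<Longrightarrow> cayley_path G S x x 0"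
| step: "\<lbrakk>cayley_path G S x (edge_point u v t) l; (u, v) \<in> cayley_edges G S;
          t \<in> {0..1}; t' \<in> {0..1}\<rbrakk> \<Longrightarrow>
         cayley_path G S x (edge_point u v t') (l + \<bar>t - t'\<bar>)"

text \<open>
  The value \<open>0\<close> outside the realisation is only there because \<^locale>\<open>Metric_space\<close> requires
  nonnegativity everywhere.
\<close>

definition cayley_dist ::
  "('g, 'a) monoid_scheme \<Rightarrow> 'g set \<Rightarrow> ('g \<Rightarrow> real) \<Rightarrow> ('g \<Rightarrow> real) \<Rightarrow> real" where
  "cayley_dist G S x y =
     (if x \<in> cayley_points G S \<and> y \<in> cayley_points G S
      then Inf {l. cayley_path G S x y l} else 0)"

definition delta_hyperbolic_group :: "real \<Rightarrow> ('g, 'a) monoid_scheme \<Rightarrow> 'g set \<Rightarrow> bool" where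
  "delta_hyperbolic_group \<delta> G S \<longleftrightarrow>
     group G \<and> finite_generating_set G S \<and>
     delta_hyperbolic_space \<delta> (cayley_points G S) (cayley_dist G S)"

definition hyperbolic_group :: "('g, 'a) monoid_scheme \<Rightarrow> 'g set \<Rightarrow> bool" where
  "hyperbolic_group G S \<longleftrightarrow> (\<exists>\<delta>. delta_hyperbolic_group \<delta> G S)"

section \<open>Measure equivalence couplings\<close>

definition standard_borel_measure :: "'w measure \<Rightarrow> bool" where
  "standard_borel_measure M \<longleftrightarrow>
     (\<exists>T. completely_metrizable_space T \<and> second_countable T \<and> topspace T = space M \<and>
          sets M = sigma_sets (space M) {U. openin T U})"

definition free_mp_action ::
  "('g, 'a) monoid_scheme \<Rightarrow> 'w measure \<Rightarrow> ('g \<Rightarrow> 'w \<Rightarrow> 'w) \<Rightarrow> bool" where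
  "free_mp_action G M act \<longleftrightarrow>
     group_action G (space M) act \<and>
     (\<forall>g\<in>carrier G. \<forall>x\<in>space M. act g x = x \<longrightarrow> g = \<one>\<^bsub>G\<^esub>) \<and>
     (\<forall>g\<in>carrier G. act g \<in> M \<rightarrow>\<^sub>M M \<and> distr M M (act g) = M)"

definition fundamental_domain ::
  "('g, 'a) monoid_scheme \<Rightarrow> 'w measure \<Rightarrow> ('g \<Rightarrow> 'w \<Rightarrow> 'w) \<Rightarrow> 'w set \<Rightarrow> bool" where
  "fundamental_domain G M act X \<longleftrightarrow>
     X \<in> sets M \<and>
     bij_betw (\<lambda>(g, x). act g x) (carrier G \<times> X) (space M) \<and>
     (\<lambda>(g, x). act g x) \<in> count_space (carrier G) \<Otimes>\<^sub>M restrict_space M X \<rightarrow>\<^sub>M M \<and>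
     distr (count_space (carrier G) \<Otimes>\<^sub>M restrict_space M X) M (\<lambda>(g, x). act g x) = M"

locale me_coupling = sigma_finite_measure M
  for \<Gamma> :: "('g, 'a) monoid_scheme" and \<Lambda> :: "('h, 'b) monoid_scheme"
    and M :: "'w measure"
    and act\<^sub>\<Gamma> :: "'g \<Rightarrow> 'w \<Rightarrow> 'w" and act\<^sub>\<Lambda> :: "'h \<Rightarrow> 'w \<Rightarrow> 'w"
    and X\<^sub>\<Gamma> X\<^sub>\<Lambda> :: "'w set" +
  assumes countable_groups: "group \<Gamma>" "group \<Lambda>" "countable (carrier \<Gamma>)" "countable (carrier \<Lambda>)"
    and standard: "standard_borel_measure M"
    and nonzero: "emeasure M (space M) \<noteq> 0"
    and actions: "free_mp_action \<Gamma> M act\<^sub>\<Gamma>" "free_mp_action \<Lambda> M act\<^sub>\<Lambda>"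
    and actions_commute: "\<lbrakk>g \<in> carrier \<Gamma>; h \<in> carrier \<Lambda>; x \<in> space M\<rbrakk> \<Longrightarrow>
      act\<^sub>\<Gamma> g (act\<^sub>\<Lambda> h x) = act\<^sub>\<Lambda> h (act\<^sub>\<Gamma> g x)"
    and fundamental_domains:
      "fundamental_domain \<Gamma> M act\<^sub>\<Gamma> X\<^sub>\<Gamma>" "fundamental_domain \<Lambda> M act\<^sub>\<Lambda> X\<^sub>\<Lambda>"
    and finite_domains: "emeasure M X\<^sub>\<Gamma> < \<infinity>" "emeasure M X\<^sub>\<Lambda> < \<infinity>"

text \<open>
  With \<open>H = \<Lambda>\<close>, \<open>X = X\<^sub>\<Lambda>\<close> this is the cocycle \<open>\<alpha> : \<Gamma> \<times> X\<^sub>\<Lambda> \<Rightarrow> \<Lambda>\<close>; with the roles of the two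
  groups exchanged it is \<open>\<beta> : \<Lambda> \<times> X\<^sub>\<Gamma> \<Rightarrow> \<Gamma>\<close>.
\<close>

definition me_cocycle ::
  "('g \<Rightarrow> 'w \<Rightarrow> 'w) \<Rightarrow> ('h, 'b) monoid_scheme \<Rightarrow> ('h \<Rightarrow> 'w \<Rightarrow> 'w) \<Rightarrow> 'w set \<Rightarrow> 'g \<Rightarrow> 'w \<Rightarrow> 'h" where
  "me_cocycle act\<^sub>G H act\<^sub>H X g x = (THE h. h \<in> carrier H \<and> act\<^sub>H h (act\<^sub>G g x) \<in> X)"

definition cobounded ::
  "('h, 'b) monoid_scheme \<Rightarrow> ('h \<Rightarrow> 'w \<Rightarrow> 'w) \<Rightarrow> 'w set \<Rightarrow> 'w set \<Rightarrow> bool" where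
  "cobounded \<Lambda> act\<^sub>\<Lambda> X\<^sub>\<Gamma> X\<^sub>\<Lambda> \<longleftrightarrow>
     (\<exists>F. finite F \<and> F \<subseteq> carrier \<Lambda> \<and> X\<^sub>\<Gamma> \<subseteq> (\<Union>h\<in>F. act\<^sub>\<Lambda> h ` X\<^sub>\<Lambda>))"

definition Lp_Linf_integrable ::
  "real \<Rightarrow> ('g, 'a) monoid_scheme \<Rightarrow> 'g set \<Rightarrow> ('h, 'b) monoid_scheme \<Rightarrow> 'h set \<Rightarrow> 'w measure \<Rightarrow>
   ('g \<Rightarrow> 'w \<Rightarrow> 'w) \<Rightarrow> ('h \<Rightarrow> 'w \<Rightarrow> 'w) \<Rightarrow> 'w set \<Rightarrow> 'w set \<Rightarrow> bool" where
  "Lp_Linf_integrable p \<Gamma> S\<^sub>\<Gamma> \<Lambda> S\<^sub>\<Lambda> M act\<^sub>\<Gamma> act\<^sub>\<Lambda> X\<^sub>\<Gamma> X\<^sub>\<Lambda> \<longleftrightarrow>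
     (\<forall>s\<in>S\<^sub>\<Gamma>. (\<integral>\<^sup>+x\<in>X\<^sub>\<Lambda>.
        ennreal (real (word_length \<Lambda> S\<^sub>\<Lambda> (me_cocycle act\<^sub>\<Gamma> \<Lambda> act\<^sub>\<Lambda> X\<^sub>\<Lambda> s x)) powr p) \<partial>M) < \<infinity>) \<and>
     (\<forall>t\<in>S\<^sub>\<Lambda>. \<exists>C. AE x in M. x \<in> X\<^sub>\<Gamma> \<longrightarrow>
        word_length \<Gamma> S\<^sub>\<Gamma> (me_cocycle act\<^sub>\<Lambda> \<Gamma> act\<^sub>\<Gamma> X\<^sub>\<Gamma> t x) \<le> C)"

end

theory Submission
  imports Defs "HOL-Real_Asymp.Real_Asymp"
begin

text \<open>
  For \<open>x \<in> X\<^sub>\<Gamma>\<close> let \<open>f(\<lambda>) = \<beta>(\<lambda>\<^sup>-\<^sup>1, x)\<^sup>-\<^sup>1\<close>; since \<open>\<beta>\<close> is essentially bounded on generators, this is a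
  Lipschitz map from \<open>\<Lambda>\<close> to \<open>\<Gamma>\<close> for almost every \<open>x\<close>. By the \<open>L\<^sup>p\<close> condition, coboundedness and a union
  bound over the roughly \<open>exp(Ent k)\<close> elements of length at most \<open>k = O(\<delta> log n)\<close>, the probability that
  \<open>f\<close> brings two given points at distance \<open>n/300\<close> to distance at most \<open>k\<close> is at most
  \<open>n\<^sup>c\<^sup>-\<^sup>p\<close> up to logarithms, where \<open>c\<close> is a small multiple of \<open>\<delta> Ent\<close>. As \<open>p > 2 + c\<close>, some \<open>f\<close> does so for none of the
  \<open>O(n\<^sup>2)\<close> pairs formed from \<open>O(n)\<close> given points. In \<open>\<Gamma>\<close>, a chain of length \<open>O(n)\<close> passes
  within \<open>O(\<delta> log n)\<close> of each point of a geodesic joining its ends. So if a geodesic and a chain of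
  length \<open>n\<close> in \<open>\<Lambda>\<close> have the same ends, then their images under such an \<open>f\<close> come close to each other
  all along a geodesic of \<open>\<Gamma>\<close>, and the chain passes within \<open>n/100\<close> of each point of the original geodesic.

  This sublinear stability bounds the thinness of triangles: if a point \<open>m\<close> of a \<open>D\<close>-slim triangle were
  farther than \<open>D/2\<close> from the other two sides, then a detour of length less than \<open>40 D\<close> around the ball of
  radius \<open>D/2\<close> about \<open>m\<close> would contradict stability. Hence \<open>D\<close> can be halved as long as it is large.
\<close>

section \<open>Geodesics and chains\<close>

text \<open>Keeps the parametrisation that \<open>geodesic_segment\<close> hides behind an
  existential quantifier; subsegments and sample points are read off from it.\<close>

definition geodesic_curve :: "'p set \<Rightarrow> ('p \<Rightarrow> 'p \<Rightarrow> real) \<Rightarrow> (real \<Rightarrow> 'p) \<Rightarrow> real \<Rightarrow> bool" where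
  "geodesic_curve M d c l \<longleftrightarrow>
     0 \<le> l \<and> c \<in> {0..l} \<rightarrow> M \<and> (\<forall>s\<in>{0..l}. \<forall>t\<in>{0..l}. d (c s) (c t) = \<bar>s - t\<bar>)"

text \<open>A discrete stand-in for a path of length at most n inside Y. In a metric space steps may
  be trivial, so a chain can be padded to a prescribed number of steps.\<close>

primrec chain_connected :: "('p \<Rightarrow> 'p \<Rightarrow> real) \<Rightarrow> 'p set \<Rightarrow> nat \<Rightarrow> 'p \<Rightarrow> 'p \<Rightarrow> bool" where
  "chain_connected d Y 0 a b \<longleftrightarrow> a = b \<and> a \<in> Y"
| "chain_connected d Y (Suc n) a b \<longleftrightarrow> (\<exists>c. chain_connected d Y n a c \<and> d c b \<le> 1 \<and> b \<in> Y)"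

lemma chain_connected_trans:
  assumes "chain_connected d Y m a b" and "chain_connected d Y n b c"
  shows "chain_connected d Y (m + n) a c"
  using assms(2)
proof (induction n arbitrary: c)
  case 0
  then show ?case using assms(1) by simp
next
  case (Suc n)
  then show ?case by auto
qed

lemma chain_connected_ends:
  "chain_connected d Y n a b \<Longrightarrow> a \<in> Y \<and> b \<in> Y"
  by (induction n arbitrary: b) auto

lemma chain_connected_sequence:
  "chain_connected d Y n a b \<Longrightarrow>
     \<exists>x. x 0 = a \<and> x n = b \<and> (\<forall>i\<le>n. x i \<in> Y) \<and> (\<forall>i<n. d (x i) (x (Suc i)) \<le> 1)"
proof (induction n arbitrary: b)
  case 0
  then show ?case by auto
next
  case (Suc n)
  then obtain c where c: "chain_connected d Y n a c" "d c b \<le> 1" "b \<in> Y" by auto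
  then obtain x where x: "x 0 = a" "x n = c" "\<forall>i\<le>n. x i \<in> Y" "\<forall>i<n. d (x i) (x (Suc i)) \<le> 1"
    using Suc.IH by blast
  let ?x = "x(Suc n := b)"
  have "?x 0 = a \<and> ?x (Suc n) = b \<and> (\<forall>i\<le>Suc n. ?x i \<in> Y) \<and>
    (\<forall>i<Suc n. d (?x i) (?x (Suc i)) \<le> 1)"
    using x c by (auto simp: less_Suc_eq le_Suc_eq)
  then show ?case by blast
qed

context Metric_space
begin

lemma geodesic_curve_in:
  "geodesic_curve M d c l \<Longrightarrow> s \<in> {0..l} \<Longrightarrow> c s \<in> M"
  by (auto simp: geodesic_curve_def)

lemma geodesic_curve_dist:
  "geodesic_curve M d c l \<Longrightarrow> s \<in> {0..l} \<Longrightarrow> t \<in> {0..l} \<Longrightarrow> d (c s) (c t) = \<bar>s - t\<bar>"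
  by (auto simp: geodesic_curve_def)

lemma geodesic_segment_iff:
  "geodesic_segment M d x y A \<longleftrightarrow>
    (\<exists>c. geodesic_curve M d c (d x y) \<and> c 0 = x \<and> c (d x y) = y \<and> A = c ` {0..d x y})"
  unfolding geodesic_segment_def geodesic_curve_def by auto

lemma geodesic_subcurve:
  assumes c: "geodesic_curve M d c l" and s: "0 \<le> s" "s \<le> t" "t \<le> l"
  shows "geodesic_segment M d (c s) (c t) (c ` {s..t})"
proof -
  have dst: "d (c s) (c t) = t - s" using geodesic_curve_dist[OF c, of s t] s by auto
  define c' where "c' = (\<lambda>u. c (s + u))"
  have "c ` {s..t} = c' ` {0..t - s}"
  proof -
    have "{s..t} = (\<lambda>u. s + u) ` {0..t - s}" by simp
    then show ?thesis unfolding c'_def by (metis image_image)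
  qed
  moreover have "geodesic_curve M d c' (t - s)"
    unfolding geodesic_curve_def
  proof (intro conjI ballI)
    show "0 \<le> t - s" using s by simp
    show "c' \<in> {0..t - s} \<rightarrow> M" using geodesic_curve_in[OF c] s by (auto simp: c'_def)
    fix u v assume "u \<in> {0..t - s}" "v \<in> {0..t - s}"
    then show "d (c' u) (c' v) = \<bar>u - v\<bar>"
      using geodesic_curve_dist[OF c, of "s + u" "s + v"] s by (auto simp: c'_def)
  qed
  ultimately show ?thesis
    unfolding geodesic_segment_iff dst by (intro exI[of _ c']) (simp add: c'_def)
qed

lemma geodesic_reverse:
  assumes "geodesic_segment M d x y A"
  shows "geodesic_segment M d y x A"
proof -
  from assms obtain c where c: "geodesic_curve M d c (d x y)" "c 0 = x" "c (d x y) = y"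
    "A = c ` {0..d x y}" unfolding geodesic_segment_iff by blast
  let ?l = "d x y"
  define c' where "c' = (\<lambda>u. c (?l - u))"
  have "A = c' ` {0..?l}"
  proof -
    have "{0..?l} = (\<lambda>u. ?l - u) ` {0..?l}" by simp
    then show ?thesis unfolding c'_def c(4) by (metis image_image)
  qed
  moreover have "geodesic_curve M d c' ?l"
    unfolding geodesic_curve_def
  proof (intro conjI ballI)
    show "0 \<le> ?l" by simp
    show "c' \<in> {0..?l} \<rightarrow> M" using geodesic_curve_in[OF c(1)] by (auto simp: c'_def)
    fix u v assume "u \<in> {0..?l}" "v \<in> {0..?l}"
    then show "d (c' u) (c' v) = \<bar>u - v\<bar>"
      using geodesic_curve_dist[OF c(1), of "?l - u" "?l - v"] by (auto simp: c'_def)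
  qed
  ultimately show ?thesis
    unfolding geodesic_segment_iff commute[of y x]
    by (intro exI[of _ c']) (simp add: c'_def c)
qed

lemma geodesic_subset: "geodesic_segment M d x y A \<Longrightarrow> A \<subseteq> M"
  unfolding geodesic_segment_iff using geodesic_curve_in by blast

lemma geodesic_ends: "geodesic_segment M d x y A \<Longrightarrow> x \<in> A \<and> y \<in> A"
  unfolding geodesic_segment_iff by (metis atLeastAtMost_iff image_eqI nonneg order_refl)

lemma geodesic_dist_start:
  assumes "geodesic_segment M d x y A" "z \<in> A"
  shows "d x z + d z y = d x y"
proof -
  from assms obtain c s where c: "geodesic_curve M d c (d x y)" "c 0 = x" "c (d x y) = y"
    and s: "s \<in> {0..d x y}" "z = c s" unfolding geodesic_segment_iff by blast
  then show ?thesis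
    using geodesic_curve_dist[OF c(1), of 0 s] geodesic_curve_dist[OF c(1), of s "d x y"] by auto
qed

lemma geodesic_subsegment:
  assumes A: "geodesic_segment M d x y A" and pq: "p \<in> A" "q \<in> A"
  shows "\<exists>A'\<subseteq>A. geodesic_segment M d p q A'"
proof -
  from A obtain c where c: "geodesic_curve M d c (d x y)" and A': "A = c ` {0..d x y}"
    unfolding geodesic_segment_iff by blast
  from pq A' obtain s t where s: "s \<in> {0..d x y}" "t \<in> {0..d x y}" "p = c s" "q = c t" by auto
  show ?thesis
  proof (cases "s \<le> t")
    case True
    then have "geodesic_segment M d p q (c ` {s..t})" using geodesic_subcurve[OF c] s by auto
    moreover have "c ` {s..t} \<subseteq> A" using s A' by auto
    ultimately show ?thesis by blast
  next
    case False
    then have "geodesic_segment M d p q (c ` {t..s})"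
      using geodesic_subcurve[OF c, of t s] s by (auto intro: geodesic_reverse)
    moreover have "c ` {t..s} \<subseteq> A" using s A' by auto
    ultimately show ?thesis by blast
  qed
qed

lemma geodesic_point_at:
  assumes A: "geodesic_segment M d x y A" and r: "0 \<le> r" "r \<le> d x y"
  shows "\<exists>z\<in>A. d x z = r \<and> d z y = d x y - r"
proof -
  from A obtain c where c: "geodesic_curve M d c (d x y)" "c 0 = x" "c (d x y) = y"
    "A = c ` {0..d x y}" unfolding geodesic_segment_iff by blast
  have "d x (c r) = r" "d (c r) y = d x y - r"
    using geodesic_curve_dist[OF c(1), of 0 r] geodesic_curve_dist[OF c(1), of r "d x y"] c r by auto
  then show ?thesis using c(4) r by auto
qed

lemma chain_connected_sym:
  "chain_connected d Y n a b \<Longrightarrow> chain_connected d Y n b a"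
proof (induction n arbitrary: b)
  case 0
  then show ?case by auto
next
  case (Suc n)
  then obtain c where c: "chain_connected d Y n a c" "d c b \<le> 1" "b \<in> Y" by auto
  have "chain_connected d Y (Suc 0) b c"
    using c chain_connected_ends[OF c(1)] by (auto simp: commute)
  from chain_connected_trans[OF this Suc.IH[OF c(1)]] show ?case by simp
qed

lemma chain_connected_le:
  assumes "chain_connected d Y m a b" "m \<le> n" "Y \<subseteq> M"
  shows "chain_connected d Y n a b"
  using assms(2,1)
proof (induction n rule: dec_induct)
  case base
  then show ?case .
next
  case (step n)
  then have "chain_connected d Y n a b" by simp
  moreover have "d b b \<le> 1" "b \<in> Y"
    using chain_connected_ends[OF step.prems] assms(3) by auto
  ultimately show ?case by auto
qed

text \<open>Sampling at integer times gives the chain; the minimum with the length stops it at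
  b.\<close>

lemma chain_connected_geodesic:
  assumes "geodesic_segment M d a b A" "A \<subseteq> Y" "d a b \<le> real n"
  shows "chain_connected d Y n a b"
proof -
  from assms(1) obtain c where c: "geodesic_curve M d c (d a b)" "c 0 = a" "c (d a b) = b"
    "A = c ` {0..d a b}" unfolding geodesic_segment_iff by blast
  have "chain_connected d Y k a (c (min (real k) (d a b)))" for k
  proof (induction k)
    case 0
    then show ?case using c assms geodesic_ends by auto
  next
    case (Suc k)
    have "d (c (min (real k) (d a b))) (c (min (real (Suc k)) (d a b))) \<le> 1"
      using geodesic_curve_dist[OF c(1), of "min (real k) (d a b)" "min (real (Suc k)) (d a b)"] by auto
    moreover have "c (min (real (Suc k)) (d a b)) \<in> Y" using c(4) assms(2) by auto
    ultimately show ?case using Suc by auto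
  qed
  from this[of n] show ?thesis using assms(3) c(3) by (simp add: min_absorb2)
qed

end

section \<open>Logarithmic distortion in hyperbolic spaces\<close>

lemma delta_hyperbolic_thin:
  assumes "delta_hyperbolic_space \<delta> M d" "x \<in> M" "y \<in> M" "z \<in> M"
    "geodesic_segment M d x y A" "geodesic_segment M d y z B" "geodesic_segment M d z x C" "w \<in> A"
  shows "\<exists>v\<in>B \<union> C. d w v \<le> \<delta>"
proof -
  have "A \<subseteq> neighbourhood M d \<delta> (B \<union> C)"
    using assms(1-7) unfolding delta_hyperbolic_space_def by metis
  then show ?thesis using assms(8) unfolding neighbourhood_def by blast
qed

text \<open>Halving: in the triangle spanned by the two ends and the middle point of the chain, y is
  \<delta>-close to a geodesic over one half of the chain. After k halvings at most one jump of size
  L is left.\<close>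

lemma geodesic_near_chain:
  assumes hyp: "delta_hyperbolic_space \<delta> M d"
    and "\<forall>i\<le>n. x i \<in> M" and "\<forall>i<n. d (x i) (x (Suc i)) \<le> L" and "0 \<le> L" and "n \<le> 2 ^ k"
    and "geodesic_segment M d (x 0) (x n) A" and "y \<in> A"
  shows "\<exists>i\<le>n. d y (x i) \<le> \<delta> * real k + L"
  using assms(2-)
proof (induction k arbitrary: n x A y)
  case 0
  from hyp interpret Metric_space M d
    by (simp add: delta_hyperbolic_space_def geodesic_metric_space_def)
  have "d (x 0) (x n) \<le> L"
  proof (cases "n = 0")
    case True
    then show ?thesis using 0 by auto
  next
    case False
    then have "n = 1" using 0 by simp
    then show ?thesis using 0 by auto
  qed
  moreover have "d (x 0) y \<le> d (x 0) (x n)"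
    using geodesic_dist_start[OF 0(5,6)] nonneg[of y "x n"] by linarith
  ultimately show ?case by (intro exI[of _ 0]) (auto simp: commute)
next
  case (Suc k)
  from hyp interpret Metric_space M d
    by (simp add: delta_hyperbolic_space_def geodesic_metric_space_def)
  have geo: "\<And>p q. p \<in> M \<Longrightarrow> q \<in> M \<Longrightarrow> \<exists>A. geodesic_segment M d p q A"
    using hyp by (auto simp: delta_hyperbolic_space_def geodesic_metric_space_def)
  define m where "m = n div 2"
  have m: "m \<le> n" "m \<le> 2 ^ k" "n - m \<le> 2 ^ k" using Suc.prems(4) by (auto simp: m_def)
  obtain B where B: "geodesic_segment M d (x m) (x n) B" using geo Suc.prems(1) m by blast
  obtain C where C: "geodesic_segment M d (x 0) (x m) C" using geo Suc.prems(1) m by blast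
  have "y \<in> A" by fact
  then obtain v where v: "v \<in> B \<union> C" "d y v \<le> \<delta>"
    using delta_hyperbolic_thin[OF hyp _ _ _ Suc.prems(5) geodesic_reverse[OF B] geodesic_reverse[OF C]]
      Suc.prems(1) m by blast
  have "y \<in> M" "v \<in> M" using geodesic_subset Suc.prems(5,6) B C v by blast+
  have "\<exists>i\<le>n. d v (x i) \<le> \<delta> * real k + L"
  proof (cases "v \<in> C")
    case True
    have "\<exists>i\<le>m. d v (x i) \<le> \<delta> * real k + L"
      using Suc.prems m by (intro Suc.IH[OF _ _ _ _ C True]) auto
    then show ?thesis using m by (meson order_trans)
  next
    case False
    then have "v \<in> B" using v by auto
    have "\<exists>i\<le>n - m. d v (x (m + i)) \<le> \<delta> * real k + L"
    proof (rule Suc.IH[of "n - m" "\<lambda>i. x (m + i)" B v])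
      show "\<forall>i\<le>n - m. x (m + i) \<in> M" using Suc.prems m by auto
      show "\<forall>i<n - m. d (x (m + i)) (x (m + Suc i)) \<le> L" using Suc.prems m by auto
      show "geodesic_segment M d (x (m + 0)) (x (m + (n - m))) B" using B m by simp
    qed (use Suc.prems m \<open>v \<in> B\<close> in auto)
    then show ?thesis using m by (metis le_add_diff_inverse nat_add_left_cancel_le)
  qed
  then obtain i where i: "i \<le> n" "d v (x i) \<le> \<delta> * real k + L" by blast
  have "d y (x i) \<le> d y v + d v (x i)"
    using triangle \<open>y \<in> M\<close> \<open>v \<in> M\<close> Suc.prems(1) i by blast
  then show ?case using i v by (intro exI[of _ i]) (auto simp: algebra_simps)
qed

section \<open>From sublinear geodesic stability to slim triangles\<close>

text \<open>The ratio 1/100 is fixed with \<open>slim_upto_halve\<close> in view: there n = 30 * K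
  with K at most D + 1, and n / 100 has to fall below D / 2.\<close>

definition tracks_geodesics :: "'p set \<Rightarrow> ('p \<Rightarrow> 'p \<Rightarrow> real) \<Rightarrow> nat \<Rightarrow> bool" where
  "tracks_geodesics M d N\<^sub>0 \<longleftrightarrow>
     (\<forall>n\<ge>N\<^sub>0. \<forall>x A. (\<forall>i\<le>n. x i \<in> M) \<longrightarrow> (\<forall>i<n. d (x i) (x (Suc i)) \<le> 1) \<longrightarrow>
        geodesic_segment M d (x 0) (x n) A \<longrightarrow> (\<forall>y\<in>A. \<exists>i\<le>n. d y (x i) \<le> real n / 100))"

text \<open>The perimeter bound N guarantees a trivial D to start the halving from. Treating the
  side A alone is enough, as relabelling the vertices gives the other two sides.\<close>

definition slim_upto :: "'p set \<Rightarrow> ('p \<Rightarrow> 'p \<Rightarrow> real) \<Rightarrow> real \<Rightarrow> real \<Rightarrow> bool" where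
  "slim_upto M d N D \<longleftrightarrow>
     (\<forall>x\<in>M. \<forall>y\<in>M. \<forall>z\<in>M. \<forall>A B C. geodesic_segment M d x y A \<longrightarrow> geodesic_segment M d y z B \<longrightarrow>
        geodesic_segment M d z x C \<longrightarrow> d x y + d y z + d z x \<le> N \<longrightarrow>
        (\<forall>w\<in>A. \<exists>v\<in>B \<union> C. d w v \<le> D))"

context Metric_space
begin

text \<open>The two inequalities put p, m, q in this order along the segment.\<close>

lemma geodesic_between:
  assumes A: "geodesic_segment M d a b A" and pmq: "p \<in> A" "m \<in> A" "q \<in> A"
    and le: "d a p \<le> d a m" "d b q \<le> d b m"
  shows "\<exists>A'. geodesic_segment M d p q A' \<and> m \<in> A'"
proof -
  from A obtain c where c: "geodesic_curve M d c (d a b)" "c 0 = a" "c (d a b) = b"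
    "A = c ` {0..d a b}" unfolding geodesic_segment_iff by blast
  from pmq obtain s r t where srt: "s \<in> {0..d a b}" "r \<in> {0..d a b}" "t \<in> {0..d a b}"
    "p = c s" "m = c r" "q = c t" unfolding c(4) by blast
  have 0: "0 \<in> {0..d a b}" "d a b \<in> {0..d a b}" by auto
  have "s \<le> r" using le(1) geodesic_curve_dist[OF c(1) 0(1) srt(1)]
      geodesic_curve_dist[OF c(1) 0(1) srt(2)] srt c(2) by auto
  moreover have "r \<le> t" using le(2) geodesic_curve_dist[OF c(1) 0(2) srt(3)]
      geodesic_curve_dist[OF c(1) 0(2) srt(2)] srt c(3) by auto
  ultimately show ?thesis
    using geodesic_subcurve[OF c(1), of s t] srt by (intro exI[of _ "c ` {s..t}"]) auto
qed

text \<open>Go from m towards a for a length of 2 * D, and from there by a geodesic of length at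
  most D to Z: this geodesic keeps distance at least D from m. If a is nearer than that, it serves
  itself, since it lies in Z. In the application Z is the union of the other two sides and K is D
  rounded up.\<close>

lemma side_to_others:
  assumes geo: "geodesic_metric_space M d"
    and A: "geodesic_segment M d a b A" and m: "m \<in> A" and Z: "Z \<subseteq> M" "a \<in> Z"
    and slim: "\<forall>w\<in>A. \<exists>v\<in>Z. d w v \<le> D" and far: "\<forall>z\<in>Z. d m z > D / 2"
    and D: "0 < D" "D \<le> real K"
  shows "\<exists>a'\<in>A. \<exists>u\<in>Z. d a a' \<le> d a m \<and> d m u \<le> 3 * D \<and>
    chain_connected d {z \<in> M. d m z > D / 2} K a' u"
proof -
  let ?Y = "{z \<in> M. d m z > D / 2}"
  have AM: "A \<subseteq> M" using geodesic_subset[OF A] .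
  show ?thesis
  proof (cases "d a m \<le> 2 * D")
    case True
    have "chain_connected d ?Y 0 a a" using Z far by auto
    then have "chain_connected d ?Y K a a" by (rule chain_connected_le) auto
    then show ?thesis using True Z D geodesic_ends[OF A]
      by (intro bexI[of _ a]) (auto simp: commute mdist_zero)
  next
    case False
    obtain A1 where A1: "A1 \<subseteq> A" "geodesic_segment M d a m A1"
      using geodesic_subsegment[OF A _ m] geodesic_ends[OF A] by blast
    obtain z where z: "z \<in> A1" "d a z = d a m - 2 * D" "d z m = 2 * D"
      using geodesic_point_at[OF A1(2), of "d a m - 2 * D"] False D by auto
    obtain u where u: "u \<in> Z" "d z u \<le> D" using slim z A1 by blast
    have zu: "z \<in> M" "u \<in> M" "m \<in> M" using z A1 AM u Z m by auto
    obtain E where E: "geodesic_segment M d z u E"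
      using geo zu unfolding geodesic_metric_space_def by blast
    have "E \<subseteq> ?Y"
    proof
      fix w assume w: "w \<in> E"
      have "w \<in> M" using geodesic_subset[OF E] w by auto
      have "d z w \<le> D" using geodesic_dist_start[OF E w] u nonneg[of w u] by linarith
      then have "d m w \<ge> D" using triangle[of z w m] zu \<open>w \<in> M\<close> z(3) by (simp add: commute)
      then show "w \<in> ?Y" using D \<open>w \<in> M\<close> by simp
    qed
    then have "chain_connected d ?Y K z u"
      using chain_connected_geodesic[OF E] u D by simp
    moreover have "d m u \<le> 3 * D" using triangle[of m z u] zu z(3) u by (simp add: commute)
    moreover have "d a z \<le> d a m" using z D by simp
    ultimately show ?thesis using z A1 u by blast
  qed
qed

text \<open>
  Points on the two sides issuing from \<open>c\<close> are joined by travelling towards \<open>c\<close>, far enough for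
  the two sides to be \<open>D\<close>-close to each other and away from \<open>m\<close>, and switching sides there.
\<close>

lemma switch_sides:
  assumes geo: "geodesic_metric_space M d" and slim: "slim_upto M d N D"
    and B: "geodesic_segment M d b c B" and C: "geodesic_segment M d c a C"
    and per: "d a b + d b c + d c a \<le> N" and abc: "a \<in> M" "b \<in> M" "c \<in> M" "m \<in> M"
    and uv: "u \<in> B" "v \<in> C" "d m u \<le> 3 * D" "d m v \<le> 3 * D"
    and far: "\<forall>z\<in>B \<union> C. d m z > D / 2" and D: "0 < D" "D \<le> real K"
  shows "chain_connected d {z \<in> M. d m z > D / 2} (28 * K) u v"
proof -
  let ?Y = "{z \<in> M. d m z > D / 2}"
  have BC: "B \<subseteq> ?Y" "C \<subseteq> ?Y" using far geodesic_subset[OF B] geodesic_subset[OF C] by auto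
  have M: "u \<in> M" "v \<in> M" using BC uv by auto
  have duv: "d u v \<le> 6 * D" using triangle[of u m v] M abc uv by (simp add: commute)
  obtain B1 where B1: "B1 \<subseteq> B" "geodesic_segment M d u c B1"
    using geodesic_subsegment[OF B uv(1)] geodesic_ends[OF B] by blast
  obtain C1 where C1: "C1 \<subseteq> C" "geodesic_segment M d c v C1"
    using geodesic_subsegment[OF C _ uv(2)] geodesic_ends[OF C] by blast
  show ?thesis
  \<comment> \<open>If c is near, the chain goes through c in 10 K + 18 K steps; otherwise it
    switches sides at q, in 10 K + K + 17 K steps.\<close>
  proof (cases "d u c \<le> 10 * D")
    case True
    have "d c v \<le> 16 * D" using triangle[of c u v] True duv M abc by (simp add: commute)
    have "chain_connected d ?Y (10 * K) u c"
      using B1 BC True D by (intro chain_connected_geodesic[OF B1(2)]) auto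
    moreover have "chain_connected d ?Y (18 * K) c v"
      using C1 BC \<open>d c v \<le> 16 * D\<close> D by (intro chain_connected_geodesic[OF C1(2)]) auto
    ultimately have "chain_connected d ?Y (10 * K + 18 * K) u v" by (rule chain_connected_trans)
    then show ?thesis by simp
  next
    case False
    obtain q where q: "q \<in> B1" "d u q = 10 * D"
      using geodesic_point_at[OF B1(2), of "10 * D"] False D by auto
    obtain U where U: "geodesic_segment M d v u U"
      using geo M unfolding geodesic_metric_space_def by blast
    \<comment> \<open>The triangle u, c, v has no larger perimeter than a, b, c, so
      \<open>slim\<close> applies to it as well.\<close>
    have "d u v + d c v + d u c \<le> N"
    proof -
      have "d u v \<le> d u b + d b a + d a v" using triangle[of u b v] triangle[of b a v] M abc by simp
      then show ?thesis
        using geodesic_dist_start[OF B uv(1)] geodesic_dist_start[OF C uv(2)] per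
        by (simp add: commute)
    qed
    then have "d u c + d c v + d v u \<le> N" by (simp add: commute)
    then have "\<exists>w\<in>C1 \<union> U. d q w \<le> D"
      using slim B1(2) C1(2) U M abc(3) q(1) unfolding slim_upto_def by blast
    then obtain w where w: "w \<in> C1 \<union> U" "d q w \<le> D" by blast
    have wM: "w \<in> M" "q \<in> M" using w geodesic_subset U C1 B1 q by blast+
    \<comment> \<open>Every point of U is within 6 D of u, whereas w is within D of q and q is at
      distance 10 D from u.\<close>
    have "w \<notin> U"
    proof
      assume "w \<in> U"
      then have "d v w + d w u = d v u" by (rule geodesic_dist_start[OF U])
      then have "d u w \<le> 6 * D" using duv nonneg[of v w] commute[of w u] commute[of v u] by linarith
      then show False using triangle[of u w q] M wM q w D by (simp add: commute)
    qed
    then have wC: "w \<in> C1" using w by auto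
    obtain E where E: "geodesic_segment M d q w E"
      using geo wM unfolding geodesic_metric_space_def by blast
    have "E \<subseteq> ?Y"
    proof
      fix z assume z: "z \<in> E"
      have zM: "z \<in> M" using geodesic_subset[OF E] z by auto
      have "d q z \<le> D" using geodesic_dist_start[OF E z] w nonneg[of z w] by linarith
      \<comment> \<open>Of the 10 D from u to q, at most 3 D lead from u to m and at most D from z
        to q; at least 6 D remain for the distance from m to z.\<close>
      moreover have "d u q \<le> d u m + d m z + d z q"
        using triangle[of u m q] triangle[of m z q] M abc wM zM by simp
      ultimately have "d m z \<ge> 6 * D" using q uv by (simp add: commute)
      then show "z \<in> ?Y" using D zM by simp
    qed
    have qw: "chain_connected d ?Y K q w"
      using E \<open>E \<subseteq> ?Y\<close> w D by (intro chain_connected_geodesic[OF E]) auto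
    obtain B2 where B2: "B2 \<subseteq> B1" "geodesic_segment M d u q B2"
      using geodesic_subsegment[OF B1(2) _ q(1)] geodesic_ends[OF B1(2)] by blast
    have uq: "chain_connected d ?Y (10 * K) u q"
      using B1 B2 BC D q by (intro chain_connected_geodesic[OF B2(2)]) auto
    have 1: "chain_connected d ?Y (10 * K + K) u w" by (rule chain_connected_trans[OF uq qw])
    obtain C2 where C2: "C2 \<subseteq> C1" "geodesic_segment M d w v C2"
      using geodesic_subsegment[OF C1(2) wC] geodesic_ends[OF C1(2)] by blast
    have "d w v \<le> 17 * D"
    proof -
      have "d w v \<le> d w q + d q u + d u v"
        using triangle[of w q v] triangle[of q u v] M wM by simp
      then show ?thesis using w q duv by (simp add: commute)
    qed
    then have "chain_connected d ?Y (17 * K) w v"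
      using C1 C2 BC D by (intro chain_connected_geodesic[OF C2(2)]) auto
    with 1 have "chain_connected d ?Y (10 * K + K + 17 * K) u v" by (rule chain_connected_trans)
    then show ?thesis by simp
  qed
qed

text \<open>If m were farther than D / 2 from the other two sides, a detour of 30 K steps outside
  the ball of radius D / 2 about m would join two points of A between which m lies, and tracking
  would force it back into that ball.\<close>

lemma slim_upto_halve:
  assumes geo: "geodesic_metric_space M d" and track: "tracks_geodesics M d N\<^sub>0"
    and slim: "slim_upto M d N D" and D: "10 \<le> D" "real N\<^sub>0 \<le> D"
  shows "slim_upto M d N (D / 2)"
  unfolding slim_upto_def
proof (intro ballI allI impI, rule ccontr)
  fix a b c A B C m
  assume abc: "a \<in> M" "b \<in> M" "c \<in> M" and A: "geodesic_segment M d a b A"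
    and B: "geodesic_segment M d b c B" and C: "geodesic_segment M d c a C"
    and per: "d a b + d b c + d c a \<le> N" and m: "m \<in> A"
    and contra: "\<not> (\<exists>v\<in>B \<union> C. d m v \<le> D / 2)"
  define K where "K = nat \<lceil>D\<rceil>"
  have K: "D \<le> real K" "real K \<le> D + 1" "N\<^sub>0 \<le> 30 * K" using D by (auto simp: K_def) linarith+
  have D0: "0 < D" using D by simp
  let ?Y = "{z \<in> M. d m z > D / 2}"
  let ?Z = "B \<union> C"
  have far: "\<forall>z\<in>?Z. d m z > D / 2" using contra by (meson not_le)
  have Z: "?Z \<subseteq> M" "a \<in> ?Z" "b \<in> ?Z" using geodesic_subset B C geodesic_ends by blast+
  have mM: "m \<in> M" using m geodesic_subset[OF A] by auto
  have sl: "\<forall>w\<in>A. \<exists>v\<in>?Z. d w v \<le> D"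
    using slim A B C abc per unfolding slim_upto_def by blast
  obtain a' u where a': "a' \<in> A" "u \<in> ?Z" "d a a' \<le> d a m" "d m u \<le> 3 * D"
    "chain_connected d ?Y K a' u"
    using side_to_others[OF geo A m Z(1,2) sl far D0 K(1)] by blast
  obtain b' v where b': "b' \<in> A" "v \<in> ?Z" "d b b' \<le> d b m" "d m v \<le> 3 * D"
    "chain_connected d ?Y K b' v"
    using side_to_others[OF geo geodesic_reverse[OF A] m Z(1,3) sl far D0 K(1)] by blast
  have uvM: "u \<in> M" "v \<in> M" using a' b' Z by auto
  \<comment> \<open>If u and v lie on the same side, that side itself avoids the ball, and their
    distance is at most 6 D. Otherwise \<open>switch_sides\<close> connects them.\<close>
  have along: "chain_connected d ?Y (28 * K) u v"
    if E: "geodesic_segment M d p q E" "E \<subseteq> ?Z" and uvE: "u \<in> E" "v \<in> E" for p q E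
  proof -
    obtain E' where E': "E' \<subseteq> E" "geodesic_segment M d u v E'"
      using geodesic_subsegment[OF E(1) uvE] by blast
    have "d u v \<le> 28 * real K"
      using triangle[of u m v] uvM mM a' b' K(1) D0 by (simp add: commute)
    then show ?thesis
      using E'(1) E(2) far Z(1) by (intro chain_connected_geodesic[OF E'(2)]) auto
  qed
  have "chain_connected d ?Y (28 * K) u v"
  proof -
    consider "u \<in> B" "v \<in> B" | "u \<in> C" "v \<in> C" | "u \<in> B" "v \<in> C" | "v \<in> B" "u \<in> C"
      using a'(2) b'(2) by blast
    then show ?thesis
    proof cases
      case 1
      then show ?thesis using along[OF B] by blast
    next
      case 2
      then show ?thesis using along[OF C] by blast
    next
      case 3
      then show ?thesis
        using switch_sides[OF geo slim B C per abc mM _ _ a'(4) b'(4) far D0 K(1)] by blast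
    next
      case 4
      then show ?thesis
        using chain_connected_sym
          switch_sides[OF geo slim B C per abc mM _ _ b'(4) a'(4) far D0 K(1)] by blast
    qed
  qed
  then have "chain_connected d ?Y (K + 28 * K + K) a' b'"
    by (intro chain_connected_trans[OF chain_connected_trans[OF a'(5)] chain_connected_sym[OF b'(5)]])
  then have conn: "chain_connected d ?Y (30 * K) a' b'" by (simp add: algebra_simps)
  then obtain x where x: "x 0 = a'" "x (30 * K) = b'" "\<forall>i\<le>30 * K. x i \<in> ?Y"
    "\<forall>i<30 * K. d (x i) (x (Suc i)) \<le> 1" using chain_connected_sequence[OF conn] by blast
  \<comment> \<open>The points a' and b' were chosen on either side of m, so the part of A between
    them is a geodesic through m with the same ends as the chain.\<close>
  obtain A' where A': "geodesic_segment M d a' b' A'" "m \<in> A'"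
    using geodesic_between[OF A a'(1) m b'(1) a'(3) b'(3)] by blast
  have "\<forall>i\<le>30 * K. x i \<in> M" using x by auto
  then obtain i where i: "i \<le> 30 * K" "d m (x i) \<le> real (30 * K) / 100"
    using track[unfolded tracks_geodesics_def, rule_format, of "30 * K" x A' m] K(3) x(1,2,4) A' by auto
  \<comment> \<open>This contradicts 30 K / 100 \<le> 3 (D + 1) / 10 < D / 2, where D \<ge> 10
    enters.\<close>
  have "d m (x i) > D / 2" using x(3) i(1) by auto
  then show False using i K(2) D by auto
qed

text \<open>Triangles of perimeter at most N are trivially slim with a constant of the form D0 * 2 ^
  k. Halving brings this down to 2 * D0, a bound independent of N.\<close>

theorem tracks_geodesics_imp_hyperbolic:
  assumes geo: "geodesic_metric_space M d" and track: "tracks_geodesics M d N\<^sub>0"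
  shows "\<exists>\<delta>. delta_hyperbolic_space \<delta> M d"
proof -
  \<comment> \<open>The threshold above which \<open>slim_upto_halve\<close> applies.\<close>
  define D\<^sub>0 where "D\<^sub>0 = max 10 (real N\<^sub>0)"
  have iter: "slim_upto M d N (2 * D\<^sub>0)" if "slim_upto M d N (D\<^sub>0 * 2 ^ k)" "1 \<le> k" for N k
    using that(2,1)
  proof (induction k rule: dec_induct)
    case base
    then show ?case by (simp add: mult.commute)
  next
    case (step k)
    have "(1::real) \<le> 2 ^ Suc k" by (rule one_le_power) simp
    then have "D\<^sub>0 * 1 \<le> D\<^sub>0 * 2 ^ Suc k" by (intro mult_left_mono) (auto simp: D\<^sub>0_def)
    then have "slim_upto M d N (D\<^sub>0 * 2 ^ Suc k / 2)"
      by (intro slim_upto_halve[OF geo track step.prems]) (auto simp: D\<^sub>0_def)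
    then show ?case using step.IH by simp
  qed
  have slim: "slim_upto M d N (2 * D\<^sub>0)" for N
  proof -
    obtain k where k: "N < 2 ^ k" using real_arch_pow[of 2 N] by auto
    have "2 ^ k \<le> (2::real) ^ Suc k" by simp
    also have "\<dots> \<le> D\<^sub>0 * 2 ^ Suc k"
      using mult_right_mono[of 1 D\<^sub>0 "2 ^ Suc k"] by (simp add: D\<^sub>0_def)
    finally have le: "N \<le> D\<^sub>0 * 2 ^ Suc k" using k by linarith
    have "slim_upto M d N (D\<^sub>0 * 2 ^ Suc k)"
      unfolding slim_upto_def
    proof (intro ballI allI impI)
      fix x y z A B C w
      assume A: "geodesic_segment M d x y A" and "geodesic_segment M d y z B"
        and C: "geodesic_segment M d z x C" and N: "d x y + d y z + d z x \<le> N" and w: "w \<in> A"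
      \<comment> \<open>The trivial bound: w is within the perimeter of the vertex x, which also
        lies on C.\<close>
      have "d x w \<le> D\<^sub>0 * 2 ^ Suc k"
        using geodesic_dist_start[OF A w] nonneg[of w y] nonneg[of y z] nonneg[of z x] N le
        by linarith
      then show "\<exists>v\<in>B \<union> C. d w v \<le> D\<^sub>0 * 2 ^ Suc k"
        using geodesic_ends[OF C] by (metis Un_iff commute)
    qed
    then show ?thesis using iter[of N "Suc k"] by simp
  qed
  have side: "A \<subseteq> neighbourhood M d (2 * D\<^sub>0) (B \<union> C)"
    if "x \<in> M" "y \<in> M" "z \<in> M" "geodesic_segment M d x y A" "geodesic_segment M d y z B"
      "geodesic_segment M d z x C" for x y z A B C
  proof -
    have "\<forall>w\<in>A. \<exists>v\<in>B \<union> C. d w v \<le> 2 * D\<^sub>0"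
      using slim[of "d x y + d y z + d z x"] that unfolding slim_upto_def by blast
    then show ?thesis using geodesic_subset that unfolding neighbourhood_def by blast
  qed
  have "0 \<le> 2 * D\<^sub>0" by (simp add: D\<^sub>0_def)
  then have "delta_hyperbolic_space (2 * D\<^sub>0) M d"
    unfolding delta_hyperbolic_space_def using geo side by blast
  then show ?thesis by blast
qed

end

section \<open>Word lengths\<close>

lemma (in group) set_power_closed: "A \<subseteq> carrier G \<Longrightarrow> set_power G A n \<subseteq> carrier G"
  by (induction n) (auto simp: set_mult_def)

lemma set_power_finite: "finite A \<Longrightarrow> finite (set_power G A n)"
  by (induction n) (auto simp: set_mult_def)

lemma card_set_power_le: "finite A \<Longrightarrow> card (set_power G A n) \<le> card A ^ n"
proof (induction n)
  case (Suc n)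
  have "set_power G A (Suc n) = (\<lambda>(x, y). x \<otimes>\<^bsub>G\<^esub> y) ` (set_power G A n \<times> A)"
    by (auto simp: set_mult_def)
  then have "card (set_power G A (Suc n)) \<le> card (set_power G A n \<times> A)"
    using Suc.prems set_power_finite by (metis card_image_le finite_SigmaI)
  also have "\<dots> \<le> card A ^ n * card A"
    using Suc by (simp add: card_cartesian_product)
  finally show ?case by (simp add: mult.commute)
qed simp

lemma (in group) set_power_add:
  assumes "A \<subseteq> carrier G" "x \<in> set_power G A m" "y \<in> set_power G A n"
  shows "x \<otimes> y \<in> set_power G A (m + n)"
  using assms(3)
proof (induction n arbitrary: y)
  case 0
  then have "y = \<one>" "x \<in> carrier G" using assms(2) set_power_closed[OF assms(1)] by auto
  then show ?case using assms(2) by simp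
next
  case (Suc n)
  then obtain z s where z: "z \<in> set_power G A n" "s \<in> A" "y = z \<otimes> s" by (auto simp: set_mult_def)
  have "x \<otimes> y = (x \<otimes> z) \<otimes> s"
    using z assms set_power_closed[OF assms(1)] by (metis m_assoc subsetD)
  then show ?case using Suc.IH[OF z(1)] z by (auto simp: set_mult_def)
qed

lemma (in group) set_power_1: "A \<subseteq> carrier G \<Longrightarrow> set_power G A (Suc 0) = A"
  by (auto simp: set_mult_def) (metis l_one subsetD)

locale fg_group = group G for G (structure) +
  fixes S
  assumes fin_gen: "finite_generating_set G S"
begin

abbreviation "sym_gens \<equiv> S \<union> set_inv S"
abbreviation "wl \<equiv> word_length G S"
text \<open>Products of exactly n letters, reduced or not, so one element may occur for several n;
  the least such n is its word length.\<close>

abbreviation "sphere_words \<equiv> set_power G sym_gens"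

lemma gens_closed: "S \<subseteq> carrier G" and gens_finite: "finite S"
  and gens_generate: "generate G S = carrier G"
  using fin_gen by (auto simp: finite_generating_set_def)

lemma sym_gens_closed: "sym_gens \<subseteq> carrier G"
  using gens_closed by (auto simp: SET_INV_def)

lemma sym_gens_inv: "s \<in> sym_gens \<Longrightarrow> inv s \<in> sym_gens"
  using gens_closed by (auto simp: SET_INV_def)

lemma sym_gens_finite: "finite sym_gens"
  using gens_finite by (auto simp: SET_INV_def)

lemma sphere_words_inv: "x \<in> sphere_words n \<Longrightarrow> inv x \<in> sphere_words n"
proof (induction n arbitrary: x)
  case 0
  then show ?case by simp
next
  case (Suc n)
  then obtain z s where z: "z \<in> sphere_words n" "s \<in> sym_gens" "x = z \<otimes> s" by (auto simp: set_mult_def)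
  have "inv x = inv s \<otimes> inv z"
    using z set_power_closed[OF sym_gens_closed] sym_gens_closed by (metis inv_mult_group subsetD)
  moreover have "inv s \<in> sphere_words (Suc 0)"
    using sym_gens_inv[OF z(2)] set_power_1[OF sym_gens_closed] by simp
  ultimately show ?case
    using set_power_add[OF sym_gens_closed _ Suc.IH[OF z(1)], of "inv s" "Suc 0"] by simp
qed

lemma sphere_words_exhaust:
  assumes "g \<in> carrier G"
  shows "\<exists>n. g \<in> sphere_words n"
proof -
  have "g \<in> generate G S" using assms gens_generate by simp
  then show ?thesis
  proof (induction rule: generate.induct)
    case one
    then show ?case by (intro exI[of _ 0]) simp
  next
    case (incl h)
    then show ?case using set_power_1[OF sym_gens_closed] by (intro exI[of _ "Suc 0"]) simp
  next
    case (inv h)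
    then have "inv h \<in> sym_gens" using sym_gens_inv by blast
    then show ?case using set_power_1[OF sym_gens_closed] by (intro exI[of _ "Suc 0"]) simp
  next
    case (eng h1 h2)
    then show ?case using set_power_add[OF sym_gens_closed] by blast
  qed
qed

lemma wl_in: "g \<in> carrier G \<Longrightarrow> g \<in> sphere_words (wl g)"
  unfolding word_length_def using sphere_words_exhaust by (rule LeastI_ex)

lemma wl_le: "g \<in> sphere_words n \<Longrightarrow> wl g \<le> n"
  unfolding word_length_def by (rule Least_le)

lemma wl_one: "wl \<one> = 0"
  using wl_le[of \<one> 0] by simp

lemma wl_inv: "g \<in> carrier G \<Longrightarrow> wl (inv g) = wl g"
  by (metis sphere_words_inv wl_in wl_le inv_inv inv_closed le_antisym)

lemma wl_mult: "g \<in> carrier G \<Longrightarrow> h \<in> carrier G \<Longrightarrow> wl (g \<otimes> h) \<le> wl g + wl h"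
  using set_power_add[OF sym_gens_closed wl_in wl_in] wl_le by blast

lemma wl_gen: "s \<in> sym_gens \<Longrightarrow> wl s \<le> 1"
  using wl_le[of s "Suc 0"] set_power_1[OF sym_gens_closed] by simp

definition wdist where "wdist g h = wl (inv g \<otimes> h)"

lemma wdist_self: "g \<in> carrier G \<Longrightarrow> wdist g g = 0"
  by (simp add: wdist_def wl_one)

lemma wdist_sym: "g \<in> carrier G \<Longrightarrow> h \<in> carrier G \<Longrightarrow> wdist g h = wdist h g"
  unfolding wdist_def using wl_inv[of "inv g \<otimes> h"] by (simp add: inv_mult_group)

lemma wdist_triangle:
  assumes "g \<in> carrier G" "h \<in> carrier G" "k \<in> carrier G"
  shows "wdist g k \<le> wdist g h + wdist h k"
proof -
  have "inv g \<otimes> k = (inv g \<otimes> h) \<otimes> (inv h \<otimes> k)"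
    using assms by (metis inv_closed inv_solve_left m_assoc m_closed)
  then show ?thesis unfolding wdist_def using wl_mult assms by simp
qed

definition word_ball where "word_ball k = {g \<in> carrier G. wl g \<le> k}"

lemma word_ball_subset: "word_ball k \<subseteq> (\<Union>n\<le>k. sphere_words n)"
  using wl_in by (auto simp: word_ball_def)

lemma word_ball_finite: "finite (word_ball k)"
  by (rule finite_subset[OF word_ball_subset]) (use set_power_finite[OF sym_gens_finite] in auto)

text \<open>Induction along a word that represents the quotient of u and v, one letter costing at
  most L.\<close>

lemma lipschitz_if_gens:
  assumes f: "\<And>u. u \<in> carrier G \<Longrightarrow> f u \<in> carrier K" and K: "fg_group K T"
    and gen: "\<And>u s. u \<in> carrier G \<Longrightarrow> s \<in> S \<Longrightarrow> fg_group.wdist K T (f (u \<otimes> s)) (f u) \<le> L"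
    and uv: "u \<in> carrier G" "v \<in> carrier G"
  shows "fg_group.wdist K T (f u) (f v) \<le> L * wdist u v"
proof -
  interpret K: fg_group K T by fact
  have step: "K.wdist (f u) (f (u \<otimes> s)) \<le> L" if u: "u \<in> carrier G" and s: "s \<in> sym_gens" for u s
  proof (cases "s \<in> S")
    case True
    then show ?thesis using gen[OF u True] f u gens_closed K.wdist_sym by (metis m_closed subsetD)
  next
    case False
    \<comment> \<open>An inverse letter is a generator step traversed backwards, from u s back to
      u.\<close>
    then obtain r where r: "r \<in> S" "s = inv r" using s by (auto simp: SET_INV_def)
    have rc: "r \<in> carrier G" using r gens_closed by blast
    have us: "u \<otimes> s \<in> carrier G" using u rc r by simp
    have "(u \<otimes> s) \<otimes> r = u" using u r rc by (simp add: m_assoc)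
    then show ?thesis using gen[OF us r(1)] by simp
  qed
  have "K.wdist (f u) (f (u \<otimes> k)) \<le> L * n" if "k \<in> sphere_words n" for k n
    using that
  proof (induction n arbitrary: k)
    case 0
    then show ?case using K.wdist_self f uv by simp
  next
    case (Suc n)
    then obtain z s where z: "z \<in> sphere_words n" "s \<in> sym_gens" "k = z \<otimes> s" by (auto simp: set_mult_def)
    have zc: "z \<in> carrier G" using z set_power_closed[OF sym_gens_closed] by blast
    have sc: "s \<in> carrier G" using z sym_gens_closed by blast
    have k: "u \<otimes> k = (u \<otimes> z) \<otimes> s" using z zc sc uv by (simp add: m_assoc)
    have "K.wdist (f u) (f (u \<otimes> k)) \<le> K.wdist (f u) (f (u \<otimes> z)) + K.wdist (f (u \<otimes> z)) (f (u \<otimes> k))"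
      using f uv zc sc k by (intro K.wdist_triangle) auto
    also have "\<dots> \<le> L * n + L"
      using Suc.IH[OF z(1)] step[of "u \<otimes> z" s] zc z(2) uv k by (intro add_mono) auto
    finally show ?case by simp
  qed
  from this[OF wl_in[of "inv u \<otimes> v"]] show ?thesis
    using uv by (simp add: m_assoc[symmetric] wdist_def)
qed

section \<open>The geometric realisation of a Cayley graph\<close>

text \<open>Cayley edges are oriented and S need not be symmetric; here the orientation is
  forgotten. A loop, with u = v, occurs if S contains the unit.\<close>

definition adj where "adj u v \<longleftrightarrow> (u, v) \<in> cayley_edges G S \<or> (v, u) \<in> cayley_edges G S"

abbreviation "pts \<equiv> cayley_points G S"
abbreviation "cpath \<equiv> cayley_path G S"
abbreviation "cd \<equiv> cayley_dist G S"
definition vertex where "vertex u = edge_point u u (0::real)"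

lemma edge_point_flip: "edge_point u v t = edge_point v u (1 - t)"
  by (auto simp: vertex_def edge_point_def)

lemma edge_point_0: "edge_point u v 0 = vertex u"
  and edge_point_1: "edge_point u v 1 = vertex v"
  and edge_point_same: "edge_point u u t = vertex u"
  by (auto simp: vertex_def edge_point_def indicator_def)

lemma edge_point_nonzero: "edge_point u v t w \<noteq> 0 \<Longrightarrow> w = u \<or> w = v"
  by (cases "w = u"; cases "w = v") (auto simp: edge_point_def)

lemma adj_sym: "adj u v \<Longrightarrow> adj v u"
  by (auto simp: adj_def)

lemma adj_closed: "adj u v \<Longrightarrow> u \<in> carrier G \<and> v \<in> carrier G"
  using gens_closed by (auto simp: adj_def cayley_edges_def)

lemma adjI: "u \<in> carrier G \<Longrightarrow> s \<in> sym_gens \<Longrightarrow> adj u (u \<otimes> s)"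
proof -
  assume u: "u \<in> carrier G" and s: "s \<in> sym_gens"
  show ?thesis
  proof (cases "s \<in> S")
    case True
    then show ?thesis using u by (auto simp: adj_def cayley_edges_def)
  next
    case False
    then obtain r where r: "r \<in> S" "s = inv r" using s by (auto simp: SET_INV_def)
    have "u = (u \<otimes> s) \<otimes> r" using u r gens_closed by (auto simp: m_assoc)
    moreover have "u \<otimes> s \<in> carrier G" using u s sym_gens_closed by auto
    ultimately have "(u \<otimes> s, u) \<in> cayley_edges G S" unfolding cayley_edges_def using r(1) by blast
    then show ?thesis by (simp add: adj_def)
  qed
qed

lemma adj_wdist:
  assumes "adj u v"
  shows "wdist u v \<le> 1"
proof -
  have *: "wdist a b \<le> 1" if "(a, b) \<in> cayley_edges G S" for a b
  proof -
    from that obtain s where s: "a \<in> carrier G" "s \<in> S" "b = a \<otimes> s" by (auto simp: cayley_edges_def)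
    then have "inv a \<otimes> b = s" using gens_closed by (auto simp: m_assoc[symmetric])
    then show ?thesis unfolding wdist_def using wl_gen s by auto
  qed
  show ?thesis
    using assms *[of u v] *[of v u] wdist_sym adj_closed[OF assms] by (auto simp: adj_def)
qed

lemma pts_vertex: "u \<in> carrier G \<Longrightarrow> vertex u \<in> pts"
  unfolding cayley_points_def vertex_def by blast

lemma pts_edge: "adj u v \<Longrightarrow> t \<in> {0..1} \<Longrightarrow> edge_point u v t \<in> pts"
proof -
  have *: "edge_point u v t \<in> pts" if "(u, v) \<in> cayley_edges G S" "t \<in> {0..1}" for u v t
    using that unfolding cayley_points_def vertex_def by blast
  assume "adj u v" "t \<in> {0..1}"
  then show ?thesis using *[of u v t] *[of v u "1 - t"] edge_point_flip[of u v t] by (auto simp: adj_def)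
qed

lemma pts_cases:
  assumes "x \<in> pts"
  obtains u where "u \<in> carrier G" "x = vertex u"
  | u v t where "adj u v" "u \<noteq> v" "t \<in> {0..1}" "x = edge_point u v t"
proof -
  from assms consider u where "u \<in> carrier G" "x = vertex u"
    | u v t where "(u, v) \<in> cayley_edges G S" "t \<in> {0..1}" "x = edge_point u v t"
    unfolding cayley_points_def vertex_def by blast
  then show thesis
  proof cases
    case 1
    then show ?thesis using that(1) by blast
  next
    case (2 u v t)
    then have "adj u v" by (simp add: adj_def)
    then show ?thesis using that(2)[of u v t] that(1)[of u] 2 adj_closed edge_point_same by metis
  qed
qed

section \<open>Paths: both orientations, concatenation, reversal and words\<close>

lemma path_step:
  assumes "cpath x (edge_point u v t) l" "adj u v" "t \<in> {0..1}" "t' \<in> {0..1}"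
  shows "cpath x (edge_point u v t') (l + \<bar>t - t'\<bar>)"
proof (cases "(u, v) \<in> cayley_edges G S")
  case True
  from cayley_path.step[OF assms(1) this assms(3,4)] show ?thesis .
next
  case False
  then have "(v, u) \<in> cayley_edges G S" using assms by (auto simp: adj_def)
  moreover have "cpath x (edge_point v u (1 - t)) l" using assms(1) edge_point_flip by metis
  ultimately have "cpath x (edge_point v u (1 - t')) (l + \<bar>(1 - t) - (1 - t')\<bar>)"
    using assms(3,4) by (intro cayley_path.step) auto
  then show ?thesis by (simp add: edge_point_flip[of u v t'] abs_minus_commute)
qed

lemma path_pts: "cpath x y l \<Longrightarrow> x \<in> pts \<and> y \<in> pts \<and> 0 \<le> l"
proof (induction rule: cayley_path.induct)
  case (step x u v t l t')
  then show ?case using pts_edge[of u v t'] by (auto simp: adj_def)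
qed auto

lemma path_trans:
  assumes "cpath y z m" "cpath x y l"
  shows "cpath x z (l + m)"
  using assms
proof (induction arbitrary: l rule: cayley_path.induct)
  case (step y u v t m t')
  then show ?case using cayley_path.step[of G S x u v t "l + m" t'] by (simp add: add.assoc)
qed auto

lemma path_edge:
  assumes "adj u v" "s \<in> {0..1}" "t \<in> {0..1}"
  shows "cpath (edge_point u v s) (edge_point u v t) \<bar>s - t\<bar>"
  using path_step[OF cayley_path.refl[OF pts_edge[OF assms(1,2)]] assms] by simp

lemma path_sym: "cpath x y l \<Longrightarrow> cpath y x l"
proof (induction rule: cayley_path.induct)
  case (refl x)
  then show ?case by (rule cayley_path.refl)
next
  case (step x u v t l t')
  have "cpath (edge_point u v t') (edge_point u v t) \<bar>t' - t\<bar>"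
    using step by (intro path_edge) (auto simp: adj_def)
  from path_trans[OF step.IH this] show ?case by (simp add: abs_minus_commute add.commute)
qed

lemma path_words:
  "g \<in> carrier G \<Longrightarrow> k \<in> sphere_words n \<Longrightarrow> cpath (vertex g) (vertex (g \<otimes> k)) (real n)"
proof (induction n arbitrary: k)
  case 0
  then show ?case using cayley_path.refl[OF pts_vertex] by simp
next
  case (Suc n)
  then obtain z s where z: "z \<in> sphere_words n" "s \<in> sym_gens" "k = z \<otimes> s" by (auto simp: set_mult_def)
  have zc: "z \<in> carrier G" using z set_power_closed[OF sym_gens_closed] by blast
  have sc: "s \<in> carrier G" using z sym_gens_closed by blast
  have k: "g \<otimes> k = (g \<otimes> z) \<otimes> s" using z zc sc Suc.prems(1) by (simp add: m_assoc)
  have "adj (g \<otimes> z) (g \<otimes> k)" unfolding k using adjI[of "g \<otimes> z" s] z zc Suc.prems by simp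
  then have "cpath (vertex (g \<otimes> z)) (vertex (g \<otimes> k)) \<bar>0 - 1\<bar>"
    using path_edge[of "g \<otimes> z" "g \<otimes> k" 0 1] by (simp add: edge_point_0 edge_point_1)
  from path_trans[OF this Suc.IH[OF Suc.prems(1) z(1)]] show ?case by (simp add: add.commute)
qed

lemma path_vertices:
  assumes "g \<in> carrier G" "h \<in> carrier G"
  shows "cpath (vertex g) (vertex h) (real (wdist g h))"
proof -
  have "g \<otimes> (inv g \<otimes> h) = h" using assms by (simp add: m_assoc[symmetric])
  then show ?thesis
    using path_words[OF assms(1) wl_in[of "inv g \<otimes> h"]] assms by (simp add: wdist_def)
qed

text \<open>Barycentric coordinates are 1-Lipschitz along edges. Hence points joined by a path of
  length 0 coincide.\<close>

lemma path_coordinate: "cpath x y l \<Longrightarrow> \<bar>x w - y w\<bar> \<le> l"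
proof (induction rule: cayley_path.induct)
  case (step x u v t l t')
  have "\<bar>edge_point u v t w - edge_point u v t' w\<bar> \<le> \<bar>t - t'\<bar>"
    by (auto simp: vertex_def edge_point_def indicator_def)
  then show ?case using step.IH by linarith
qed auto

text \<open>Extends a function on vertices affinely over the edges; the sum is finite because a
  point of the realisation has at most two nonzero coordinates.\<close>

definition linear_ext where "linear_ext f z = (\<Sum>w | z w \<noteq> 0. z w * f w)" for f z :: "_ \<Rightarrow> real"

lemma linear_ext_edge_point: "linear_ext f (edge_point u v t) = (1 - t) * f u + t * f v"
proof (cases "u = v")
  case True
  have "{w. edge_point u u t w \<noteq> 0} = {u}" by (auto simp: vertex_def edge_point_def indicator_def)
  then show ?thesis
    using True by (simp add: linear_ext_def) (simp add: edge_point_def algebra_simps)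
next
  case False
  have "linear_ext f (edge_point u v t) = (\<Sum>w\<in>{u, v}. edge_point u v t w * f w)"
    unfolding linear_ext_def by (intro sum.mono_neutral_left) (use edge_point_nonzero in \<open>fastforce+\<close>)
  then show ?thesis using False by (simp add: edge_point_def)
qed

lemma path_linear_ext:
  assumes "\<And>u v. adj u v \<Longrightarrow> \<bar>f u - f v\<bar> \<le> 1"
  shows "cpath x y l \<Longrightarrow> \<bar>linear_ext f x - linear_ext f y\<bar> \<le> l"
proof (induction rule: cayley_path.induct)
  case (step x u v t l t')
  have "linear_ext f (edge_point u v t) - linear_ext f (edge_point u v t') = (t - t') * (f v - f u)"
    by (simp add: linear_ext_edge_point algebra_simps)
  moreover have "\<bar>(t - t') * (f v - f u)\<bar> \<le> \<bar>t - t'\<bar> * 1"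
    unfolding abs_mult using step.hyps assms[of u v]
    by (intro mult_left_mono) (auto simp: adj_def abs_minus_commute)
  ultimately have "\<bar>linear_ext f (edge_point u v t) - linear_ext f (edge_point u v t')\<bar> \<le> \<bar>t - t'\<bar>"
    by simp
  then show ?case using step.IH by linarith
qed auto

text \<open>The word distance from g is 1-Lipschitz on adjacent vertices, so its affine extension is
  1-Lipschitz along paths; it rises from 0 at g to \<open>wdist g h\<close> at h.\<close>

lemma path_vertices_ge:
  assumes "g \<in> carrier G" "h \<in> carrier G" "cpath (vertex g) (vertex h) l"
  shows "real (wdist g h) \<le> l"
proof -
  have "\<bar>real (wdist g u) - real (wdist g v)\<bar> \<le> 1" if "adj u v" for u v
    using adj_wdist[OF that] adj_closed[OF that] assms(1) wdist_triangle[of g u v]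
      wdist_triangle[of g v u] wdist_sym[of u v] by auto
  from path_linear_ext[of "\<lambda>u. real (wdist g u)", OF this assms(3)]
  show ?thesis by (simp add: vertex_def linear_ext_edge_point wdist_self assms)
qed

text \<open>The nonzero coordinates of x mark vertices of its edge, and the coordinate at a tells
  how far a is: the segment from x to a has length 1 - x a.\<close>

lemma pts_support:
  assumes "x \<in> pts"
  shows "finite {w. x w \<noteq> 0}" "\<exists>a\<in>carrier G. x a \<noteq> 0"
    "x a \<noteq> 0 \<Longrightarrow> a \<in> carrier G \<and> 0 < x a \<and> x a \<le> 1 \<and> cpath x (vertex a) (1 - x a)"
proof -
  have fin: "{w. edge_point u v t w \<noteq> 0} \<subseteq> {u, v}" for u v t
    using edge_point_nonzero by fastforce
  show "finite {w. x w \<noteq> 0}"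
    using assms by (cases rule: pts_cases) (auto simp: vertex_def intro: finite_subset[OF fin])
  show "\<exists>a\<in>carrier G. x a \<noteq> 0"
    using assms
  proof (cases rule: pts_cases)
    case (1 u)
    then show ?thesis by (intro bexI[of _ u]) (auto simp: vertex_def edge_point_def)
  next
    case (2 u v t)
    then have "x u = 1 - t" "x v = t" by (auto simp: edge_point_def)
    then have "x u \<noteq> 0 \<or> x v \<noteq> 0" by auto
    then show ?thesis using adj_closed[OF 2(1)] by auto
  qed
  assume a: "x a \<noteq> 0"
  show "a \<in> carrier G \<and> 0 < x a \<and> x a \<le> 1 \<and> cpath x (vertex a) (1 - x a)"
    using assms
  proof (cases rule: pts_cases)
    case (1 u)
    then have "a = u" "x a = 1" using a edge_point_nonzero[of u u 0 a] by (auto simp: vertex_def edge_point_def)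
    then show ?thesis using 1 cayley_path.refl[OF assms] by simp
  next
    case (2 u v t)
    consider "a = u" | "a = v"
      using a edge_point_nonzero[of u v t a] 2(4) by auto
    then show ?thesis
    proof cases
      case 1
      then have "x a = 1 - t" using 2 by (simp add: edge_point_def)
      then show ?thesis
        using path_edge[OF 2(1) 2(3), of 0] 2 1 a adj_closed[OF 2(1)] by (simp add: edge_point_0)
    next
      case c: 2
      then have "x a = t" using 2 by (simp add: edge_point_def)
      then show ?thesis
        using path_edge[OF 2(1) 2(3), of 1] 2 c a adj_closed[OF 2(1)]
        by (simp add: edge_point_1 abs_of_nonpos)
    qed
  qed
qed

text \<open>
  A path can be shortened to one that stays in one edge or one that passes through vertices \<open>a\<close> and
  \<open>b\<close> and runs along a word in between. Only finitely many lengths arise in this way, so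
  the infimum defining the distance is attained.
\<close>

definition edge_length where
  "edge_length x y l \<longleftrightarrow> (\<exists>u v s t. adj u v \<and> u \<noteq> v \<and> s \<in> {0..1} \<and> t \<in> {0..1} \<and>
     x = edge_point u v s \<and> y = edge_point u v t \<and> l = \<bar>s - t\<bar>)"

definition vertex_length where
  "vertex_length x y l \<longleftrightarrow> (\<exists>a b. x a \<noteq> 0 \<and> y b \<noteq> 0 \<and> l = (1 - x a) + real (wdist a b) + (1 - y b))"

lemma edge_length_path: "edge_length x y l \<Longrightarrow> cpath x y l"
  unfolding edge_length_def using path_edge by blast

lemma vertex_length_path:
  assumes "x \<in> pts" "y \<in> pts" "vertex_length x y l"
  shows "cpath x y l"
proof -
  from assms(3) obtain a b where ab: "x a \<noteq> 0" "y b \<noteq> 0"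
    "l = (1 - x a) + real (wdist a b) + (1 - y b)" unfolding vertex_length_def by blast
  have a: "a \<in> carrier G" "cpath x (vertex a) (1 - x a)" using pts_support(3)[OF assms(1) ab(1)] by auto
  have b: "b \<in> carrier G" "cpath y (vertex b) (1 - y b)" using pts_support(3)[OF assms(2) ab(2)] by auto
  show ?thesis
    using path_trans[OF path_sym[OF b(2)] path_trans[OF path_vertices[OF a(1) b(1)] a(2)]] ab(3) by simp
qed

text \<open>Coordinate 1 means that y is the vertex b. This turns a path inside one edge into one
  through vertices, so that it can be continued into another edge.\<close>

lemma edge_length_at_vertex:
  assumes "edge_length x y l" "y b = 1"
  shows "\<exists>l'\<le>l. vertex_length x y l'"
proof -
  from assms obtain u v s t where uv: "adj u v" "u \<noteq> v" "s \<in> {0..1}" "t \<in> {0..1}"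
    "x = edge_point u v s" "y = edge_point u v t" "l = \<bar>s - t\<bar>" unfolding edge_length_def by blast
  have cl: "u \<in> carrier G" "v \<in> carrier G" using adj_closed uv by auto
  have eval: "x u = 1 - s" "x v = s" "y u = 1 - t" "y v = t" using uv by (auto simp: vertex_def edge_point_def)
  have "b = u \<and> t = 0 \<or> b = v \<and> t = 1"
    using edge_point_nonzero[of u v t b] assms(2) eval uv(6) by auto
  \<comment> \<open>Usually b serves as both vertices. Only if x is the opposite end of the edge
    does its coordinate at b vanish; then the first vertex is that end.\<close>
  then consider "b = u" "t = 0" "s < 1" | "b = u" "t = 0" "s = 1" | "b = v" "t = 1" "0 < s"
    | "b = v" "t = 1" "s = 0" using uv(3) by force
  then show ?thesis
  proof cases
    case 1
    then have "vertex_length x y s" unfolding vertex_length_def using eval cl wdist_self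
      by (intro exI[of _ u]) auto
    then show ?thesis using uv 1 by auto
  next
    case 2
    then have "vertex_length x y (real (wdist v u))" unfolding vertex_length_def using eval
      by (intro exI[of _ v] exI[of _ u]) auto
    then show ?thesis using uv 2 adj_wdist[OF adj_sym[OF uv(1)]] by (intro exI[of _ "real (wdist v u)"]) auto
  next
    case 3
    then have "vertex_length x y (1 - s)" unfolding vertex_length_def using eval cl wdist_self
      by (intro exI[of _ v]) auto
    then show ?thesis using uv 3 by (intro exI[of _ "1 - s"]) auto
  next
    case 4
    then have "vertex_length x y (real (wdist u v))" unfolding vertex_length_def using eval
      by (intro exI[of _ u] exI[of _ v]) auto
    then show ?thesis using uv 4 adj_wdist[OF uv(1)] by (intro exI[of _ "real (wdist u v)"]) auto
  qed
qed

text \<open>The last vertex b is kept while its coordinate stays nonzero. If the end point moves all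
  the way to the other end of the edge, that end replaces b, and the word distance changes by at
  most 1.\<close>

lemma vertex_length_step:
  assumes "x \<in> pts" "vertex_length x (edge_point u v t) l" "adj u v" "u \<noteq> v" "t \<in> {0..1}" "t' \<in> {0..1}"
  shows "\<exists>l'\<le>l + \<bar>t - t'\<bar>. vertex_length x (edge_point u v t') l'"
proof -
  let ?y = "edge_point u v t" and ?y' = "edge_point u v t'"
  from assms(2) obtain a b where ab: "x a \<noteq> 0" "?y b \<noteq> 0"
    "l = (1 - x a) + real (wdist a b) + (1 - ?y b)" unfolding vertex_length_def by blast
  have a: "a \<in> carrier G" using pts_support(3)[OF assms(1) ab(1)] by auto
  have cl: "u \<in> carrier G" "v \<in> carrier G" using adj_closed assms by auto
  have tri: "wdist a u \<le> wdist a v + 1" "wdist a v \<le> wdist a u + 1"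
    using wdist_triangle[OF a cl] wdist_triangle[OF a cl(2,1)] adj_wdist[OF assms(3)]
      adj_wdist[OF adj_sym[OF assms(3)]] by auto
  have eval: "?y u = 1 - t" "?y v = t" "?y' u = 1 - t'" "?y' v = t'" 
    using assms(4) by (auto simp: vertex_def edge_point_def)
  have intro: "\<exists>l'\<le>l + \<bar>t - t'\<bar>. vertex_length x ?y' l'"
    if "?y' b' \<noteq> 0" "real (wdist a b') + (1 - ?y' b') \<le> real (wdist a b) + (1 - ?y b) + \<bar>t - t'\<bar>" for b'
  proof -
    have "vertex_length x ?y' ((1 - x a) + real (wdist a b') + (1 - ?y' b'))"
      unfolding vertex_length_def using ab(1) that(1) by blast
    then show ?thesis using that(2) ab(3) by (intro exI conjI) auto
  qed
  consider "b = u" | "b = v"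
    using edge_point_nonzero[OF ab(2)] by blast
  then show ?thesis
  proof cases
    case 1
    show ?thesis
      using intro[of u] intro[of v] eval 1 tri assms(5,6) by (cases "t' = 1") auto
  next
    case 2
    show ?thesis
      using intro[of u] intro[of v] eval 2 tri assms(5,6) by (cases "t' = 0") auto
  qed
qed

text \<open>An interior point determines its edge up to orientation, so the path stays in one edge;
  at a vertex \<open>edge_length_at_vertex\<close> reduces to the previous lemma.\<close>

lemma edge_length_step:
  assumes "x \<in> pts" "edge_length x (edge_point u v t) l" "adj u v" "u \<noteq> v" "t \<in> {0..1}" "t' \<in> {0..1}"
  shows "\<exists>l'\<le>l + \<bar>t - t'\<bar>. vertex_length x (edge_point u v t') l' \<or> edge_length x (edge_point u v t') l'"
proof -
  let ?y = "edge_point u v t"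
  from assms(2) obtain p q s r where pq: "adj p q" "p \<noteq> q" "s \<in> {0..1}" "r \<in> {0..1}"
    "x = edge_point p q s" "?y = edge_point p q r" "l = \<bar>s - r\<bar>" unfolding edge_length_def by blast
  have eval: "?y u = 1 - t" "?y v = t" using assms(4) by (auto simp: vertex_def edge_point_def)
  show ?thesis
  proof (cases "t = 0 \<or> t = 1")
    case True
    then have "?y u = 1 \<or> ?y v = 1" using eval by auto
    then obtain l1 where "l1 \<le> l" "vertex_length x ?y l1"
      using edge_length_at_vertex assms(2) by blast
    then show ?thesis
      using vertex_length_step[OF assms(1) _ assms(3-6), of l1] by (meson add_right_mono order_trans)
  next
    case False
    then have ne: "edge_point p q r u \<noteq> 0" "edge_point p q r v \<noteq> 0" using eval pq(6) by auto
    then have "p = u \<and> q = v \<or> p = v \<and> q = u"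
      using assms(4) edge_point_nonzero by metis
    then obtain s' where s': "s' \<in> {0..1}" "x = edge_point u v s'" "l = \<bar>s' - t\<bar>"
    proof
      assume *: "p = u \<and> q = v"
      then have "edge_point u v r v = t" using eval pq by simp
      then have "r = t" using assms(4) by (simp add: edge_point_def)
      then show thesis using that[of s] pq * by auto
    next
      assume *: "p = v \<and> q = u"
      have "edge_point v u r u = 1 - t" using * eval pq by simp
      then have "r = 1 - t" using assms(4) by (simp add: edge_point_def)
      then show thesis using that[of "1 - s"] pq * edge_point_flip[of v u s] by auto
    qed
    then have "edge_length x (edge_point u v t') \<bar>s' - t'\<bar>"
      unfolding edge_length_def using assms by blast
    moreover have "\<bar>s' - t'\<bar> \<le> l + \<bar>t - t'\<bar>" using s' by simp
    ultimately show ?thesis by blast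
  qed
qed

lemma path_shorten:
  "cpath x y l \<Longrightarrow> \<exists>l'\<le>l. vertex_length x y l' \<or> edge_length x y l'"
proof (induction rule: cayley_path.induct)
  case (refl x)
  then show ?case
  proof (cases rule: pts_cases)
    case (1 u)
    then have "vertex_length x x 0" unfolding vertex_length_def using wdist_self
      by (intro exI[of _ u]) (auto simp: vertex_def edge_point_def)
    then show ?thesis by blast
  next
    case (2 u v t)
    then have "edge_length x x 0" unfolding edge_length_def by fastforce
    then show ?thesis by blast
  qed
next
  case (step x u v t l t')
  have adj: "adj u v" using step by (simp add: adj_def)
  obtain l1 where l1: "l1 \<le> l" "vertex_length x (edge_point u v t) l1 \<or> edge_length x (edge_point u v t) l1"
    using step.IH by blast
  have x: "x \<in> pts" using path_pts step.hyps(1) by blast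
  show ?case
  \<comment> \<open>A loop is collapsed to a point, so a step along it does not move the end
    point.\<close>
  proof (cases "u = v")
    case True
    then have "edge_point u v t' = edge_point u v t" using edge_point_same by metis
    moreover have "l1 \<le> l + \<bar>t - t'\<bar>" using l1(1) by simp
    ultimately show ?thesis using l1(2) by metis
  next
    case False
    then have "\<exists>l'\<le>l1 + \<bar>t - t'\<bar>. vertex_length x (edge_point u v t') l' \<or> edge_length x (edge_point u v t') l'"
      using l1(2) vertex_length_step[OF x _ adj False step.hyps(3,4)]
        edge_length_step[OF x _ adj False step.hyps(3,4)] by blast
    then show ?thesis using l1(1) by (meson add_right_mono order_trans)
  qed
qed

text \<open>The first kind of length is indexed by pairs from the two finite supports, the second is
  a single coordinate difference. The value 0 is added for the case that both coordinates at v
  vanish.\<close>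

lemma finite_short_lengths:
  assumes "x \<in> pts" "y \<in> pts"
  shows "finite {l. vertex_length x y l \<or> edge_length x y l}"
proof -
  let ?A = "{w. x w \<noteq> 0}" and ?B = "{w. y w \<noteq> 0}"
  have fin: "finite ?A" "finite ?B" using pts_support(1) assms by auto
  have "{l. vertex_length x y l \<or> edge_length x y l} \<subseteq>
    (\<lambda>(a, b). (1 - x a) + real (wdist a b) + (1 - y b)) ` (?A \<times> ?B) \<union>
    insert 0 ((\<lambda>w. \<bar>x w - y w\<bar>) ` (?A \<union> ?B))"
  proof
    fix l assume "l \<in> {l. vertex_length x y l \<or> edge_length x y l}"
    then consider "vertex_length x y l" | "edge_length x y l" by blast
    then show "l \<in> (\<lambda>(a, b). (1 - x a) + real (wdist a b) + (1 - y b)) ` (?A \<times> ?B) \<union>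
      insert 0 ((\<lambda>w. \<bar>x w - y w\<bar>) ` (?A \<union> ?B))"
    proof cases
      case 1
      then show ?thesis unfolding vertex_length_def by force
    next
      case 2
      then obtain u v s t where "u \<noteq> v" "x = edge_point u v s" "y = edge_point u v t" "l = \<bar>s - t\<bar>"
        unfolding edge_length_def by blast
      then have "l = \<bar>x v - y v\<bar>" by (auto simp: vertex_def edge_point_def)
      then show ?thesis by (cases "x v = 0 \<and> y v = 0") auto
    qed
  qed
  then show ?thesis by (rule finite_subset) (use fin in auto)
qed

lemma path_exists:
  assumes "x \<in> pts" "y \<in> pts"
  shows "\<exists>l. cpath x y l"
proof -
  obtain a b where ab: "x a \<noteq> 0" "y b \<noteq> 0" using pts_support(2) assms by meson
  then have "vertex_length x y ((1 - x a) + real (wdist a b) + (1 - y b))"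
    unfolding vertex_length_def by blast
  then show ?thesis using vertex_length_path assms by blast
qed

lemma cayley_dist_attained:
  assumes "x \<in> pts" "y \<in> pts"
  shows "cpath x y (cd x y)"
proof -
  let ?L = "{l. vertex_length x y l \<or> edge_length x y l}"
  have fin: "finite ?L" by (rule finite_short_lengths[OF assms])
  have ne: "?L \<noteq> {}" using path_exists[OF assms] path_shorten by blast
  have "Min ?L \<in> ?L" using Min_in[OF fin ne] .
  then have "cpath x y (Min ?L)" using vertex_length_path[OF assms] edge_length_path by blast
  moreover have "Min ?L \<le> l" if l: "cpath x y l" for l
  proof -
    obtain l' where "l' \<le> l" "l' \<in> ?L" using path_shorten[OF l] by blast
    then show ?thesis using Min_le[OF fin] by (meson order_trans)
  qed
  ultimately have "Inf {l. cpath x y l} = Min ?L" by (intro cInf_eq_minimum) auto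
  then show ?thesis using \<open>cpath x y (Min ?L)\<close> assms by (simp add: cayley_dist_def)
qed

section \<open>The path metric and its geodesics\<close>

lemma cayley_dist_le: "cpath x y l \<Longrightarrow> cd x y \<le> l"
proof -
  assume p: "cpath x y l"
  then have "x \<in> pts" "y \<in> pts" using path_pts by blast+
  moreover have "bdd_below {l. cpath x y l}" using path_pts by (intro bdd_belowI[of _ 0]) blast
  ultimately show ?thesis unfolding cayley_dist_def using p by (auto intro: cInf_lower)
qed

lemma cayley_Metric_space: "Metric_space pts cd"
proof
  show "0 \<le> cd x y" for x y
  proof (cases "x \<in> pts \<and> y \<in> pts")
    case True
    then show ?thesis using cayley_dist_attained path_pts by blast
  qed (auto simp: cayley_dist_def)
  have le: "cd y x \<le> cd x y" if "x \<in> pts" "y \<in> pts" for x y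
    using cayley_dist_le[OF path_sym[OF cayley_dist_attained[OF that]]] .
  show "cd x y = cd y x" for x y
  proof (cases "x \<in> pts \<and> y \<in> pts")
    case True
    then show ?thesis using le by (intro antisym) auto
  qed (auto simp: cayley_dist_def)
  show "cd x y = 0 \<longleftrightarrow> x = y" if "x \<in> pts" "y \<in> pts" for x y
  proof
    assume "cd x y = 0"
    then have "\<bar>x w - y w\<bar> \<le> 0" for w using path_coordinate[OF cayley_dist_attained[OF that]] by metis
    then show "x = y" by (intro ext) auto
  next
    assume "x = y"
    then show "cd x y = 0"
      using cayley_dist_le[OF cayley_path.refl] path_pts[OF cayley_dist_attained] that
      by (metis order_antisym)
  qed
  show "cd x z \<le> cd x y + cd y z" if "x \<in> pts" "y \<in> pts" "z \<in> pts" for x y z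
    using cayley_dist_le[OF path_trans[OF cayley_dist_attained cayley_dist_attained]] that by blast
qed

lemma cayley_dist_vertex:
  assumes "g \<in> carrier G" "h \<in> carrier G"
  shows "cd (vertex g) (vertex h) = real (wdist g h)"
  using cayley_dist_le[OF path_vertices[OF assms]]
    path_vertices_ge[OF assms cayley_dist_attained[OF pts_vertex pts_vertex]] assms
  by (simp add: order_antisym)

lemma near_vertex:
  assumes "x \<in> pts"
  shows "\<exists>g\<in>carrier G. cd x (vertex g) \<le> 1"
proof -
  obtain a where a: "a \<in> carrier G" "x a \<noteq> 0" using pts_support(2) assms by blast
  have "0 < x a" "cpath x (vertex a) (1 - x a)" using pts_support(3)[OF assms a(2)] by auto
  then show ?thesis using a(1) cayley_dist_le by (intro bexI[of _ a]) fastforce+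
qed

text \<open>Traversing the steps one after the other at unit speed gives a 1-Lipschitz curve on the
  interval from 0 to l.\<close>

lemma path_curve:
  assumes "cpath x y l"
  shows "\<exists>c. c 0 = x \<and> c l = y \<and> (\<forall>s\<in>{0..l}. c s \<in> pts) \<and>
    (\<forall>s t. 0 \<le> s \<longrightarrow> s \<le> t \<longrightarrow> t \<le> l \<longrightarrow> cd (c s) (c t) \<le> t - s)"
  using assms
proof (induction rule: cayley_path.induct)
  case (refl x)
  interpret Metric_space pts cd by (rule cayley_Metric_space)
  show ?case using refl by (intro exI[of _ "\<lambda>_. x"]) auto
next
  case (step x u v t l t')
  interpret Metric_space pts cd by (rule cayley_Metric_space)
  have adj: "adj u v" using step by (simp add: adj_def)
  obtain c where c: "c 0 = x" "c l = edge_point u v t" "\<forall>s\<in>{0..l}. c s \<in> pts"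
    "\<And>s t. 0 \<le> s \<Longrightarrow> s \<le> t \<Longrightarrow> t \<le> l \<Longrightarrow> cd (c s) (c t) \<le> t - s" using step.IH by blast
  have l0: "0 \<le> l" using path_pts step.hyps(1) by blast
  \<comment> \<open>The edge parameter reached at time r: from t at time l it moves at unit speed
    towards t'.\<close>
  define e where "e r = t + sgn (t' - t) * (r - l)" for r
  define c' where "c' r = (if r \<le> l then c r else edge_point u v (e r))" for r
  have e_in: "e r \<in> {0..1}" if "l \<le> r" "r \<le> l + \<bar>t - t'\<bar>" for r
    using that step.hyps(3,4) by (auto simp: e_def sgn_if)
  have el: "e l = t" "e (l + \<bar>t - t'\<bar>) = t'" by (auto simp: e_def sgn_if)
  have e_dist: "cd (edge_point u v (e r)) (edge_point u v (e r')) \<le> r' - r"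
    if "l \<le> r" "r \<le> r'" "r' \<le> l + \<bar>t - t'\<bar>" for r r'
  proof -
    have "\<bar>e r - e r'\<bar> \<le> r' - r" using that by (auto simp: e_def sgn_if)
    then show ?thesis
      using cayley_dist_le[OF path_edge[OF adj e_in e_in], of r r'] that by linarith
  qed
  have c'l: "c' r = edge_point u v (e r)" if "l \<le> r" for r
    using that c(2) el(1) by (auto simp: c'_def)
  have c'_in: "c' r \<in> pts" if "0 \<le> r" "r \<le> l + \<bar>t - t'\<bar>" for r
    using c(3) pts_edge[OF adj e_in] that by (auto simp: c'_def)
  have "cd (c' s) (c' r) \<le> r - s" if sr: "0 \<le> s" "s \<le> r" "r \<le> l + \<bar>t - t'\<bar>" for s r
  proof -
    consider "r \<le> l" | "l \<le> s" | "s \<le> l" "l \<le> r" by linarith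
    then show ?thesis
    proof cases
      case 1
      then show ?thesis using c(4) sr by (simp add: c'_def)
    next
      case 2
      then show ?thesis using e_dist sr c'l by simp
    next
      case 3
      have "cd (c' s) (c' l) \<le> l - s" using c(4)[of s l] sr 3 by (simp add: c'_def)
      moreover have "cd (c' l) (c' r) \<le> r - l" using e_dist[of l r] sr 3 c'l by simp
      moreover have "cd (c' s) (c' r) \<le> cd (c' s) (c' l) + cd (c' l) (c' r)"
        using sr l0 3 by (intro triangle c'_in) auto
      ultimately show ?thesis by linarith
    qed
  qed
  moreover have "c' 0 = x" using l0 c by (simp add: c'_def)
  moreover have "c' (l + \<bar>t - t'\<bar>) = edge_point u v t'" using c'l el(2) by simp
  ultimately show ?case using c'_in by (intro exI[of _ c']) auto
qed

text \<open>A path of minimal length is attained; its unit speed curve is 1-Lipschitz, and since its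
  duration equals the distance of its ends, the triangle inequality leaves no slack on any
  subinterval.\<close>

theorem cayley_geodesic: "geodesic_metric_space pts cd"
proof -
  interpret Metric_space pts cd by (rule cayley_Metric_space)
  have "\<exists>A. geodesic_segment pts cd x y A" if xy: "x \<in> pts" "y \<in> pts" for x y
  proof -
    obtain c where c: "c 0 = x" "c (cd x y) = y" "\<forall>s\<in>{0..cd x y}. c s \<in> pts"
      "\<And>s t. 0 \<le> s \<Longrightarrow> s \<le> t \<Longrightarrow> t \<le> cd x y \<Longrightarrow> cd (c s) (c t) \<le> t - s"
      using path_curve[OF cayley_dist_attained[OF xy]] by blast
    have le: "cd (c s) (c t) = t - s" if "0 \<le> s" "s \<le> t" "t \<le> cd x y" for s t
    proof -
      have "c s \<in> pts" "c t \<in> pts" using c(3) that by auto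
      then have "cd x y \<le> cd x (c s) + cd (c s) (c t) + cd (c t) y"
        using triangle[of x "c s" y] triangle[of "c s" "c t" y] xy by linarith
      then show ?thesis
        using c(4)[of 0 s] c(4)[of t "cd x y"] c(4)[of s t] c(1,2) that by auto
    qed
    have "cd (c s) (c t) = \<bar>s - t\<bar>" if "s \<in> {0..cd x y}" "t \<in> {0..cd x y}" for s t
      using le[of s t] le[of t s] that commute by (cases "s \<le> t") auto
    then have "geodesic_segment pts cd x y (c ` {0..cd x y})"
      unfolding geodesic_segment_def using c by (intro exI[of _ c]) auto
    then show ?thesis by blast
  qed
  then show ?thesis
    unfolding geodesic_metric_space_def using cayley_Metric_space by blast
qed

end

section \<open>Cocycles of commuting actions\<close>

lemma
  assumes "free_mp_action G M act"
  shows mp_action_closed: "\<lbrakk>g \<in> carrier G; x \<in> space M\<rbrakk> \<Longrightarrow> act g x \<in> space M"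
    and mp_action_mult: "\<lbrakk>g \<in> carrier G; h \<in> carrier G; x \<in> space M\<rbrakk> \<Longrightarrow>
      act (g \<otimes>\<^bsub>G\<^esub> h) x = act g (act h x)"
    and mp_action_one: "x \<in> space M \<Longrightarrow> act \<one>\<^bsub>G\<^esub> x = x"
    and mp_action_measurable: "g \<in> carrier G \<Longrightarrow> act g \<in> M \<rightarrow>\<^sub>M M"
    and mp_action_emeasure: "\<lbrakk>g \<in> carrier G; A \<in> sets M\<rbrakk> \<Longrightarrow>
      emeasure M (act g -` A \<inter> space M) = emeasure M A"
proof -
  interpret group_action G "space M" act using assms by (simp add: free_mp_action_def)
  show "\<lbrakk>g \<in> carrier G; x \<in> space M\<rbrakk> \<Longrightarrow> act g x \<in> space M" using element_image by blast
  show "\<lbrakk>g \<in> carrier G; h \<in> carrier G; x \<in> space M\<rbrakk> \<Longrightarrow> act (g \<otimes>\<^bsub>G\<^esub> h) x = act g (act h x)"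
    using composition_rule by blast
  show "x \<in> space M \<Longrightarrow> act \<one>\<^bsub>G\<^esub> x = x" using id_eq_one by (metis restrict_apply')
  show m: "g \<in> carrier G \<Longrightarrow> act g \<in> M \<rightarrow>\<^sub>M M" using assms by (simp add: free_mp_action_def)
  show "\<lbrakk>g \<in> carrier G; A \<in> sets M\<rbrakk> \<Longrightarrow> emeasure M (act g -` A \<inter> space M) = emeasure M A"
    using emeasure_distr[OF m, of A] assms by (simp add: free_mp_action_def)
qed

text \<open>Neutral names, because it is interpreted twice with the roles of the groups exchanged:
  once for \<alpha> and once for \<beta>.\<close>

locale commuting_domain = G: group G + H: group H
  for G :: "('g, 'a) monoid_scheme" and H :: "('h, 'b) monoid_scheme" +
  fixes M :: "'w measure"
    and act\<^sub>G :: "'g \<Rightarrow> 'w \<Rightarrow> 'w" and act\<^sub>H :: "'h \<Rightarrow> 'w \<Rightarrow> 'w" and X :: "'w set"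
  assumes countable_H: "countable (carrier H)"
    and action_G: "free_mp_action G M act\<^sub>G" and action_H: "free_mp_action H M act\<^sub>H"
    and commute: "\<lbrakk>g \<in> carrier G; h \<in> carrier H; x \<in> space M\<rbrakk> \<Longrightarrow>
      act\<^sub>G g (act\<^sub>H h x) = act\<^sub>H h (act\<^sub>G g x)"
    and domain: "fundamental_domain H M act\<^sub>H X"
begin

abbreviation "cocycle \<equiv> me_cocycle act\<^sub>G H act\<^sub>H X"

text \<open>The action of G on the space of H-orbits, with X as a set of representatives: move by g,
  then return to X by an element of H.\<close>

definition induced where "induced g x = act\<^sub>H (cocycle g x) (act\<^sub>G g x)"

lemmas G_closed = mp_action_closed[OF action_G] and H_closed = mp_action_closed[OF action_H]
  and G_mult = mp_action_mult[OF action_G] and H_mult = mp_action_mult[OF action_H]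
  and G_one = mp_action_one[OF action_G] and H_one = mp_action_one[OF action_H]

lemma G_inv: "\<lbrakk>g \<in> carrier G; x \<in> space M\<rbrakk> \<Longrightarrow> act\<^sub>G (inv\<^bsub>G\<^esub> g) (act\<^sub>G g x) = x"
  using G_mult[of "inv\<^bsub>G\<^esub> g" g x] G_one by simp

lemma H_inv: "\<lbrakk>h \<in> carrier H; x \<in> space M\<rbrakk> \<Longrightarrow> act\<^sub>H (inv\<^bsub>H\<^esub> h) (act\<^sub>H h x) = x"
  using H_mult[of "inv\<^bsub>H\<^esub> h" h x] H_one by simp

lemma X_sets: "X \<in> sets M" and X_space: "x \<in> X \<Longrightarrow> x \<in> space M"
  using domain sets.sets_into_space by (auto simp: fundamental_domain_def)

lemma domain_unique:
  assumes "h \<in> carrier H" "h' \<in> carrier H" "x \<in> space M" "act\<^sub>H h x \<in> X" "act\<^sub>H h' x \<in> X"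
  shows "h = h'"
proof -
  have inj: "inj_on (\<lambda>(g, x). act\<^sub>H g x) (carrier H \<times> X)"
    using domain by (auto simp: fundamental_domain_def bij_betw_def)
  have "act\<^sub>H (inv\<^bsub>H\<^esub> h) (act\<^sub>H h x) = act\<^sub>H (inv\<^bsub>H\<^esub> h') (act\<^sub>H h' x)"
    using H_inv assms by simp
  then have "inv\<^bsub>H\<^esub> h = inv\<^bsub>H\<^esub> h'"
    using inj_onD[OF inj, of "(inv\<^bsub>H\<^esub> h, act\<^sub>H h x)" "(inv\<^bsub>H\<^esub> h', act\<^sub>H h' x)"] assms by simp
  then show ?thesis using H.inv_inv assms by metis
qed

lemma domain_ex:
  assumes "x \<in> space M"
  shows "\<exists>h\<in>carrier H. act\<^sub>H h x \<in> X"
proof -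
  have "x \<in> (\<lambda>(g, x). act\<^sub>H g x) ` (carrier H \<times> X)"
    using domain assms by (auto simp: fundamental_domain_def bij_betw_def)
  then obtain h y where h: "h \<in> carrier H" "y \<in> X" "x = act\<^sub>H h y" by auto
  then have "act\<^sub>H (inv\<^bsub>H\<^esub> h) x = y" using H_inv X_space by simp
  then show ?thesis using h by (intro bexI[of _ "inv\<^bsub>H\<^esub> h"]) auto
qed

lemma cocycle:
  assumes "g \<in> carrier G" "x \<in> space M"
  shows cocycle_closed: "cocycle g x \<in> carrier H" and induced_in: "induced g x \<in> X"
proof -
  have "\<exists>!h. h \<in> carrier H \<and> act\<^sub>H h (act\<^sub>G g x) \<in> X"
    using domain_ex[OF G_closed[OF assms]] domain_unique G_closed[OF assms] by blast
  from theI'[OF this] show "cocycle g x \<in> carrier H" "induced g x \<in> X"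
    by (simp_all add: me_cocycle_def induced_def)
qed

lemma cocycle_eqI:
  assumes "g \<in> carrier G" "x \<in> space M" "h \<in> carrier H" "act\<^sub>H h (act\<^sub>G g x) \<in> X"
  shows "cocycle g x = h"
  using domain_unique[OF cocycle_closed[OF assms(1,2)] assms(3) G_closed[OF assms(1,2)] _ assms(4)]
    induced_in[OF assms(1,2)] by (simp add: induced_def)

text \<open>The cocycle identity. As the actions commute, the product on the right carries the
  translate of x back into X, and only one element of H does so.\<close>

lemma cocycle_mult:
  assumes g: "g \<in> carrier G" "g' \<in> carrier G" and x: "x \<in> X"
  shows "cocycle (g \<otimes>\<^bsub>G\<^esub> g') x = cocycle g (induced g' x) \<otimes>\<^bsub>H\<^esub> cocycle g' x"
proof (rule cocycle_eqI)
  let ?y = "induced g' x"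
  have xs: "x \<in> space M" and y: "?y \<in> space M" using x induced_in g X_space by auto
  note c = cocycle_closed[OF g(1) y] cocycle_closed[OF g(2) xs]
  show "g \<otimes>\<^bsub>G\<^esub> g' \<in> carrier G" "x \<in> space M" "cocycle g ?y \<otimes>\<^bsub>H\<^esub> cocycle g' x \<in> carrier H"
    using g xs c by auto
  have "act\<^sub>H (cocycle g ?y \<otimes>\<^bsub>H\<^esub> cocycle g' x) (act\<^sub>G (g \<otimes>\<^bsub>G\<^esub> g') x)
    = act\<^sub>H (cocycle g ?y) (act\<^sub>H (cocycle g' x) (act\<^sub>G g (act\<^sub>G g' x)))"
    using H_mult c G_mult G_closed g xs by simp
  also have "act\<^sub>H (cocycle g' x) (act\<^sub>G g (act\<^sub>G g' x)) = act\<^sub>G g ?y"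
    using commute G_closed g xs c by (simp add: induced_def)
  finally show "act\<^sub>H (cocycle g ?y \<otimes>\<^bsub>H\<^esub> cocycle g' x) (act\<^sub>G (g \<otimes>\<^bsub>G\<^esub> g') x) \<in> X"
    using induced_in[OF g(1) y] by (simp add: induced_def)
qed

lemma GH_measurable:
  "\<lbrakk>g \<in> carrier G; h \<in> carrier H\<rbrakk> \<Longrightarrow> (\<lambda>x. act\<^sub>H h (act\<^sub>G g x)) \<in> M \<rightarrow>\<^sub>M M"
  using mp_action_measurable[OF action_G] mp_action_measurable[OF action_H] by measurable

lemma GH_sets:
  assumes "g \<in> carrier G" "h \<in> carrier H" "A \<in> sets M"
  shows "{x \<in> X. act\<^sub>H h (act\<^sub>G g x) \<in> A} \<in> sets M"
proof -
  have "{x \<in> X. act\<^sub>H h (act\<^sub>G g x) \<in> A} = X \<inter> ((\<lambda>x. act\<^sub>H h (act\<^sub>G g x)) -` A \<inter> space M)"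
    using X_space by auto
  then show ?thesis using measurable_sets[OF GH_measurable assms(3)] assms X_sets by auto
qed

text \<open>The cocycle takes countably many values, and each level set is cut out by the measurable
  condition of returning to X.\<close>

lemma cocycle_sets:
  assumes "g \<in> carrier G"
  shows "{x \<in> X. P (cocycle g x)} \<in> sets M"
proof -
  have "{x \<in> X. P (cocycle g x)} = (\<Union>h\<in>{h\<in>carrier H. P h}. {x \<in> X. act\<^sub>H h (act\<^sub>G g x) \<in> X})"
    (is "?L = ?R")
  proof
    show "?L \<subseteq> ?R" using assms cocycle_closed induced_in X_space unfolding induced_def by fastforce
    show "?R \<subseteq> ?L" using assms cocycle_eqI X_space by fastforce
  qed
  moreover have "countable {h\<in>carrier H. P h}" using countable_H by (rule countable_subset[rotated]) auto
  ultimately show ?thesis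
    using GH_sets[OF assms _ X_sets] by (auto intro!: sets.countable_UN')
qed

lemma induced_decomp:
  assumes "g \<in> carrier G" "A \<subseteq> X"
  shows "{x \<in> X. induced g x \<in> A} = (\<Union>h\<in>carrier H. {x \<in> X. act\<^sub>H h (act\<^sub>G g x) \<in> A})"
    (is "?L = ?R")
proof
  show "?L \<subseteq> ?R" using assms cocycle_closed X_space unfolding induced_def by fastforce
  show "?R \<subseteq> ?L"
  proof
    fix x assume "x \<in> ?R"
    then obtain h where h: "h \<in> carrier H" "x \<in> X" "act\<^sub>H h (act\<^sub>G g x) \<in> A" by blast
    then have "cocycle g x = h" using assms cocycle_eqI X_space by blast
    then show "x \<in> ?L" using h by (simp add: induced_def)
  qed
qed

lemma induced_sets:
  assumes "g \<in> carrier G" "A \<subseteq> X" "A \<in> sets M"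
  shows "{x \<in> X. induced g x \<in> A} \<in> sets M"
  unfolding induced_decomp[OF assms(1,2)] using GH_sets assms countable_H
  by (auto intro!: sets.countable_UN')

text \<open>
  The translates \<open>h g X\<close> are pairwise disjoint, and \<open>h g\<close> carries the piece of \<open>X\<close> on which
  the cocycle is \<open>h\<close> and the induced action lands in \<open>A\<close> onto \<open>A \<inter> h g X\<close>.
\<close>

lemma emeasure_induced_le:
  assumes g: "g \<in> carrier G" and A: "A \<subseteq> X" "A \<in> sets M"
  shows "emeasure M {x \<in> X. induced g x \<in> A} \<le> emeasure M A"
proof -
  let ?f = "\<lambda>h x. act\<^sub>H h (act\<^sub>G g x)"
  let ?f' = "\<lambda>h x. act\<^sub>G (inv\<^bsub>G\<^esub> g) (act\<^sub>H (inv\<^bsub>H\<^esub> h) x)"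
  let ?S = "\<lambda>h. {x \<in> X. ?f h x \<in> A}" and ?T = "\<lambda>h. {y \<in> A. ?f' h y \<in> X}"
  have As: "y \<in> space M" if "y \<in> A" for y using A that X_space by auto
  have S_sets: "?S h \<in> sets M" if "h \<in> carrier H" for h using GH_sets g A that by blast
  have f'f: "?f' h (?f h x) = x" and ff': "?f h (?f' h x) = x" if "h \<in> carrier H" "x \<in> space M" for h x
  proof -
    show "?f' h (?f h x) = x" using that g H_inv G_inv G_closed by simp
    have "act\<^sub>G g (act\<^sub>G (inv\<^bsub>G\<^esub> g) z) = z" if "z \<in> space M" for z
      using G_inv[of "inv\<^bsub>G\<^esub> g" z] that g by simp
    moreover have "act\<^sub>H h (act\<^sub>H (inv\<^bsub>H\<^esub> h) z) = z" if "z \<in> space M" for z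
      using H_inv[of "inv\<^bsub>H\<^esub> h" z] that \<open>h \<in> carrier H\<close> by simp
    ultimately show "?f h (?f' h x) = x" using that H_closed by simp
  qed
  have pre: "emeasure M (?S h) = emeasure M (?T h)" and T_sets: "?T h \<in> sets M" if h: "h \<in> carrier H" for h
  proof -
    \<comment> \<open>\<open>?V\<close> and \<open>?U\<close> move \<open>?S h\<close> first by g
      and then by h, both preserving the measure; the result is \<open>?T h\<close>.\<close>
    let ?V = "act\<^sub>G (inv\<^bsub>G\<^esub> g) -` ?S h \<inter> space M"
    have V: "?V \<in> sets M"
      using measurable_sets[OF mp_action_measurable[OF action_G] S_sets[OF h]] g by simp
    have VS: "emeasure M ?V = emeasure M (?S h)"
      using mp_action_emeasure[OF action_G _ S_sets[OF h]] g by simp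
    let ?U = "act\<^sub>H (inv\<^bsub>H\<^esub> h) -` ?V \<inter> space M"
    have U: "?U \<in> sets M" "emeasure M ?U = emeasure M ?V"
      using measurable_sets[OF mp_action_measurable[OF action_H] V]
        mp_action_emeasure[OF action_H _ V] h by simp_all
    have "?U = ?T h"
    proof (intro equalityI subsetI)
      fix y assume "y \<in> ?U"
      then have y: "y \<in> space M" "?f' h y \<in> X" "?f h (?f' h y) \<in> A" by auto
      then show "y \<in> ?T h" using ff'[OF h y(1)] by simp
    next
      fix y assume y: "y \<in> ?T h"
      then have "y \<in> space M" using As by auto
      then show "y \<in> ?U" using y ff'[OF h] H_closed h by simp
    qed
    then show "emeasure M (?S h) = emeasure M (?T h)" "?T h \<in> sets M" using U VS by simp_all
  qed
  have disjS: "disjoint_family_on ?S (carrier H)"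
    unfolding disjoint_family_on_def
  proof (intro ballI impI equals0I)
    fix h h' x assume h: "h \<in> carrier H" "h' \<in> carrier H" "h \<noteq> h'" and x: "x \<in> ?S h \<inter> ?S h'"
    then have "?f h x \<in> X" "?f h' x \<in> X" "x \<in> space M" using A X_space by auto
    then show False using domain_unique[OF h(1,2), of "act\<^sub>G g x"] G_closed g h by auto
  qed
  have disjT: "disjoint_family_on ?T (carrier H)"
    unfolding disjoint_family_on_def
  proof (intro ballI impI equals0I)
    fix h h' y assume h: "h \<in> carrier H" "h' \<in> carrier H" "h \<noteq> h'" and y: "y \<in> ?T h \<inter> ?T h'"
    let ?z = "act\<^sub>G (inv\<^bsub>G\<^esub> g) y"
    have ys: "y \<in> space M" using As y by auto
    have "act\<^sub>H (inv\<^bsub>H\<^esub> h) ?z \<in> X" "act\<^sub>H (inv\<^bsub>H\<^esub> h') ?z \<in> X"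
      using y commute[of "inv\<^bsub>G\<^esub> g" _ y] g h ys by auto
    then have "inv\<^bsub>H\<^esub> h = inv\<^bsub>H\<^esub> h'"
      using domain_unique[of "inv\<^bsub>H\<^esub> h" "inv\<^bsub>H\<^esub> h'" ?z] G_closed g h ys by simp
    then show False using H.inv_inv h by metis
  qed
  have "emeasure M {x \<in> X. induced g x \<in> A} = (\<integral>\<^sup>+h. emeasure M (?S h) \<partial>count_space (carrier H))"
    unfolding induced_decomp[OF g A(1)]
    by (intro emeasure_UN_countable S_sets countable_H disjS)
  also have "\<dots> = (\<integral>\<^sup>+h. emeasure M (?T h) \<partial>count_space (carrier H))"
    using pre by (intro nn_integral_cong) simp
  also have "\<dots> = emeasure M (\<Union>h\<in>carrier H. ?T h)"
    by (intro emeasure_UN_countable[symmetric] T_sets countable_H disjT)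
  also have "\<dots> \<le> emeasure M A" using A by (intro emeasure_mono) auto
  finally show ?thesis .
qed

text \<open>By the cocycle identity, the value at a word of n letters is a product of n values at
  letters, taken at points moved by the induced action. If its length exceeds n * a, one factor is
  longer than a. Induced maps do not increase the measure of preimages, so each letter contributes
  at most \<tau>.\<close>

lemma emeasure_cocycle_word:
  fixes len :: "'h \<Rightarrow> nat"
  assumes len_one: "len \<one>\<^bsub>H\<^esub> = 0"
    and len_mult: "\<And>h k. \<lbrakk>h \<in> carrier H; k \<in> carrier H\<rbrakk> \<Longrightarrow> len (h \<otimes>\<^bsub>H\<^esub> k) \<le> len h + len k"
    and T: "T \<subseteq> carrier G"
    and tail: "\<And>s. s \<in> T \<Longrightarrow> emeasure M {x \<in> X. a < real (len (cocycle s x))} \<le> \<tau>"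
    and "0 \<le> a"
  shows "g \<in> set_power G T n \<Longrightarrow>
    emeasure M {x \<in> X. real n * a < real (len (cocycle g x))} \<le> of_nat n * \<tau>"
proof (induction n arbitrary: g)
  case 0
  have "cocycle \<one>\<^bsub>G\<^esub> x = \<one>\<^bsub>H\<^esub>" if "x \<in> X" for x
    using that X_space[OF that] G_one H_one by (intro cocycle_eqI) auto
  then have "{x \<in> X. real 0 * a < real (len (cocycle g x))} = {}" using 0 len_one by auto
  then show ?case by (simp only: emeasure_empty) simp
next
  case (Suc n)
  then obtain g' s where g: "g' \<in> set_power G T n" "s \<in> T" "g = g' \<otimes>\<^bsub>G\<^esub> s" by (auto simp: set_mult_def)
  have gc: "g' \<in> carrier G" "s \<in> carrier G" using g T G.set_power_closed[OF T] by auto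
  let ?A = "{x \<in> X. real n * a < real (len (cocycle g' x))}"
  let ?B = "{x \<in> X. a < real (len (cocycle s x))}"
  have A: "?A \<in> sets M" "?A \<subseteq> X" using cocycle_sets[OF gc(1)] by auto
  have B: "?B \<in> sets M" using cocycle_sets[OF gc(2)] by auto
  have C: "{x \<in> X. induced s x \<in> ?A} \<in> sets M" using induced_sets[OF gc(2) A(2,1)] .
  have "{x \<in> X. real (Suc n) * a < real (len (cocycle g x))} \<subseteq> ?B \<union> {x \<in> X. induced s x \<in> ?A}"
  proof
    fix x assume "x \<in> {x \<in> X. real (Suc n) * a < real (len (cocycle g x))}"
    then have x: "x \<in> X" "real (Suc n) * a < real (len (cocycle g x))" by auto
    have xs: "x \<in> space M" using X_space x by blast
    have y: "induced s x \<in> X" using induced_in gc xs by blast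
    have "len (cocycle g x) \<le> len (cocycle g' (induced s x)) + len (cocycle s x)"
      unfolding g(3) cocycle_mult[OF gc x(1)] using cocycle_closed gc xs X_space[OF y] len_mult by blast
    then have "real (len (cocycle g x)) \<le> real (len (cocycle g' (induced s x))) + real (len (cocycle s x))"
      by linarith
    moreover have "real (Suc n) * a = real n * a + a" by (simp add: algebra_simps)
    ultimately show "x \<in> ?B \<union> {x \<in> X. induced s x \<in> ?A}" using x y by auto
  qed
  then have "emeasure M {x \<in> X. real (Suc n) * a < real (len (cocycle g x))}
    \<le> emeasure M (?B \<union> {x \<in> X. induced s x \<in> ?A})" using B C by (intro emeasure_mono) auto
  also have "\<dots> \<le> emeasure M ?B + emeasure M {x \<in> X. induced s x \<in> ?A}"
    by (rule emeasure_subadditive[OF B C])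
  also have "\<dots> \<le> \<tau> + of_nat n * \<tau>"
    using tail[OF g(2)] emeasure_induced_le[OF gc(2) A(2,1)] Suc.IH[OF g(1)]
    by (intro add_mono) (auto intro: order_trans)
  finally show ?case by (simp add: distrib_right)
qed

text \<open>Markov's inequality for the p-th moment.\<close>

lemma emeasure_cocycle_tail:
  fixes len :: "'h \<Rightarrow> nat"
  assumes g: "g \<in> carrier G" and "0 < a" "0 \<le> p"
    and int: "(\<integral>\<^sup>+x\<in>X. ennreal (real (len (cocycle g x)) powr p) \<partial>M) \<le> ennreal C"
  shows "emeasure M {x \<in> X. a < real (len (cocycle g x))} \<le> ennreal (C / a powr p)"
proof -
  let ?A = "{x \<in> X. a < real (len (cocycle g x))}"
  have A: "?A \<in> sets M" using cocycle_sets[OF g] by auto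
  have "ennreal (a powr p) * emeasure M ?A = (\<integral>\<^sup>+x. ennreal (a powr p) * indicator ?A x \<partial>M)"
    using A by (simp add: nn_integral_cmult_indicator)
  also have "\<dots> \<le> (\<integral>\<^sup>+x\<in>X. ennreal (real (len (cocycle g x)) powr p) \<partial>M)"
    using assms(2,3) by (intro nn_integral_mono) (auto simp: indicator_def intro!: ennreal_leI powr_mono2)
  also note int
  finally have le: "ennreal (a powr p) * emeasure M ?A \<le> ennreal C" .
  have ap: "0 < a powr p" using assms by simp
  have "emeasure M ?A = ennreal (1 / a powr p) * (ennreal (a powr p) * emeasure M ?A)"
    using ap by (simp add: mult.assoc[symmetric] ennreal_mult'[symmetric])
  also have "\<dots> \<le> ennreal (1 / a powr p) * ennreal C" using le by (rule mult_left_mono) simp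
  also have "\<dots> = ennreal (C / a powr p)"
    using ap by (simp add: ennreal_mult'[symmetric] divide_simps)
  finally show ?thesis .
qed

text \<open>Countably many translates of X cover the space, so a null X would make the whole space
  null.\<close>

lemma emeasure_domain_pos:
  assumes "emeasure M (space M) \<noteq> 0"
  shows "emeasure M X > 0"
proof (rule ccontr)
  assume "\<not> 0 < emeasure M X"
  then have 0: "emeasure M X = 0" by simp
  let ?V = "\<lambda>h. act\<^sub>H h -` X \<inter> space M"
  have "?V h \<in> null_sets M" if "h \<in> carrier H" for h
    using measurable_sets[OF mp_action_measurable[OF action_H that] X_sets]
      mp_action_emeasure[OF action_H that X_sets] 0 by (simp add: null_sets_def)
  then have "(\<Union>h\<in>carrier H. ?V h) \<in> null_sets M" using countable_H by (intro null_sets_UN') auto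
  moreover have "space M \<subseteq> (\<Union>h\<in>carrier H. ?V h)" using domain_ex by auto
  ultimately have "space M \<in> null_sets M" by (meson null_sets_subset sets.top)
  then show False using assms by auto
qed

end

section \<open>Random Lipschitz maps between coupled groups\<close>

locale integrable_coupling = me_coupling \<Gamma> \<Lambda> M act\<^sub>\<Gamma> act\<^sub>\<Lambda> X\<^sub>\<Gamma> X\<^sub>\<Lambda>
  for \<Gamma> :: "('g, 'a) monoid_scheme" and \<Lambda> :: "('h, 'b) monoid_scheme"
    and M :: "'w measure"
    and act\<^sub>\<Gamma> :: "'g \<Rightarrow> 'w \<Rightarrow> 'w" and act\<^sub>\<Lambda> :: "'h \<Rightarrow> 'w \<Rightarrow> 'w"
    and X\<^sub>\<Gamma> X\<^sub>\<Lambda> :: "'w set" +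
  fixes S\<^sub>\<Gamma> :: "'g set" and S\<^sub>\<Lambda> :: "'h set" and p :: real
  assumes gens: "finite_generating_set \<Gamma> S\<^sub>\<Gamma>" "set_inv\<^bsub>\<Gamma>\<^esub> S\<^sub>\<Gamma> = S\<^sub>\<Gamma>" "finite_generating_set \<Lambda> S\<^sub>\<Lambda>"
    and cob: "cobounded \<Lambda> act\<^sub>\<Lambda> X\<^sub>\<Gamma> X\<^sub>\<Lambda>"
    and integrable: "Lp_Linf_integrable p \<Gamma> S\<^sub>\<Gamma> \<Lambda> S\<^sub>\<Lambda> M act\<^sub>\<Gamma> act\<^sub>\<Lambda> X\<^sub>\<Gamma> X\<^sub>\<Lambda>"
    and p_nonneg: "0 \<le> p"

sublocale integrable_coupling \<subseteq> Gam: fg_group \<Gamma> S\<^sub>\<Gamma>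
  using countable_groups gens by (simp add: fg_group_def fg_group_axioms_def)

sublocale integrable_coupling \<subseteq> Lam: fg_group \<Lambda> S\<^sub>\<Lambda>
  using countable_groups gens by (simp add: fg_group_def fg_group_axioms_def)

sublocale integrable_coupling \<subseteq> \<alpha>: commuting_domain \<Gamma> \<Lambda> M act\<^sub>\<Gamma> act\<^sub>\<Lambda> X\<^sub>\<Lambda>
  by unfold_locales (use countable_groups actions actions_commute fundamental_domains in auto)

sublocale integrable_coupling \<subseteq> \<beta>: commuting_domain \<Lambda> \<Gamma> M act\<^sub>\<Lambda> act\<^sub>\<Gamma> X\<^sub>\<Gamma>
  by unfold_locales (use countable_groups actions actions_commute fundamental_domains in auto)

context integrable_coupling
begin

text \<open>
  If \<open>\<gamma> w y \<in> X\<^sub>\<Gamma>\<close> for a short \<open>\<gamma>\<close>, then, translating \<open>y\<close> and \<open>\<gamma> w y\<close> into \<open>X\<^sub>\<Lambda>\<close> by elements of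
  the finite set \<open>F\<close>, the cocycle \<open>\<alpha>(\<gamma>, _)\<close> takes a value that differs from \<open>w\<close> by elements of \<open>F\<close>.
\<close>

lemma emeasure_short_cocycle:
  assumes F: "finite F" "F \<subseteq> carrier \<Lambda>" "X\<^sub>\<Gamma> \<subseteq> (\<Union>h\<in>F. act\<^sub>\<Lambda> h ` X\<^sub>\<Lambda>)" and c: "\<forall>h\<in>F. Lam.wl h \<le> c"
    and tail: "\<And>s. s \<in> S\<^sub>\<Gamma> \<Longrightarrow> emeasure M {x \<in> X\<^sub>\<Lambda>. a < real (Lam.wl (\<alpha>.cocycle s x))} \<le> \<tau>"
    and "0 \<le> a" and w: "w \<in> carrier \<Lambda>" "2 * real c + real k * a < real (Lam.wl w)"
  shows "emeasure M {y \<in> X\<^sub>\<Gamma>. Gam.wl (\<beta>.cocycle w y) \<le> k}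
    \<le> of_nat (card F * (card (Gam.word_ball k) * k)) * \<tau>"
proof -
  \<comment> \<open>\<open>Z g\<close> is the exceptional set where the cocycle of g is too long,
    and \<open>P h g\<close> is its translate by h.\<close>
  define Z where "Z g = {x \<in> X\<^sub>\<Lambda>. real k * a < real (Lam.wl (\<alpha>.cocycle g x))}" for g
  define P where "P h g = act\<^sub>\<Lambda> (inv\<^bsub>\<Lambda>\<^esub> h) -` Z g \<inter> space M" for h g
  have Z: "Z g \<in> sets M" if "g \<in> carrier \<Gamma>" for g
    using \<alpha>.cocycle_sets[OF that] by (auto simp: Z_def)
  have P: "P h g \<in> sets M" if "h \<in> F" "g \<in> carrier \<Gamma>" for h g
    using measurable_sets[OF mp_action_measurable[OF actions(2)] Z] that F(2) by (auto simp: P_def)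
  have Pm: "emeasure M (P h g) \<le> of_nat k * \<tau>" if h: "h \<in> F" and g: "g \<in> Gam.word_ball k" for h g
  proof -
    have gc: "g \<in> carrier \<Gamma>" "Gam.wl g \<le> k" using g by (auto simp: Gam.word_ball_def)
    have "emeasure M (P h g) = emeasure M (Z g)"
      unfolding P_def using h F(2) Z[OF gc(1)] by (intro mp_action_emeasure[OF actions(2)]) auto
    also have "\<dots> \<le> emeasure M {x \<in> X\<^sub>\<Lambda>. real (Gam.wl g) * a < real (Lam.wl (\<alpha>.cocycle g x))}"
    proof (rule emeasure_mono)
      have "real (Gam.wl g) * a \<le> real k * a" using gc assms(6) by (intro mult_right_mono) auto
      then show "Z g \<subseteq> {x \<in> X\<^sub>\<Lambda>. real (Gam.wl g) * a < real (Lam.wl (\<alpha>.cocycle g x))}"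
        by (auto simp: Z_def)
      show "{x \<in> X\<^sub>\<Lambda>. real (Gam.wl g) * a < real (Lam.wl (\<alpha>.cocycle g x))} \<in> sets M"
        using \<alpha>.cocycle_sets[OF gc(1)] by auto
    qed
    also have "\<dots> \<le> of_nat (Gam.wl g) * \<tau>"
    proof (rule \<alpha>.emeasure_cocycle_word[of _ S\<^sub>\<Gamma>])
      \<comment> \<open>Symmetry of \<open>S\<^sub>\<Gamma>\<close> makes the word length count
        words in \<open>S\<^sub>\<Gamma>\<close> itself.\<close>
      show "g \<in> set_power \<Gamma> S\<^sub>\<Gamma> (Gam.wl g)" using Gam.wl_in[OF gc(1)] gens(2) by simp
    qed (use Lam.wl_one Lam.wl_mult Gam.gens_closed tail assms(6) in auto)
    also have "\<dots> \<le> of_nat k * \<tau>" using gc by (intro mult_right_mono) auto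
    finally show ?thesis .
  qed
  have "{y \<in> X\<^sub>\<Gamma>. Gam.wl (\<beta>.cocycle w y) \<le> k} \<subseteq> (\<Union>(h, g)\<in>F \<times> Gam.word_ball k. P h g)"
  proof
    fix y assume "y \<in> {y \<in> X\<^sub>\<Gamma>. Gam.wl (\<beta>.cocycle w y) \<le> k}"
    then have y: "y \<in> X\<^sub>\<Gamma>" "Gam.wl (\<beta>.cocycle w y) \<le> k" by auto
    define g where "g = \<beta>.cocycle w y"
    have ys: "y \<in> space M" using y \<beta>.X_space by blast
    have g: "g \<in> carrier \<Gamma>" "act\<^sub>\<Gamma> g (act\<^sub>\<Lambda> w y) \<in> X\<^sub>\<Gamma>"
      using \<beta>.cocycle_closed[OF w(1) ys] \<beta>.induced_in[OF w(1) ys]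
      by (auto simp: g_def \<beta>.induced_def)
    obtain h z where h: "h \<in> F" "z \<in> X\<^sub>\<Lambda>" "y = act\<^sub>\<Lambda> h z" using F(3) y by blast
    obtain h' z' where h': "h' \<in> F" "z' \<in> X\<^sub>\<Lambda>" "act\<^sub>\<Gamma> g (act\<^sub>\<Lambda> w y) = act\<^sub>\<Lambda> h' z'" using F(3) g by blast
    have hc: "h \<in> carrier \<Lambda>" "h' \<in> carrier \<Lambda>" using h h' F by auto
    have zs: "z \<in> space M" "z' \<in> space M" using h h' \<alpha>.X_space by auto
    let ?v = "inv\<^bsub>\<Lambda>\<^esub> h' \<otimes>\<^bsub>\<Lambda>\<^esub> (w \<otimes>\<^bsub>\<Lambda>\<^esub> h)"
    have "act\<^sub>\<Lambda> ?v (act\<^sub>\<Gamma> g z) = act\<^sub>\<Lambda> (inv\<^bsub>\<Lambda>\<^esub> h') (act\<^sub>\<Lambda> w (act\<^sub>\<Lambda> h (act\<^sub>\<Gamma> g z)))"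
      using \<alpha>.H_mult \<alpha>.G_closed \<alpha>.H_closed hc w(1) zs g(1) by simp
    also have "act\<^sub>\<Lambda> w (act\<^sub>\<Lambda> h (act\<^sub>\<Gamma> g z)) = act\<^sub>\<Gamma> g (act\<^sub>\<Lambda> w (act\<^sub>\<Lambda> h z))"
      using actions_commute \<alpha>.H_closed hc w(1) zs g(1) by simp
    also have "act\<^sub>\<Lambda> (inv\<^bsub>\<Lambda>\<^esub> h') \<dots> = z'" using h h' \<alpha>.H_inv hc zs by simp
    finally have "\<alpha>.cocycle g z = ?v" using g hc w(1) zs h' by (intro \<alpha>.cocycle_eqI) auto
    \<comment> \<open>The two translating elements cost at most c each, which is where 2 * c in the
      hypothesis on w goes.\<close>
    moreover have "Lam.wl w \<le> c + Lam.wl ?v + c"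
    proof -
      have "w = h' \<otimes>\<^bsub>\<Lambda>\<^esub> (?v \<otimes>\<^bsub>\<Lambda>\<^esub> inv\<^bsub>\<Lambda>\<^esub> h)"
        using hc w(1) Lam.inv_solve_left Lam.m_assoc by (simp add: Lam.m_assoc[symmetric])
          (simp add: Lam.m_assoc)
      then have "Lam.wl w \<le> Lam.wl h' + (Lam.wl ?v + Lam.wl (inv\<^bsub>\<Lambda>\<^esub> h))"
        using Lam.wl_mult[of h' "?v \<otimes>\<^bsub>\<Lambda>\<^esub> inv\<^bsub>\<Lambda>\<^esub> h"] Lam.wl_mult[of ?v "inv\<^bsub>\<Lambda>\<^esub> h"] hc w(1) by simp
      moreover have "Lam.wl h \<le> c" "Lam.wl h' \<le> c" using c h(1) h'(1) by auto
      ultimately show ?thesis using Lam.wl_inv[OF hc(1)] by linarith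
    qed
    ultimately have "z \<in> Z g" using w(2) h(2) by (simp add: Z_def)
    then have "y \<in> P h g" using \<alpha>.H_inv hc zs h ys by (simp add: P_def)
    moreover have "g \<in> Gam.word_ball k" using g y by (simp add: Gam.word_ball_def g_def)
    ultimately show "y \<in> (\<Union>(h, g)\<in>F \<times> Gam.word_ball k. P h g)" using h(1) by auto
  qed
  then have "emeasure M {y \<in> X\<^sub>\<Gamma>. Gam.wl (\<beta>.cocycle w y) \<le> k}
    \<le> emeasure M (\<Union>(h, g)\<in>F \<times> Gam.word_ball k. P h g)"
    using P F(1) Gam.word_ball_finite by (intro emeasure_mono sets.finite_UN) (auto simp: Gam.word_ball_def)
  also have "\<dots> \<le> (\<Sum>(h, g)\<in>F \<times> Gam.word_ball k. emeasure M (P h g))"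
  proof -
    have "emeasure M (\<Union>x\<in>F \<times> Gam.word_ball k. P (fst x) (snd x))
      \<le> (\<Sum>x\<in>F \<times> Gam.word_ball k. emeasure M (P (fst x) (snd x)))"
      using P F(1) Gam.word_ball_finite
      by (intro emeasure_subadditive_finite) (auto simp: Gam.word_ball_def)
    then show ?thesis by (simp add: case_prod_beta)
  qed
  also have "\<dots> \<le> of_nat (card (F \<times> Gam.word_ball k)) * (of_nat k * \<tau>)"
    using Pm by (intro sum_bounded_above) auto
  finally show ?thesis by (simp add: card_cartesian_product mult.assoc)
qed

definition orbit_map where "orbit_map x u = inv\<^bsub>\<Gamma>\<^esub> (\<beta>.cocycle (inv\<^bsub>\<Lambda>\<^esub> u) x)"

lemma orbit_map_closed: "x \<in> X\<^sub>\<Gamma> \<Longrightarrow> u \<in> carrier \<Lambda> \<Longrightarrow> orbit_map x u \<in> carrier \<Gamma>"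
  unfolding orbit_map_def using \<beta>.cocycle_closed \<beta>.X_space by simp

text \<open>With y the induced image of x under the inverse of u, the cocycle identity expresses the
  value at the inverse of v as the value of one cocycle at y times the value at the inverse of u.
  The common factor cancels in the quotient.\<close>

lemma orbit_map_wdist:
  assumes x: "x \<in> X\<^sub>\<Gamma>" and uv: "u \<in> carrier \<Lambda>" "v \<in> carrier \<Lambda>"
  shows "Gam.wdist (orbit_map x u) (orbit_map x v)
    = Gam.wl (\<beta>.cocycle (inv\<^bsub>\<Lambda>\<^esub> v \<otimes>\<^bsub>\<Lambda>\<^esub> u) (\<beta>.induced (inv\<^bsub>\<Lambda>\<^esub> u) x))"
proof -
  have xs: "x \<in> space M" using x \<beta>.X_space by blast
  define y where "y = \<beta>.induced (inv\<^bsub>\<Lambda>\<^esub> u) x"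
  have ys: "y \<in> space M" unfolding y_def using \<beta>.X_space \<beta>.induced_in xs uv by simp
  define w where "w = inv\<^bsub>\<Lambda>\<^esub> v \<otimes>\<^bsub>\<Lambda>\<^esub> u"
  have w: "w \<in> carrier \<Lambda>" "w \<otimes>\<^bsub>\<Lambda>\<^esub> inv\<^bsub>\<Lambda>\<^esub> u = inv\<^bsub>\<Lambda>\<^esub> v" using uv by (auto simp: w_def Lam.m_assoc)
  let ?a = "\<beta>.cocycle (inv\<^bsub>\<Lambda>\<^esub> u) x" and ?b = "\<beta>.cocycle w y"
  have cl: "?a \<in> carrier \<Gamma>" "?b \<in> carrier \<Gamma>" using \<beta>.cocycle_closed xs ys uv w by auto
  have "\<beta>.cocycle (inv\<^bsub>\<Lambda>\<^esub> v) x = ?b \<otimes>\<^bsub>\<Gamma>\<^esub> ?a"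
    using \<beta>.cocycle_mult[OF w(1) _ x, of "inv\<^bsub>\<Lambda>\<^esub> u"] uv w(2) by (simp add: y_def)
  then have "Gam.wdist (orbit_map x u) (orbit_map x v)
    = Gam.wl (?a \<otimes>\<^bsub>\<Gamma>\<^esub> (inv\<^bsub>\<Gamma>\<^esub> ?a \<otimes>\<^bsub>\<Gamma>\<^esub> inv\<^bsub>\<Gamma>\<^esub> ?b))"
    using cl by (simp add: Gam.wdist_def orbit_map_def Gam.inv_mult_group)
  also have "?a \<otimes>\<^bsub>\<Gamma>\<^esub> (inv\<^bsub>\<Gamma>\<^esub> ?a \<otimes>\<^bsub>\<Gamma>\<^esub> inv\<^bsub>\<Gamma>\<^esub> ?b) = inv\<^bsub>\<Gamma>\<^esub> ?b"
    using cl by (simp add: Gam.m_assoc[symmetric])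
  finally show ?thesis using cl Gam.wl_inv by (simp add: y_def w_def)
qed

text \<open>One null set serves all u and v: the exceptional set of each generator is pulled back by
  the induced maps of the countably many elements of \<Lambda>, and these pullbacks are
  null.\<close>

lemma orbit_map_lipschitz:
  "\<exists>L. \<exists>N\<in>null_sets M. \<forall>x\<in>X\<^sub>\<Gamma> - N. \<forall>u\<in>carrier \<Lambda>. \<forall>v\<in>carrier \<Lambda>.
     Gam.wdist (orbit_map x u) (orbit_map x v) \<le> L * Lam.wdist u v"
proof -
  have "\<forall>t\<in>S\<^sub>\<Lambda>. \<exists>C. AE x in M. x \<in> X\<^sub>\<Gamma> \<longrightarrow> Gam.wl (\<beta>.cocycle t x) \<le> C"
    using integrable by (simp add: Lp_Linf_integrable_def)
  then obtain C where C: "\<And>t. t \<in> S\<^sub>\<Lambda> \<Longrightarrow> AE x in M. x \<in> X\<^sub>\<Gamma> \<longrightarrow> Gam.wl (\<beta>.cocycle t x) \<le> C t"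
    by metis
  \<comment> \<open>A bound common to all generators.\<close>
  define L where "L = (\<Sum>t\<in>S\<^sub>\<Lambda>. C t)"
  define N where "N t = {x \<in> X\<^sub>\<Gamma>. \<not> Gam.wl (\<beta>.cocycle t x) \<le> L}" for t
  have tc: "t \<in> carrier \<Lambda>" if "t \<in> S\<^sub>\<Lambda>" for t using that Lam.gens_closed by blast
  have N: "N t \<in> sets M" "N t \<subseteq> X\<^sub>\<Gamma>" if "t \<in> S\<^sub>\<Lambda>" for t
    using \<beta>.cocycle_sets[OF tc[OF that]] by (auto simp: N_def)
  have N0: "emeasure M (N t) = 0" if t: "t \<in> S\<^sub>\<Lambda>" for t
  proof -
    have "C t \<le> L" unfolding L_def using Lam.gens_finite t by (intro member_le_sum) auto
    then have "AE x in M. x \<in> X\<^sub>\<Gamma> \<longrightarrow> Gam.wl (\<beta>.cocycle t x) \<le> L"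
      using C[OF t] by (auto elim!: eventually_mono)
    moreover have "{x \<in> space M. \<not> (x \<in> X\<^sub>\<Gamma> \<longrightarrow> Gam.wl (\<beta>.cocycle t x) \<le> L)} = N t"
      using \<beta>.X_space by (auto simp: N_def)
    ultimately show ?thesis
      using AE_iff_measurable[OF N(1)[OF t], of "\<lambda>x. x \<in> X\<^sub>\<Gamma> \<longrightarrow> Gam.wl (\<beta>.cocycle t x) \<le> L"] by simp
  qed
  define B where "B u t = {x \<in> X\<^sub>\<Gamma>. \<beta>.induced (inv\<^bsub>\<Lambda>\<^esub> u) x \<in> N t}" for u t
  have B: "B u t \<in> null_sets M" if "u \<in> carrier \<Lambda>" "t \<in> S\<^sub>\<Lambda>" for u t
    using \<beta>.induced_sets[OF _ N(2,1), of "inv\<^bsub>\<Lambda>\<^esub> u" t] \<beta>.emeasure_induced_le[OF _ N(2,1), of "inv\<^bsub>\<Lambda>\<^esub> u" t]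
      that N0 unfolding B_def null_sets_def by simp
  let ?N = "\<Union>u\<in>carrier \<Lambda>. \<Union>t\<in>S\<^sub>\<Lambda>. B u t"
  have "?N \<in> null_sets M"
    using B countable_groups(4) countable_finite[OF Lam.gens_finite] by (intro null_sets_UN') auto
  moreover have "Gam.wdist (orbit_map x u) (orbit_map x v) \<le> L * Lam.wdist u v"
    if x: "x \<in> X\<^sub>\<Gamma> - ?N" and uv: "u \<in> carrier \<Lambda>" "v \<in> carrier \<Lambda>" for x u v
  proof (rule Lam.lipschitz_if_gens[OF _ Gam.fg_group_axioms _ uv])
    show "orbit_map x u \<in> carrier \<Gamma>" if "u \<in> carrier \<Lambda>" for u using orbit_map_closed x that by auto
    fix u s assume us: "u \<in> carrier \<Lambda>" "s \<in> S\<^sub>\<Lambda>"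
    then have usc: "u \<otimes>\<^bsub>\<Lambda>\<^esub> s \<in> carrier \<Lambda>" using tc by simp
    let ?y = "\<beta>.induced (inv\<^bsub>\<Lambda>\<^esub> (u \<otimes>\<^bsub>\<Lambda>\<^esub> s)) x"
    have "x \<notin> B (u \<otimes>\<^bsub>\<Lambda>\<^esub> s) s" using x usc us by blast
    then have "?y \<notin> N s" using x by (auto simp: B_def)
    moreover have "?y \<in> X\<^sub>\<Gamma>" using \<beta>.induced_in usc x \<beta>.X_space by simp
    ultimately have "Gam.wl (\<beta>.cocycle s ?y) \<le> L" by (simp add: N_def)
    moreover have "inv\<^bsub>\<Lambda>\<^esub> u \<otimes>\<^bsub>\<Lambda>\<^esub> (u \<otimes>\<^bsub>\<Lambda>\<^esub> s) = s"
      using us tc by (simp add: Lam.m_assoc[symmetric])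
    ultimately show "Gam.wdist (orbit_map x (u \<otimes>\<^bsub>\<Lambda>\<^esub> s)) (orbit_map x u) \<le> L"
      using orbit_map_wdist[of x "u \<otimes>\<^bsub>\<Lambda>\<^esub> s" u] x usc us by simp
  qed
  ultimately show ?thesis by blast
qed

text \<open>First moment argument. For each pair from W that is too far apart, the points x whose
  \<open>orbit_map\<close> brings it to distance at most k form a set of small measure. If these
  measures add up to less than that of \<open>X\<^sub>\<Gamma>\<close>, some x outside them and
  outside the null set remains.\<close>

theorem expanding_lipschitz_map:
  "\<exists>L c. \<exists>\<kappa>>0. \<forall>k a W. 0 < a \<and> finite W \<and> W \<subseteq> carrier \<Lambda> \<and>
      real ((card W)\<^sup>2 * (card (Gam.word_ball k) * k)) < \<kappa> * a powr p \<longrightarrow>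
    (\<exists>f. (\<forall>u\<in>carrier \<Lambda>. f u \<in> carrier \<Gamma>) \<and>
      (\<forall>u\<in>carrier \<Lambda>. \<forall>v\<in>carrier \<Lambda>. Gam.wdist (f u) (f v) \<le> L * Lam.wdist u v) \<and>
      (\<forall>u\<in>W. \<forall>v\<in>W. Gam.wdist (f u) (f v) \<le> k \<longrightarrow> real (Lam.wdist u v) \<le> real c + real k * a))"
proof -
  obtain L N where N: "N \<in> null_sets M" and L: "\<And>x u v. x \<in> X\<^sub>\<Gamma> - N \<Longrightarrow> u \<in> carrier \<Lambda> \<Longrightarrow> v \<in> carrier \<Lambda> \<Longrightarrow>
      Gam.wdist (orbit_map x u) (orbit_map x v) \<le> L * Lam.wdist u v"
    using orbit_map_lipschitz by blast
  obtain F where F: "finite F" "F \<subseteq> carrier \<Lambda>" "X\<^sub>\<Gamma> \<subseteq> (\<Union>h\<in>F. act\<^sub>\<Lambda> h ` X\<^sub>\<Lambda>)"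
    using cob unfolding cobounded_def by blast
  define c where "c = (\<Sum>h\<in>F. Lam.wl h)"
  have c: "\<forall>h\<in>F. Lam.wl h \<le> c" unfolding c_def using F(1) by (auto intro: member_le_sum)
  let ?I = "\<lambda>s. \<integral>\<^sup>+x\<in>X\<^sub>\<Lambda>. ennreal (real (Lam.wl (\<alpha>.cocycle s x)) powr p) \<partial>M"
  have "?I s < \<infinity>" if "s \<in> S\<^sub>\<Gamma>" for s using integrable that by (simp add: Lp_Linf_integrable_def)
  then have I: "?I s = ennreal (enn2real (?I s))" if "s \<in> S\<^sub>\<Gamma>" for s using that by (simp add: less_top)
  define C where "C = (\<Sum>s\<in>S\<^sub>\<Gamma>. enn2real (?I s))"
  have C0: "0 \<le> C" unfolding C_def by (intro sum_nonneg) auto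
  have IC: "?I s \<le> ennreal C" if "s \<in> S\<^sub>\<Gamma>" for s
  proof -
    have "enn2real (?I s) \<le> C" unfolding C_def using Gam.gens_finite that by (intro member_le_sum) auto
    then have "ennreal (enn2real (?I s)) \<le> ennreal C" by (rule ennreal_leI)
    then show ?thesis by (subst I[OF that])
  qed
  define m where "m = measure M X\<^sub>\<Gamma>"
  have em: "emeasure M X\<^sub>\<Gamma> = ennreal m"
    unfolding m_def using finite_domains by (intro emeasure_eq_ennreal_measure) auto
  have m: "0 < m" using \<beta>.emeasure_domain_pos[OF nonzero] em by simp
  \<comment> \<open>The summand 1 makes the denominator positive and the final comparison with m
    strict.\<close>
  define \<kappa> where "\<kappa> = m / (real (card F) * C + 1)"
  have den: "0 < real (card F) * C + 1" using C0 by (intro add_nonneg_pos) auto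
  have \<kappa>: "0 < \<kappa>" using m den by (simp add: \<kappa>_def)
  \<comment> \<open>The witness for c in the statement is twice the c defined above, one for each
    translation into \<open>X\<^sub>\<Lambda>\<close>.\<close>
  have "\<exists>f. (\<forall>u\<in>carrier \<Lambda>. f u \<in> carrier \<Gamma>) \<and>
      (\<forall>u\<in>carrier \<Lambda>. \<forall>v\<in>carrier \<Lambda>. Gam.wdist (f u) (f v) \<le> L * Lam.wdist u v) \<and>
      (\<forall>u\<in>W. \<forall>v\<in>W. Gam.wdist (f u) (f v) \<le> k \<longrightarrow> real (Lam.wdist u v) \<le> real (2 * c) + real k * a)"
    if a: "0 < a" and W: "finite W" "W \<subseteq> carrier \<Lambda>"
      and small: "real ((card W)\<^sup>2 * (card (Gam.word_ball k) * k)) < \<kappa> * a powr p" for k a W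
  proof -
    let ?\<tau> = "ennreal (C / a powr p)"
    let ?n = "card F * (card (Gam.word_ball k) * k)"
    have ap: "0 < a powr p" using a by simp
    have tail: "emeasure M {x \<in> X\<^sub>\<Lambda>. a < real (Lam.wl (\<alpha>.cocycle s x))} \<le> ?\<tau>" if "s \<in> S\<^sub>\<Gamma>" for s
      using \<alpha>.emeasure_cocycle_tail[OF _ a p_nonneg IC] Gam.gens_closed that by blast
    define D where "D = {(u, v) \<in> W \<times> W. real (2 * c) + real k * a < real (Lam.wdist u v)}"
    have D: "finite D" "card D \<le> (card W)\<^sup>2" "D \<subseteq> W \<times> W"
    proof -
      show "D \<subseteq> W \<times> W" by (auto simp: D_def)
      then show "finite D" "card D \<le> (card W)\<^sup>2"
        using W(1) card_mono[of "W \<times> W" D] finite_subset[of D "W \<times> W"]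
        by (auto simp: card_cartesian_product power2_eq_square)
    qed
    \<comment> \<open>By \<open>orbit_map_wdist\<close>, the pair q is brought too close exactly for
      x in \<open>E q\<close>, the pullback of \<open>A q\<close> under an induced map.\<close>
    define A where "A q = {y \<in> X\<^sub>\<Gamma>. Gam.wl (\<beta>.cocycle (inv\<^bsub>\<Lambda>\<^esub> (snd q) \<otimes>\<^bsub>\<Lambda>\<^esub> fst q) y) \<le> k}" for q
    define E where "E q = {x \<in> X\<^sub>\<Gamma>. \<beta>.induced (inv\<^bsub>\<Lambda>\<^esub> (fst q)) x \<in> A q}" for q
    have E: "E q \<in> sets M" "emeasure M (E q) \<le> of_nat ?n * ?\<tau>" if q: "q \<in> D" for q
    proof -
      obtain u v where uv: "q = (u, v)" by (cases q)
      have cl: "u \<in> carrier \<Lambda>" "v \<in> carrier \<Lambda>" using q uv D(3) W(2) by auto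
      have big: "real (2 * c) + real k * a < real (Lam.wl (inv\<^bsub>\<Lambda>\<^esub> v \<otimes>\<^bsub>\<Lambda>\<^esub> u))"
        using q uv Lam.wdist_sym[OF cl] by (simp add: D_def Lam.wdist_def)
      have A: "A q \<in> sets M" "A q \<subseteq> X\<^sub>\<Gamma>" using \<beta>.cocycle_sets cl uv by (auto simp: A_def)
      show "E q \<in> sets M" unfolding E_def using \<beta>.induced_sets[OF _ A(2,1)] cl uv by simp
      have "emeasure M (E q) \<le> emeasure M (A q)"
        unfolding E_def using \<beta>.emeasure_induced_le[OF _ A(2,1)] cl uv by simp
      also have "\<dots> \<le> of_nat ?n * ?\<tau>"
        unfolding A_def using emeasure_short_cocycle[OF F c tail, of "inv\<^bsub>\<Lambda>\<^esub> v \<otimes>\<^bsub>\<Lambda>\<^esub> u" k] big a cl uv by simp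
      finally show "emeasure M (E q) \<le> of_nat ?n * ?\<tau>" .
    qed
    have "emeasure M ((\<Union>q\<in>D. E q) \<union> N) \<le> emeasure M (\<Union>q\<in>D. E q) + emeasure M N"
      using E D N by (intro emeasure_subadditive) auto
    also have "emeasure M N = 0" using N by auto
    also have "emeasure M (\<Union>q\<in>D. E q) \<le> (\<Sum>q\<in>D. emeasure M (E q))"
      using E D by (intro emeasure_subadditive_finite) auto
    also have "\<dots> \<le> of_nat (card D) * (of_nat ?n * ?\<tau>)"
      using E by (intro sum_bounded_above) auto
    also have "\<dots> = ennreal (real (card D) * (real ?n * (C / a powr p)))"
      using C0 ap by (simp add: ennreal_mult'[symmetric] ennreal_of_nat_eq_real_of_nat del: of_nat_mult)
    also have "\<dots> + 0 < ennreal m"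
    proof -
      let ?b = "real (card (Gam.word_ball k) * k)"
      have "real (card D) * (real ?n * (C / a powr p)) = (real (card D) * ?b) * (real (card F) * C) / a powr p"
        by (simp add: field_simps)
      also have "\<dots> \<le> (real ((card W)\<^sup>2) * ?b) * (real (card F) * C) / a powr p"
        using D(2) C0 by (intro divide_right_mono mult_right_mono) (auto simp del: of_nat_power)
      also have "\<dots> \<le> (\<kappa> * a powr p) * (real (card F) * C) / a powr p"
        using small C0 by (intro divide_right_mono mult_right_mono) auto
      also have "\<dots> = \<kappa> * (real (card F) * C)" using ap by simp
      also have "\<dots> < \<kappa> * (real (card F) * C + 1)" using \<kappa> by simp
      also have "\<dots> = m" using den by (simp add: \<kappa>_def)
      finally show ?thesis using m by (simp add: ennreal_lessI)
    qed
    finally have lt: "emeasure M ((\<Union>q\<in>D. E q) \<union> N) < emeasure M X\<^sub>\<Gamma>" using em by (simp add: add_mono)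
    have "\<not> X\<^sub>\<Gamma> \<subseteq> (\<Union>q\<in>D. E q) \<union> N"
    proof
      assume "X\<^sub>\<Gamma> \<subseteq> (\<Union>q\<in>D. E q) \<union> N"
      then have "emeasure M X\<^sub>\<Gamma> \<le> emeasure M ((\<Union>q\<in>D. E q) \<union> N)"
        using E D N by (intro emeasure_mono sets.Un sets.finite_UN) auto
      then show False using lt by simp
    qed
    then obtain x where x: "x \<in> X\<^sub>\<Gamma>" "x \<notin> N" "\<And>q. q \<in> D \<Longrightarrow> x \<notin> E q" by blast
    have "real (Lam.wdist u v) \<le> real (2 * c) + real k * a"
      if uv: "u \<in> W" "v \<in> W" and le: "Gam.wdist (orbit_map x u) (orbit_map x v) \<le> k" for u v
    proof (rule ccontr)
      assume "\<not> ?thesis"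
      then have "(u, v) \<in> D" using uv by (auto simp: D_def)
      then have "x \<notin> E (u, v)" by (rule x(3))
      moreover have cl: "u \<in> carrier \<Lambda>" "v \<in> carrier \<Lambda>" using uv W by auto
      moreover have "\<beta>.induced (inv\<^bsub>\<Lambda>\<^esub> u) x \<in> X\<^sub>\<Gamma>" using \<beta>.induced_in cl x(1) \<beta>.X_space by simp
      ultimately show False using le orbit_map_wdist[OF x(1) cl] x(1) by (simp add: E_def A_def)
    qed
    then show ?thesis
      using orbit_map_closed x L by (intro exI[of _ "orbit_map x"]) blast
  qed
  then show ?thesis using \<kappa> by blast
qed

end

section \<open>Entropy and the choice of scales\<close>

context fg_group
begin

lemma volume_entropy_nonneg: "0 \<le> volume_entropy G S"
proof -
  have "0 \<le> ln (real (growth_function G S n)) / real n" for n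
    \<comment> \<open>An empty power contributes 0, because \<open>ln 0 = 0\<close>; so does n = 0,
      by division by zero.\<close>
    by (cases "growth_function G S n = 0") auto
  then show ?thesis unfolding volume_entropy_def by (intro le_Limsup) auto
qed

text \<open>The limsup gives the exponential bound for all large n, and A absorbs the finitely many
  others.\<close>

lemma card_set_power_entropy:
  assumes "volume_entropy G S < ereal e" "0 \<le> e"
  shows "\<exists>A>0. \<forall>n. real (card (set_power G S n)) \<le> A * exp (e * real n)"
proof -
  have "eventually (\<lambda>n. ereal (ln (real (growth_function G S n)) / real n) < ereal e) sequentially"
    using assms(1) unfolding volume_entropy_def by (rule Limsup_lessD)
  then obtain n\<^sub>0 where n\<^sub>0: "\<And>n. n \<ge> n\<^sub>0 \<Longrightarrow> ln (real (growth_function G S n)) / real n < e"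
    by (auto simp: eventually_sequentially)
  define A where "A = 1 + (\<Sum>n\<le>n\<^sub>0. real (card (set_power G S n)))"
  have A: "1 \<le> A" by (auto simp: A_def intro: sum_nonneg)
  have "real (card (set_power G S n)) \<le> A * exp (e * real n)" for n
  proof (cases "n \<le> n\<^sub>0")
    case True
    then have "real (card (set_power G S n)) \<le> (\<Sum>n\<le>n\<^sub>0. real (card (set_power G S n)))"
      by (intro member_le_sum) auto
    then have "real (card (set_power G S n)) \<le> A * 1" by (simp add: A_def)
    also have "\<dots> \<le> A * exp (e * real n)" using A assms(2) by (intro mult_left_mono) auto
    finally show ?thesis .
  next
    case False
    have "real (card (set_power G S n)) \<le> exp (e * real n)"
    proof (cases "card (set_power G S n) = 0")
      case nz: False
      have "ln (real (card (set_power G S n))) < e * real n"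
        using n\<^sub>0[of n] False by (simp add: growth_function_def divide_simps mult.commute)
      then show ?thesis using nz by (simp add: ln_ge_iff[symmetric] ln_less_cancel_iff[symmetric] del: ln_less_cancel_iff)
          (metis exp_le_cancel_iff exp_ln less_imp_le of_nat_0_less_iff neq0_conv)
    qed simp
    also have "\<dots> \<le> A * exp (e * real n)" using A by simp
    finally show ?thesis .
  qed
  then show ?thesis using A by (intro exI[of _ A]) auto
qed

text \<open>For \<delta> = 0 any exponential rate is admissible, and the count of words gives one.
  For \<delta> > 0 the hypothesis puts the entropy strictly below e = (p - 2) / (108 \<delta>), and
  then 3 \<delta> e = (p - 2) / 36 < p - 2. A ball is a union of k + 1 powers of S.\<close>

lemma word_ball_growth:
  assumes sym: "set_inv S = S" and \<delta>: "0 \<le> \<delta>" and p: "ereal p > 108 * ereal \<delta> * volume_entropy G S + 2"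
  shows "2 < p \<and> (\<exists>e\<ge>0. \<exists>A>0. 3 * \<delta> * e + 2 < p \<and>
    (\<forall>k. real (card (word_ball k)) \<le> real (k + 1) * A * exp (e * real k)))"
proof -
  have nn: "0 \<le> 108 * ereal \<delta> * volume_entropy G S" using \<delta> volume_entropy_nonneg by simp
  have "(2::ereal) \<le> 108 * ereal \<delta> * volume_entropy G S + 2" using add_right_mono[OF nn, of 2] by simp
  then have p2: "2 < p" using p by (metis ereal_less(3) le_less_trans ereal_less_eq(3) less_ereal.simps(1) numeral_eq_ereal)
  have "\<exists>e\<ge>0. \<exists>A>0. 3 * \<delta> * e + 2 < p \<and> (\<forall>n. real (card (set_power G S n)) \<le> A * exp (e * real n))"
  proof (cases "\<delta> = 0")
    case True
    \<comment> \<open>The summand 1 keeps the argument of \<open>ln\<close> positive when S is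
      empty.\<close>
    define e where "e = ln (1 + real (card S))"
    have "real (card (set_power G S n)) \<le> 1 * exp (e * real n)" for n
    proof -
      have "real (card (set_power G S n)) \<le> real (card S ^ n)"
        using card_set_power_le[OF gens_finite] by (simp only: of_nat_le_iff)
      also have "\<dots> \<le> (1 + real (card S)) ^ n" by (simp add: power_mono)
      also have "\<dots> = exp (e * real n)" by (simp add: e_def exp_of_nat2_mult)
      finally show ?thesis by simp
    qed
    then show ?thesis using True p2 by (intro exI[of _ e] conjI exI[of _ 1]) (auto simp: e_def)
  next
    case False
    then have \<delta>': "0 < \<delta>" using \<delta> by simp
    define e where "e = (p - 2) / (108 * \<delta>)"
    have "volume_entropy G S < ereal e"
    proof (cases "volume_entropy G S")
      case (real E)
      then have "108 * \<delta> * E + 2 < p" using p by simp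
      then show ?thesis using real \<delta>' by (simp add: e_def pos_less_divide_eq mult.commute)
    next
      case PInf
      then show ?thesis using p \<delta>' by simp
    next
      case MInf
      then show ?thesis by simp
    qed
    moreover have "0 \<le> e" using \<delta>' p2 by (simp add: e_def)
    moreover have "3 * \<delta> * e + 2 < p"
    proof -
      have "3 * \<delta> * e = (p - 2) / 36" using \<delta>' by (simp add: e_def field_simps)
      then show ?thesis using p2 by simp
    qed
    ultimately show ?thesis using card_set_power_entropy by blast
  qed
  then obtain e A where e: "0 \<le> e" "0 < A" "3 * \<delta> * e + 2 < p"
    "\<And>n. real (card (set_power G S n)) \<le> A * exp (e * real n)" by blast
  have "real (card (word_ball k)) \<le> real (k + 1) * A * exp (e * real k)" for k
  proof -
    have "card (word_ball k) \<le> card (\<Union>n\<le>k. set_power G S n)"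
      using word_ball_subset[of k] sym set_power_finite[OF gens_finite] by (intro card_mono) auto
    also have "\<dots> \<le> (\<Sum>n\<le>k. card (set_power G S n))" by (rule card_UN_le) simp
    finally have "real (card (word_ball k)) \<le> (\<Sum>n\<le>k. real (card (set_power G S n)))"
      by (simp flip: of_nat_sum)
    also have "\<dots> \<le> (\<Sum>n\<le>k. A * exp (e * real k))"
    proof (rule sum_mono)
      fix n assume "n \<in> {..k}"
      then have "exp (e * real n) \<le> exp (e * real k)" using e(1) by (simp add: mult_left_mono)
      then show "real (card (set_power G S n)) \<le> A * exp (e * real k)"
        using e(4)[of n] e(2) by (meson mult_le_cancel_left_pos order_trans)
    qed
    finally show ?thesis by simp
  qed
  then show ?thesis using p2 e by blast
qed

end

text \<open>The smallness condition of \<open>expanding_lipschitz_map\<close> for 2 * n + 2 points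
  and a = n / (600 k). As k is at most logarithmic, the left side is of order n to the power 2 + 3
  \<delta> e and the right side of order n to the power p, up to logarithms.\<close>

lemma eventually_scale:
  fixes \<delta> e A \<kappa> p K\<^sub>0 :: real
  assumes "0 \<le> \<delta>" "0 \<le> e" "0 < A" "0 < \<kappa>" "3 * \<delta> * e + 2 < p" "0 \<le> K\<^sub>0"
  shows "eventually (\<lambda>n. \<forall>k. 1 \<le> k \<and> real k \<le> 3 * \<delta> * ln (real n) + K\<^sub>0 \<longrightarrow>
    (real (2 * n + 2))\<^sup>2 * (real (k + 1) * A * exp (e * real k) * real k)
      < \<kappa> * (real n / (600 * real k)) powr p) sequentially"
proof -
  define q where "q = p - 2 - 3 * \<delta> * e"
  have q: "0 < q" using assms by (simp add: q_def)
  have "0 \<le> 3 * \<delta> * e" using assms by simp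
  then have p: "2 < p" using assms by linarith
  \<comment> \<open>The margin q is split in two. With k + 1 bounded by the s-th power of n, the two
    factors k on the left and the p-th power of k on the right together use up q / 2; the other half
    absorbs the constants.\<close>
  define s where "s = q / (2 * (p + 2))"
  have s: "0 < s" using q p by (simp add: s_def)
  have sp: "s * (p + 2) = q / 2" using p by (simp add: s_def field_simps)
  \<comment> \<open>The summand 1 keeps the coefficient of the logarithm positive when \<delta> =
    0.\<close>
  define b where "b = 3 * \<delta> + 1"
  have b: "0 < b" using assms by (simp add: b_def)
  define C where "C = 16 * A * exp (e * K\<^sub>0)"
  have C: "0 < C" using assms by (simp add: C_def)
  define \<kappa>' where "\<kappa>' = \<kappa> * (1 / 600) powr p"
  have \<kappa>': "0 < \<kappa>'" using assms by (simp add: \<kappa>'_def)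
  have "eventually (\<lambda>x::real. b * ln x + (K\<^sub>0 + 1) < x powr s) at_top"
    using b s by real_asymp
  moreover have "eventually (\<lambda>x::real. C / \<kappa>' < x powr (q / 2)) at_top"
    using q by real_asymp
  ultimately have "eventually (\<lambda>x::real. b * ln x + (K\<^sub>0 + 1) < x powr s \<and> C / \<kappa>' < x powr (q / 2) \<and> 1 \<le> x) at_top"
    using eventually_ge_at_top[of 1] by eventually_elim auto
  then have "eventually (\<lambda>n. b * ln (real n) + (K\<^sub>0 + 1) < real n powr s \<and>
      C / \<kappa>' < real n powr (q / 2) \<and> 1 \<le> real n) sequentially"
    using filterlim_real_sequentially by (auto simp: filterlim_iff)
  then show ?thesis
  proof eventually_elim
    fix n assume n: "b * ln (real n) + (K\<^sub>0 + 1) < real n powr s \<and> C / \<kappa>' < real n powr (q / 2) \<and> 1 \<le> real n"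
    define x where "x = real n"
    have x: "b * ln x + (K\<^sub>0 + 1) < x powr s" "C / \<kappa>' < x powr (q / 2)" "1 \<le> x"
      using n by (auto simp: x_def)
    show "\<forall>k. 1 \<le> k \<and> real k \<le> 3 * \<delta> * ln (real n) + K\<^sub>0 \<longrightarrow>
      (real (2 * n + 2))\<^sup>2 * (real (k + 1) * A * exp (e * real k) * real k)
        < \<kappa> * (real n / (600 * real k)) powr p"
    proof (intro allI impI, elim conjE)
      fix k :: nat assume k: "1 \<le> k" "real k \<le> 3 * \<delta> * ln (real n) + K\<^sub>0"
      define y where "y = x powr s"
      have lnx: "0 \<le> ln x" using x by simp
      have ky: "real k + 1 \<le> y" using k(2) x(1) lnx by (simp add: y_def b_def x_def algebra_simps)
      have "exp (e * real k) \<le> exp (e * (3 * \<delta> * ln x + K\<^sub>0))"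
        using k(2) assms(2) by (simp add: x_def mult_left_mono)
      also have "\<dots> = exp (e * K\<^sub>0) * x powr (3 * \<delta> * e)"
        using x by (simp add: powr_def exp_add[symmetric] algebra_simps)
      finally have ek: "exp (e * real k) \<le> exp (e * K\<^sub>0) * x powr (3 * \<delta> * e)" .
      have "(real (2 * n + 2))\<^sup>2 * (real (k + 1) * A * exp (e * real k) * real k)
        \<le> (4 * x)\<^sup>2 * (y * A * (exp (e * K\<^sub>0) * x powr (3 * \<delta> * e)) * y)"
        using ky ek x assms(3) by (intro mult_mono power_mono) (auto simp: x_def)
      also have "\<dots> = C * (x\<^sup>2 * y\<^sup>2 * x powr (3 * \<delta> * e))"
        by (simp add: C_def power2_eq_square)
      also have "x\<^sup>2 * y\<^sup>2 * x powr (3 * \<delta> * e) = x powr (2 + 2 * s + 3 * \<delta> * e)"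
        using x by (simp add: y_def powr_add powr_power mult.commute)
      also have "C * \<dots> < (\<kappa>' * x powr (q / 2)) * x powr (2 + 2 * s + 3 * \<delta> * e)"
        using x \<kappa>' by (intro mult_strict_right_mono) (auto simp: divide_simps mult.commute)
      also have "\<dots> = \<kappa>' * x powr (p - s * p)"
      proof -
        \<comment> \<open>Here q / 2 = s * (p + 2), and 2 + 3 \<delta> e = p - q.\<close>
        have "q / 2 + (2 + 2 * s + 3 * \<delta> * e) = p - s * p" 
        using sp q_def distrib_left[of s p 2] by linarith
        then show ?thesis by (simp add: powr_add[symmetric] mult.assoc)
      qed
      also have "\<dots> = \<kappa> * (x / (600 * y)) powr p"
        using x by (simp add: \<kappa>'_def y_def powr_divide powr_mult powr_powr powr_diff)
      also have "\<dots> \<le> \<kappa> * (x / (600 * real k)) powr p"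
        using ky k(1) x p assms(4) by (intro mult_left_mono powr_mono2 divide_left_mono) auto
      finally show "(real (2 * n + 2))\<^sup>2 * (real (k + 1) * A * exp (e * real k) * real k)
        < \<kappa> * (real n / (600 * real k)) powr p" by (simp add: x_def)
    qed
  qed
qed

section \<open>Stability of geodesics in the target group\<close>

locale two_fg_groups = Gam: fg_group \<Gamma> S\<^sub>\<Gamma> + Lam: fg_group \<Lambda> S\<^sub>\<Lambda>
  for \<Gamma> :: "('g, 'a) monoid_scheme" and S\<^sub>\<Gamma> and \<Lambda> :: "('h, 'b) monoid_scheme" and S\<^sub>\<Lambda>
begin

text \<open>
  Map a chain and a geodesic with the same end points to the hyperbolic group, where both images stay
  close to one geodesic, and hence to each other. Walking along that geodesic, the associated points of
  the original geodesic make only small jumps, so they miss no long part of it.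
\<close>

lemma tracks_geodesics_if_expanding:
  assumes hyp: "delta_hyperbolic_space \<delta> Gam.pts Gam.cd"
    and maps: "\<And>n W. \<lbrakk>N\<^sub>0 \<le> n; finite W; W \<subseteq> carrier \<Lambda>; card W \<le> 2 * n + 2\<rbrakk> \<Longrightarrow>
      \<exists>f. (\<forall>u\<in>carrier \<Lambda>. f u \<in> carrier \<Gamma>) \<and>
        (\<forall>u\<in>carrier \<Lambda>. \<forall>v\<in>carrier \<Lambda>. Gam.wdist (f u) (f v) \<le> L * Lam.wdist u v) \<and>
        (\<forall>u\<in>W. \<forall>v\<in>W.
          real (Gam.wdist (f u) (f v)) \<le> 2 * (\<delta> * real (nat \<lceil>log 2 (real n)\<rceil>) + real (3 * L)) + 1 \<longrightarrow>
          real (Lam.wdist u v) \<le> real n / 300)"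
  shows "tracks_geodesics Lam.pts Lam.cd (max N\<^sub>0 1200)"
  unfolding tracks_geodesics_def
proof (intro allI impI ballI)
  interpret MG: Metric_space "Gam.pts" "Gam.cd" by (rule Gam.cayley_Metric_space)
  interpret MX: Metric_space "Lam.pts" "Lam.cd" by (rule Lam.cayley_Metric_space)
  fix n x A y
  assume n: "max N\<^sub>0 1200 \<le> n" and x: "\<forall>i\<le>n. x i \<in> Lam.pts"
    and steps: "\<forall>i<n. Lam.cd (x i) (x (Suc i)) \<le> 1"
    and A: "geodesic_segment Lam.pts Lam.cd (x 0) (x n) A" and y: "y \<in> A"
  \<comment> \<open>Rounding to vertices within distance 1, which changes distances by at most 2; a
    jump of size 1 becomes one of size at most 3.\<close>
  obtain r where r: "\<And>z. z \<in> Lam.pts \<Longrightarrow> r z \<in> carrier \<Lambda>"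
    "\<And>z. z \<in> Lam.pts \<Longrightarrow> Lam.cd z (Lam.vertex (r z)) \<le> 1"
    using Lam.near_vertex by metis
  have vpt: "Lam.vertex u \<in> Lam.pts" if "u \<in> carrier \<Lambda>" for u using Lam.pts_vertex that .
  have r_dist: "real (Lam.wdist (r z) (r z')) \<le> Lam.cd z z' + 2"
    "Lam.cd z z' \<le> real (Lam.wdist (r z) (r z')) + 2" if "z \<in> Lam.pts" "z' \<in> Lam.pts" for z z'
  proof -
    let ?v = "Lam.vertex (r z)" and ?v' = "Lam.vertex (r z')"
    have v: "?v \<in> Lam.pts" "?v' \<in> Lam.pts" using vpt r(1) that by auto
    have eq: "Lam.cd ?v ?v' = real (Lam.wdist (r z) (r z'))" using Lam.cayley_dist_vertex r(1) that by blast
    have "Lam.cd ?v ?v' \<le> Lam.cd ?v z + Lam.cd z z' + Lam.cd z' ?v'"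
      using MX.triangle[of ?v z ?v'] MX.triangle[of z z' ?v'] v that by simp
    then show "real (Lam.wdist (r z) (r z')) \<le> Lam.cd z z' + 2"
      using eq r(2)[OF that(1)] r(2)[OF that(2)] MX.commute[of ?v z] by simp
    have "Lam.cd z z' \<le> Lam.cd z ?v + Lam.cd ?v ?v' + Lam.cd ?v' z'"
      using MX.triangle[of z ?v z'] MX.triangle[of ?v ?v' z'] v that by simp
    then show "Lam.cd z z' \<le> real (Lam.wdist (r z) (r z')) + 2"
      using eq r(2)[OF that(1)] r(2)[OF that(2)] MX.commute[of ?v' z'] by simp
  qed
  let ?l = "Lam.cd (x 0) (x n)"
  obtain c where c: "geodesic_curve Lam.pts Lam.cd c ?l" "c 0 = x 0" "c ?l = x n" "A = c ` {0..?l}"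
    using A unfolding MX.geodesic_segment_iff by blast
  obtain s where s: "s \<in> {0..?l}" "y = c s" using y c(4) by blast
  have "Lam.cd (x 0) (x i) \<le> real i" if "i \<le> n" for i
    using that
  proof (induction i)
    case (Suc i)
    then have "Lam.cd (x 0) (x i) \<le> real i" "Lam.cd (x i) (x (Suc i)) \<le> 1" using steps by auto
    moreover have "Lam.cd (x 0) (x (Suc i)) \<le> Lam.cd (x 0) (x i) + Lam.cd (x i) (x (Suc i))"
      using x Suc.prems by (intro MX.triangle) auto
    ultimately show ?case by simp
  qed (use x in auto)
  then have l: "?l \<le> real n" by simp
  \<comment> \<open>Integer sample times on the geodesic, stopped at its end. Its length is at most
    n, so the samples form a chain with n steps as well.\<close>
  define \<sigma> where "\<sigma> j = min (real j) ?l" for j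
  have \<sigma>: "\<sigma> j \<in> {0..?l}" "\<sigma> 0 = 0" "\<sigma> n = ?l" "\<bar>\<sigma> j - \<sigma> (Suc j)\<bar> \<le> 1" for j using l by (auto simp: \<sigma>_def)
  have c\<sigma>: "c (\<sigma> j) \<in> Lam.pts" for j using MX.geodesic_curve_in[OF c(1) \<sigma>(1)] .
  define v where "v i = r (x i)" for i
  define w where "w j = r (c (\<sigma> j))" for j
  have vw: "\<And>i. i \<le> n \<Longrightarrow> v i \<in> carrier \<Lambda>" "\<And>j. w j \<in> carrier \<Lambda>"
    using r(1) x c\<sigma> by (auto simp: v_def w_def)
  have ends: "w 0 = v 0" "w n = v n" using c(2,3) \<sigma>(2,3) by (auto simp: v_def w_def)
  have v_step: "Lam.wdist (v i) (v (Suc i)) \<le> 3" if "i < n" for i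
  proof -
    have "real (Lam.wdist (v i) (v (Suc i))) \<le> Lam.cd (x i) (x (Suc i)) + 2"
      unfolding v_def using x that by (intro r_dist(1)) auto
    then have "real (Lam.wdist (v i) (v (Suc i))) \<le> real 3" using steps that by force
    then show ?thesis by (simp only: of_nat_le_iff)
  qed
  have w_step: "Lam.wdist (w j) (w (Suc j)) \<le> 3" for j
  proof -
    have "real (Lam.wdist (w j) (w (Suc j))) \<le> Lam.cd (c (\<sigma> j)) (c (\<sigma> (Suc j))) + 2"
      unfolding w_def using c\<sigma> by (intro r_dist(1)) auto
    also have "\<dots> \<le> real 3" using MX.geodesic_curve_dist[OF c(1) \<sigma>(1) \<sigma>(1)] \<sigma>(4)[of j] by simp
    finally show ?thesis by (simp only: of_nat_le_iff)
  qed
  define W where "W = v ` {..n} \<union> w ` {..n}"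
  have "card W \<le> card (v ` {..n}) + card (w ` {..n})" unfolding W_def by (rule card_Un_le)
  also have "\<dots> \<le> Suc n + Suc n" using card_image_le[of "{..n}"] by (intro add_mono) fastforce+
  finally have "card W \<le> 2 * n + 2" by simp
  moreover have "finite W" "W \<subseteq> carrier \<Lambda>" using vw by (auto simp: W_def)
  moreover have "N\<^sub>0 \<le> n" using n by simp
  ultimately obtain f where f: "\<And>u. u \<in> carrier \<Lambda> \<Longrightarrow> f u \<in> carrier \<Gamma>"
    and lip: "\<And>u v. u \<in> carrier \<Lambda> \<Longrightarrow> v \<in> carrier \<Lambda> \<Longrightarrow> Gam.wdist (f u) (f v) \<le> L * Lam.wdist u v"
    and exp: "\<And>u v. u \<in> W \<Longrightarrow> v \<in> W \<Longrightarrow>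
      real (Gam.wdist (f u) (f v)) \<le> 2 * (\<delta> * real (nat \<lceil>log 2 (real n)\<rceil>) + real (3 * L)) + 1 \<Longrightarrow>
      real (Lam.wdist u v) \<le> real n / 300"
    using maps[of n W] by blast
  \<comment> \<open>The number of halvings in \<open>geodesic_near_chain\<close>. R is the resulting
    distance for chains with jumps at most 3 * L.\<close>
  define k where "k = nat \<lceil>log 2 (real n)\<rceil>"
  define R where "R = \<delta> * real k + real (3 * L)"
  have nk: "n \<le> 2 ^ k"
  proof -
    have "log 2 (real n) \<le> real k" by (simp add: k_def) linarith
    then have "real n \<le> 2 powr real k" using n by (simp add: log_le_iff)
    then have "real n \<le> real (2 ^ k)" by (simp add: powr_realpow)
    then show ?thesis by (simp only: of_nat_le_iff)
  qed
  define V where "V u = Gam.vertex (f u)" for u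
  have V: "V u \<in> Gam.pts" if "u \<in> carrier \<Lambda>" for u unfolding V_def using Gam.pts_vertex f that by blast
  have V_dist: "Gam.cd (V u) (V u') = real (Gam.wdist (f u) (f u'))"
    if "u \<in> carrier \<Lambda>" "u' \<in> carrier \<Lambda>" for u u'
    unfolding V_def using Gam.cayley_dist_vertex f that by blast
  have V_step: "Gam.cd (V u) (V u') \<le> real (3 * L)"
    if "u \<in> carrier \<Lambda>" "u' \<in> carrier \<Lambda>" "Lam.wdist u u' \<le> 3" for u u'
  proof -
    have "Gam.wdist (f u) (f u') \<le> L * Lam.wdist u u'" using lip that by blast
    also have "\<dots> \<le> L * 3" using that(3) by (rule mult_left_mono) simp
    finally show ?thesis unfolding V_dist[OF that(1,2)] of_nat_le_iff by simp
  qed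
  have near: "real (Lam.wdist u u') \<le> real n / 300"
    if "u \<in> W" "u' \<in> W" "Gam.cd (V u) (V u') \<le> 2 * R + 1" for u u'
  proof -
    have "u \<in> carrier \<Lambda>" "u' \<in> carrier \<Lambda>" using that \<open>W \<subseteq> carrier \<Lambda>\<close> by auto
    then have "real (Gam.wdist (f u) (f u')) \<le> 2 * R + 1" using that(3) V_dist by metis
    then show ?thesis using exp[OF that(1,2)] unfolding R_def k_def by blast
  qed
  have v0n: "v 0 \<in> carrier \<Lambda>" "v n \<in> carrier \<Lambda>" using vw by auto
  obtain B where B: "geodesic_segment Gam.pts Gam.cd (V (v 0)) (V (v n)) B"
    using Gam.cayley_geodesic V[OF v0n(1)] V[OF v0n(2)] unfolding geodesic_metric_space_def by metis
  have near_v: "\<exists>i\<le>n. Gam.cd z (V (v i)) \<le> R" if "z \<in> B" for z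
    unfolding R_def
    by (rule geodesic_near_chain[OF hyp _ _ _ nk _ that, of "\<lambda>i. V (v i)"])
      (use V vw V_step v_step B in auto)
  have near_w: "\<exists>j\<le>n. Gam.cd z (V (w j)) \<le> R" if "z \<in> B" for z
    unfolding R_def
    by (rule geodesic_near_chain[OF hyp _ _ _ nk _ that, of "\<lambda>i. V (w i)"])
      (use V vw V_step w_step B ends in auto)
  let ?l' = "Gam.cd (V (v 0)) (V (v n))"
  obtain b where b: "geodesic_curve Gam.pts Gam.cd b ?l'" "b 0 = V (v 0)" "b ?l' = V (v n)" "B = b ` {0..?l'}"
    using B unfolding MG.geodesic_segment_iff by blast
  define \<tau> where "\<tau> m = min (real m) ?l'" for m
  have \<tau>: "\<tau> m \<in> {0..?l'}" "\<bar>\<tau> m - \<tau> (Suc m)\<bar> \<le> 1" "\<tau> 0 = 0" for m by (auto simp: \<tau>_def)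
  have b\<tau>: "b (\<tau> m) \<in> B" for m using b(4) \<tau>(1) by blast
  have BM: "B \<subseteq> Gam.pts" using MG.geodesic_subset[OF B] .
  have R0: "0 \<le> R" using hyp by (simp add: R_def delta_hyperbolic_space_def)
  \<comment> \<open>The m-th sample point of B is near the image of a geodesic sample before y (P)
    or after y (Q). At least one always holds, P at the start and Q at the end, so P and Q hold at
    the same or at adjacent sample points.\<close>
  define P where "P m \<longleftrightarrow> (\<exists>j\<le>n. \<sigma> j \<le> s \<and> Gam.cd (b (\<tau> m)) (V (w j)) \<le> R)" for m
  define Q where "Q m \<longleftrightarrow> (\<exists>j\<le>n. s \<le> \<sigma> j \<and> Gam.cd (b (\<tau> m)) (V (w j)) \<le> R)" for m
  have PQ: "P m \<or> Q m" for m unfolding P_def Q_def using near_w[OF b\<tau>] by (meson linear)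
  have P0: "P 0"
    unfolding P_def using s \<sigma>(2) \<tau>(3) ends(1) b(2) V[OF v0n(1)] R0 by (intro exI[of _ 0]) auto
  have "Q (nat \<lceil>?l'\<rceil>)"
  proof -
    have "\<tau> (nat \<lceil>?l'\<rceil>) = ?l'" 
      unfolding \<tau>_def using real_nat_ceiling_ge by (rule min_absorb2)
    then show ?thesis
      unfolding Q_def using s \<sigma>(3) ends(2) b(3) V[OF v0n(2)] R0 by (intro exI[of _ n]) auto
  qed
  then obtain m' where m': "Q m'" "\<And>m. m < m' \<Longrightarrow> \<not> Q m" using exists_least_iff[of Q] by blast
  have "\<exists>m. P m \<and> \<bar>\<tau> m - \<tau> m'\<bar> \<le> 1"
  proof (cases m')
    case 0
    then show ?thesis using P0 by (intro exI[of _ 0]) auto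
  next
    case (Suc m)
    then show ?thesis using PQ[of m] m'(2)[of m] \<tau>(2)[of m] by (intro exI[of _ m]) auto
  qed
  then obtain m where m: "P m" "\<bar>\<tau> m - \<tau> m'\<bar> \<le> 1" by blast
  obtain j where j: "j \<le> n" "\<sigma> j \<le> s" "Gam.cd (b (\<tau> m)) (V (w j)) \<le> R" using m(1) unfolding P_def by blast
  obtain j' where j': "j' \<le> n" "s \<le> \<sigma> j'" "Gam.cd (b (\<tau> m')) (V (w j')) \<le> R"
    using m'(1) unfolding Q_def by blast
  obtain i where i: "i \<le> n" "Gam.cd (b (\<tau> m)) (V (v i)) \<le> R" using near_v[OF b\<tau>] by blast
  have W: "w j \<in> W" "w j' \<in> W" "v i \<in> W" using i j j' by (auto simp: W_def)
  have pts: "V (w j) \<in> Gam.pts" "V (w j') \<in> Gam.pts" "V (v i) \<in> Gam.pts"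
    "b (\<tau> m) \<in> Gam.pts" "b (\<tau> m') \<in> Gam.pts" using V vw i b\<tau> BM by auto
  \<comment> \<open>This is where the threshold 2 * R + 1 comes from. By expansion the samples j and
    j' are close in \<Lambda>, and y lies between them.\<close>
  have "Gam.cd (V (w j)) (V (w j')) \<le> Gam.cd (V (w j)) (b (\<tau> m)) + Gam.cd (b (\<tau> m)) (b (\<tau> m'))
      + Gam.cd (b (\<tau> m')) (V (w j'))"
    using MG.triangle[of "V (w j)" "b (\<tau> m)" "V (w j')"] MG.triangle[of "b (\<tau> m)" "b (\<tau> m')" "V (w j')"] pts
    by simp
  also have "Gam.cd (b (\<tau> m)) (b (\<tau> m')) \<le> 1" using MG.geodesic_curve_dist[OF b(1) \<tau>(1) \<tau>(1)] m(2) by simp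
  finally have "Gam.cd (V (w j)) (V (w j')) \<le> 2 * R + 1"
    using j(3) j'(3) MG.commute[of "V (w j)" "b (\<tau> m)"] by simp
  then have "real (Lam.wdist (w j) (w j')) \<le> real n / 300" using near W by blast
  then have "Lam.cd (c (\<sigma> j)) (c (\<sigma> j')) \<le> real n / 300 + 2"
    using r_dist(2)[OF c\<sigma> c\<sigma>, of j j'] by (simp add: w_def)
  then have "s - \<sigma> j \<le> real n / 300 + 2"
    using MX.geodesic_curve_dist[OF c(1) \<sigma>(1) \<sigma>(1), of j j'] j'(2) by simp
  then have "Lam.cd y (c (\<sigma> j)) \<le> real n / 300 + 2"
    using MX.geodesic_curve_dist[OF c(1) s(1) \<sigma>(1), of j] j(2) s(2) by simp
  moreover have "Lam.cd (c (\<sigma> j)) (x i) \<le> real n / 300 + 2"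
  proof -
    have "Gam.cd (V (w j)) (V (v i)) \<le> Gam.cd (V (w j)) (b (\<tau> m)) + Gam.cd (b (\<tau> m)) (V (v i))"
      using MG.triangle pts by blast
    then have "Gam.cd (V (w j)) (V (v i)) \<le> 2 * R + 1"
      using j(3) i(2) MG.commute[of "V (w j)" "b (\<tau> m)"] by simp
    then have "real (Lam.wdist (w j) (v i)) \<le> real n / 300" using near W by blast
    then show ?thesis using r_dist(2)[OF c\<sigma>, of "x i" j] x i(1) by (simp add: w_def v_def)
  qed
  moreover have "Lam.cd y (x i) \<le> Lam.cd y (c (\<sigma> j)) + Lam.cd (c (\<sigma> j)) (x i)"
    using MX.triangle[of y "c (\<sigma> j)" "x i"] c\<sigma> x i(1) s MX.geodesic_curve_in[OF c(1) s(1)] by auto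
  \<comment> \<open>2 (n / 300 + 2) \<le> n / 100 because n \<ge> 1200.\<close>
  ultimately have "Lam.cd y (x i) \<le> real n / 100" using n by simp
  then show "\<exists>i\<le>n. Lam.cd y (x i) \<le> real n / 100" using i(1) by blast
qed

end

theorem corollary4p3:
  fixes \<Gamma> :: "('g, 'a) monoid_scheme" and S\<^sub>\<Gamma> :: "'g set"
    and \<Lambda> :: "('h, 'b) monoid_scheme" and S\<^sub>\<Lambda> :: "'h set"
    and M :: "'w measure"
    and act\<^sub>\<Gamma> :: "'g \<Rightarrow> 'w \<Rightarrow> 'w" and act\<^sub>\<Lambda> :: "'h \<Rightarrow> 'w \<Rightarrow> 'w"
    and X\<^sub>\<Gamma> X\<^sub>\<Lambda> :: "'w set"
    and \<delta> p :: real
  assumes "group \<Gamma>" and "finite_generating_set \<Gamma> S\<^sub>\<Gamma>" and "set_inv\<^bsub>\<Gamma>\<^esub> S\<^sub>\<Gamma> = S\<^sub>\<Gamma>"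
    and "delta_hyperbolic_group \<delta> \<Gamma> S\<^sub>\<Gamma>"
    and "ereal p > 108 * ereal \<delta> * volume_entropy \<Gamma> S\<^sub>\<Gamma> + 2"
    and "group \<Lambda>" and "finite_generating_set \<Lambda> S\<^sub>\<Lambda>"
    and "me_coupling \<Gamma> \<Lambda> M act\<^sub>\<Gamma> act\<^sub>\<Lambda> X\<^sub>\<Gamma> X\<^sub>\<Lambda>"
    and "cobounded \<Lambda> act\<^sub>\<Lambda> X\<^sub>\<Gamma> X\<^sub>\<Lambda>"
    and "Lp_Linf_integrable p \<Gamma> S\<^sub>\<Gamma> \<Lambda> S\<^sub>\<Lambda> M act\<^sub>\<Gamma> act\<^sub>\<Lambda> X\<^sub>\<Gamma> X\<^sub>\<Lambda>"
  shows "hyperbolic_group \<Lambda> S\<^sub>\<Lambda>"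
proof -
  interpret two_fg_groups \<Gamma> S\<^sub>\<Gamma> \<Lambda> S\<^sub>\<Lambda>
    by (simp add: two_fg_groups_def fg_group_def fg_group_axioms_def assms)
  have hyp: "delta_hyperbolic_space \<delta> Gam.pts Gam.cd" and \<delta>: "0 \<le> \<delta>"
    using assms(4) by (auto simp: delta_hyperbolic_group_def delta_hyperbolic_space_def)
  obtain e A where p: "2 < p" and e: "0 \<le> e" and A: "0 < A" and eA: "3 * \<delta> * e + 2 < p"
    and ball: "\<And>k. real (card (Gam.word_ball k)) \<le> real (k + 1) * A * exp (e * real k)"
    using Gam.word_ball_growth[OF assms(3) \<delta> assms(5)] by blast
  interpret C: integrable_coupling \<Gamma> \<Lambda> M act\<^sub>\<Gamma> act\<^sub>\<Lambda> X\<^sub>\<Gamma> X\<^sub>\<Lambda> S\<^sub>\<Gamma> S\<^sub>\<Lambda> p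
    using assms p by (simp add: integrable_coupling_def integrable_coupling_axioms_def)
  obtain L c \<kappa> where \<kappa>: "0 < \<kappa>" and maps: "\<And>k a W. \<lbrakk>0 < a; finite W; W \<subseteq> carrier \<Lambda>;
      real ((card W)\<^sup>2 * (card (Gam.word_ball k) * k)) < \<kappa> * a powr p\<rbrakk> \<Longrightarrow>
    \<exists>f. (\<forall>u\<in>carrier \<Lambda>. f u \<in> carrier \<Gamma>) \<and>
      (\<forall>u\<in>carrier \<Lambda>. \<forall>v\<in>carrier \<Lambda>. Gam.wdist (f u) (f v) \<le> L * Lam.wdist u v) \<and>
      (\<forall>u\<in>W. \<forall>v\<in>W. Gam.wdist (f u) (f v) \<le> k \<longrightarrow> real (Lam.wdist u v) \<le> real c + real k * a)"
    using C.expanding_lipschitz_map by metis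
  \<comment> \<open>Collects the terms of R + 1 below that do not grow with n: 2 * \<delta> from
    rounding up the logarithm, 6 * L from the jumps, and 2 from the summand 1 in R and the rounding
    of R.\<close>
  define K\<^sub>0 where "K\<^sub>0 = 2 * \<delta> + 6 * real L + 2"
  have "0 \<le> K\<^sub>0" using \<delta> by (simp add: K\<^sub>0_def)
  from eventually_scale[OF \<delta> e A \<kappa> eA this]
  obtain N\<^sub>1 where N\<^sub>1: "\<And>n k. \<lbrakk>N\<^sub>1 \<le> n; 1 \<le> k; real k \<le> 3 * \<delta> * ln (real n) + K\<^sub>0\<rbrakk> \<Longrightarrow>
    (real (2 * n + 2))\<^sup>2 * (real (k + 1) * A * exp (e * real k) * real k)
      < \<kappa> * (real n / (600 * real k)) powr p"
    unfolding eventually_sequentially by blast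
  define N\<^sub>0 where "N\<^sub>0 = max N\<^sub>1 (max (600 * c) 1)"
  have "tracks_geodesics Lam.pts Lam.cd (max N\<^sub>0 1200)"
  proof (rule tracks_geodesics_if_expanding[OF hyp])
    fix n W assume n: "N\<^sub>0 \<le> n" and W: "finite W" "W \<subseteq> carrier \<Lambda>" "card W \<le> 2 * n + 2"
    define R where "R = 2 * (\<delta> * real (nat \<lceil>log 2 (real n)\<rceil>) + real (3 * L)) + 1"
    define k where "k = nat \<lceil>R\<rceil>"
    \<comment> \<open>Then k * a = n / 600, and c \<le> n / 600 takes the other half of n /
      300.\<close>
    define a where "a = real n / (600 * real k)"
    have n1: "1 \<le> real n" "N\<^sub>1 \<le> n" "600 * real c \<le> real n" using n by (auto simp: N\<^sub>0_def)
    have R1: "1 \<le> R" using \<delta> by (simp add: R_def)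
    then have k1: "1 \<le> k" "R \<le> real k" "real k \<le> R + 1" by (auto simp: k_def) linarith+
    have a: "0 < a" using n1 k1 by (simp add: a_def)
    have "real k \<le> 3 * \<delta> * ln (real n) + K\<^sub>0"
    proof -
      \<comment> \<open>From ln 2 \<ge> 2 / 3, a binary logarithm is at most 3 / 2 times the natural
        one; so 2 \<delta> log n in R turns into the 3 \<delta> ln n of
        \<open>eventually_scale\<close>.\<close>
      have "ln (real n) * 2 \<le> ln (real n) * (3 * ln 2)"
        using ln2_ge_two_thirds n1(1) by (intro mult_left_mono) auto
      then have "log 2 (real n) \<le> 3 / 2 * ln (real n)" by (simp add: log_def divide_simps)
      moreover have "0 \<le> log 2 (real n)" using n1(1) by simp
      then have "real (nat \<lceil>log 2 (real n)\<rceil>) \<le> log 2 (real n) + 1" by linarith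
      ultimately have "real (nat \<lceil>log 2 (real n)\<rceil>) \<le> 3 / 2 * ln (real n) + 1" by linarith
      from mult_left_mono[OF this \<delta>] show ?thesis
        using k1(3) by (simp add: R_def K\<^sub>0_def algebra_simps)
    qed
    note scale = N\<^sub>1[OF n1(2) k1(1) this]
    have "real ((card W)\<^sup>2 * (card (Gam.word_ball k) * k))
      = (real (card W))\<^sup>2 * (real (card (Gam.word_ball k)) * real k)" by simp
    also have "\<dots> \<le> (real (2 * n + 2))\<^sup>2 * (real (k + 1) * A * exp (e * real k) * real k)"
      using W(3) ball A by (intro mult_mono power_mono) auto
    also note scale
    finally obtain f where f: "\<forall>u\<in>carrier \<Lambda>. f u \<in> carrier \<Gamma>"
      "\<forall>u\<in>carrier \<Lambda>. \<forall>v\<in>carrier \<Lambda>. Gam.wdist (f u) (f v) \<le> L * Lam.wdist u v"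
      "\<And>u v. \<lbrakk>u \<in> W; v \<in> W; Gam.wdist (f u) (f v) \<le> k\<rbrakk> \<Longrightarrow> real (Lam.wdist u v) \<le> real c + real k * a"
      using maps[OF a W(1,2), of k] unfolding a_def by blast
    have "real (Lam.wdist u v) \<le> real n / 300"
      if "u \<in> W" "v \<in> W" "real (Gam.wdist (f u) (f v)) \<le> R" for u v
    proof -
      have "real (Gam.wdist (f u) (f v)) \<le> real k" using that(3) k1(2) by linarith
      then have "real (Lam.wdist u v) \<le> real c + real k * a" using f(3) that by simp
      also have "real k * a = real n / 600" using k1(1) by (simp add: a_def)
      finally show ?thesis using n1(3) by simp
    qed
    then show "\<exists>f. (\<forall>u\<in>carrier \<Lambda>. f u \<in> carrier \<Gamma>) \<and>
        (\<forall>u\<in>carrier \<Lambda>. \<forall>v\<in>carrier \<Lambda>. Gam.wdist (f u) (f v) \<le> L * Lam.wdist u v) \<and>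
        (\<forall>u\<in>W. \<forall>v\<in>W.
          real (Gam.wdist (f u) (f v)) \<le> 2 * (\<delta> * real (nat \<lceil>log 2 (real n)\<rceil>) + real (3 * L)) + 1 \<longrightarrow>
          real (Lam.wdist u v) \<le> real n / 300)"
      using f(1,2) unfolding R_def by blast
  qed
  then show ?thesis
    using Metric_space.tracks_geodesics_imp_hyperbolic[OF Lam.cayley_Metric_space Lam.cayley_geodesic]
      assms(6,7) by (simp add: hyperbolic_group_def delta_hyperbolic_group_def)
qed

end
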